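(* If $\mathcal C$ is a lextensive category, then $\mathsf{Fam}(\mathcal C)$ is lextensive as well, and the coproduct functor $\sum\colon\mathsf{Fam}(\mathcal C)\to\mathcal C$ preserves finite limits.
   Context: A category $\mathcal C$ with small coproducts is extensive if $\sum\colon\prod_{i\in I}\mathcal C\downarrow X_i\to\mathcal C\downarrow\sum_{i\in I}X_i$ is an equivalence for all small families $(X_i)_{i\in I}$ of objects; it is lextensive if moreover it has all finite limits. $\mathsf{Fam}(\mathcal C)$ is the free coproduct completion: objects are set-indexed families $(c_x)_{x\in X}$ of objects of $\mathcal C$; a morphism $(c_x)_{x\in X}\to(d_y)_{y\in Y}$ is a function $f\colon X\to Y$ with morphisms $c_x\to d_{fx}$, $x\in X$. The functor $\sum$ sends a family $(c_x)_{x\in X}$ to $\sum_{x\in X}c_x$. *)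

theory Defs
  imports "HOL-Library.FuncSet" "HOL-Library.Countable_Set"
begin

section \<open>Categories and functors\<close>

text \<open>\<open>Comp C g f\<close> is "\<open>g\<close> after \<open>f\<close>". No smallness condition is imposed on
  the objects or the homs of a category.\<close>

record ('o, 'a) cat =
  Obj :: "'o set"
  Arr :: "'a set"
  Dom :: "'a \<Rightarrow> 'o"
  Cod :: "'a \<Rightarrow> 'o"
  Ide :: "'o \<Rightarrow> 'a"
  Comp :: "'a \<Rightarrow> 'a \<Rightarrow> 'a"

definition hom :: "('o, 'a) cat \<Rightarrow> 'o \<Rightarrow> 'o \<Rightarrow> 'a set" where
  "hom C x y = {f \<in> Arr C. Dom C f = x \<and> Cod C f = y}"

locale category =
  fixes C :: "('o, 'a) cat"
  assumes Dom_Obj: "f \<in> Arr C \<Longrightarrow> Dom C f \<in> Obj C"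
    and Cod_Obj: "f \<in> Arr C \<Longrightarrow> Cod C f \<in> Obj C"
    and Ide_hom: "x \<in> Obj C \<Longrightarrow> Ide C x \<in> hom C x x"
    and Comp_hom: "f \<in> hom C x y \<Longrightarrow> g \<in> hom C y z \<Longrightarrow> Comp C g f \<in> hom C x z"
    and Comp_Ide: "f \<in> hom C x y \<Longrightarrow> Comp C f (Ide C x) = f"
    and Ide_Comp: "f \<in> hom C x y \<Longrightarrow> Comp C (Ide C y) f = f"
    and Comp_assoc: "f \<in> hom C w x \<Longrightarrow> g \<in> hom C x y \<Longrightarrow> h \<in> hom C y z \<Longrightarrow>
      Comp C h (Comp C g f) = Comp C (Comp C h g) f"

definition iso :: "('o, 'a) cat \<Rightarrow> 'o \<Rightarrow> 'o \<Rightarrow> 'a \<Rightarrow> bool" where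
  "iso C x y f \<longleftrightarrow> f \<in> hom C x y \<and>
    (\<exists>g \<in> hom C y x. Comp C g f = Ide C x \<and> Comp C f g = Ide C y)"

record ('o, 'a, 'p, 'b) func =
  FObj :: "'o \<Rightarrow> 'p"
  FArr :: "'a \<Rightarrow> 'b"

locale is_functor = A: category A + B: category B
  for A :: "('o, 'a) cat" and B :: "('p, 'b) cat" +
  fixes F :: "('o, 'a, 'p, 'b) func"
  assumes FObj_Obj: "x \<in> Obj A \<Longrightarrow> FObj F x \<in> Obj B"
    and FArr_hom: "f \<in> hom A x y \<Longrightarrow> FArr F f \<in> hom B (FObj F x) (FObj F y)"
    and FArr_Ide: "x \<in> Obj A \<Longrightarrow> FArr F (Ide A x) = Ide B (FObj F x)"
    and FArr_Comp: "f \<in> hom A x y \<Longrightarrow> g \<in> hom A y z \<Longrightarrow>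
      FArr F (Comp A g f) = Comp B (FArr F g) (FArr F f)"

definition id_func :: "('o, 'a, 'o, 'a) func" where
  "id_func = \<lparr>FObj = (\<lambda>x. x), FArr = (\<lambda>f. f)\<rparr>"

definition comp_func ::
  "('p, 'b, 'q, 'c) func \<Rightarrow> ('o, 'a, 'p, 'b) func \<Rightarrow> ('o, 'a, 'q, 'c) func" where
  "comp_func G F = \<lparr>FObj = (\<lambda>x. FObj G (FObj F x)), FArr = (\<lambda>f. FArr G (FArr F f))\<rparr>"

locale natural_iso = F: is_functor A B F + G: is_functor A B G
  for A :: "('o, 'a) cat" and B :: "('p, 'b) cat"
    and F G :: "('o, 'a, 'p, 'b) func" +
  fixes \<eta> :: "'o \<Rightarrow> 'b"
  assumes component_iso: "x \<in> Obj A \<Longrightarrow> iso B (FObj F x) (FObj G x) (\<eta> x)"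
    and natural: "f \<in> hom A x y \<Longrightarrow>
      Comp B (\<eta> y) (FArr F f) = Comp B (FArr G f) (\<eta> x)"

definition equivalence ::
  "('o, 'a) cat \<Rightarrow> ('p, 'b) cat \<Rightarrow> ('o, 'a, 'p, 'b) func \<Rightarrow> bool" where
  "equivalence A B F \<longleftrightarrow> is_functor A B F \<and>
    (\<exists>G \<eta> \<epsilon>. is_functor B A G \<and>
      natural_iso A A id_func (comp_func G F) \<eta> \<and>
      natural_iso B B (comp_func F G) id_func \<epsilon>)"


section \<open>Slice categories and products of categories\<close>

text \<open>A morphism of the slice over \<open>X\<close> is a triple \<open>(f, h, g)\<close>: source object, underlying
  morphism, target object.\<close>

definition slice :: "('o, 'a) cat \<Rightarrow> 'o \<Rightarrow> ('a, 'a \<times> 'a \<times> 'a) cat" where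
  "slice C X = \<lparr>
    Obj = {f \<in> Arr C. Cod C f = X},
    Arr = {(f, h, g). f \<in> Arr C \<and> Cod C f = X \<and> g \<in> Arr C \<and> Cod C g = X \<and>
      h \<in> hom C (Dom C f) (Dom C g) \<and> Comp C g h = f},
    Dom = (\<lambda>(f, h, g). f),
    Cod = (\<lambda>(f, h, g). g),
    Ide = (\<lambda>f. (f, Ide C (Dom C f), f)),
    Comp = (\<lambda>(g', k, e) (f, h, g). (f, Comp C k h, e))\<rparr>"

definition prod_cat :: "'u set \<Rightarrow> ('u \<Rightarrow> ('o, 'a) cat) \<Rightarrow> ('u \<Rightarrow> 'o, 'u \<Rightarrow> 'a) cat" where
  "prod_cat I A = \<lparr>
    Obj = (\<Pi>\<^sub>E i\<in>I. Obj (A i)),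
    Arr = (\<Pi>\<^sub>E i\<in>I. Arr (A i)),
    Dom = (\<lambda>f. \<lambda>i\<in>I. Dom (A i) (f i)),
    Cod = (\<lambda>f. \<lambda>i\<in>I. Cod (A i) (f i)),
    Ide = (\<lambda>x. \<lambda>i\<in>I. Ide (A i) (x i)),
    Comp = (\<lambda>g f. \<lambda>i\<in>I. Comp (A i) (g i) (f i))\<rparr>"


section \<open>Finite limits\<close>

definition is_cone ::
  "('j, 'k) cat \<Rightarrow> ('o, 'a) cat \<Rightarrow> ('j, 'k, 'o, 'a) func \<Rightarrow> 'o \<Rightarrow> ('j \<Rightarrow> 'a) \<Rightarrow> bool" where
  "is_cone J C D L \<pi> \<longleftrightarrow> L \<in> Obj C \<and> (\<forall>j \<in> Obj J. \<pi> j \<in> hom C L (FObj D j)) \<and>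
    (\<forall>u \<in> Arr J. Comp C (FArr D u) (\<pi> (Dom J u)) = \<pi> (Cod J u))"

definition is_limit ::
  "('j, 'k) cat \<Rightarrow> ('o, 'a) cat \<Rightarrow> ('j, 'k, 'o, 'a) func \<Rightarrow> 'o \<Rightarrow> ('j \<Rightarrow> 'a) \<Rightarrow> bool" where
  "is_limit J C D L \<pi> \<longleftrightarrow> is_cone J C D L \<pi> \<and>
    (\<forall>M \<mu>. is_cone J C D M \<mu> \<longrightarrow>
      (\<exists>!h. h \<in> hom C M L \<and> (\<forall>j \<in> Obj J. Comp C (\<pi> j) h = \<mu> j)))"

text \<open>Every finite category is isomorphic to one whose objects and morphisms are natural
  numbers, so these suffice as shapes of finite diagrams.\<close>

definition finite_category :: "(nat, nat) cat \<Rightarrow> bool" where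
  "finite_category J \<longleftrightarrow> category J \<and> finite (Obj J) \<and> finite (Arr J)"

definition has_finite_limits :: "('o, 'a) cat \<Rightarrow> bool" where
  "has_finite_limits C \<longleftrightarrow>
    (\<forall>J D. finite_category J \<longrightarrow> is_functor J C D \<longrightarrow> (\<exists>L \<pi>. is_limit J C D L \<pi>))"

definition preserves_finite_limits ::
  "('o, 'a) cat \<Rightarrow> ('p, 'b) cat \<Rightarrow> ('o, 'a, 'p, 'b) func \<Rightarrow> bool" where
  "preserves_finite_limits A B F \<longleftrightarrow> is_functor A B F \<and>
    (\<forall>J D L \<pi>. finite_category J \<longrightarrow> is_functor J A D \<longrightarrow> is_limit J A D L \<pi> \<longrightarrow>
      is_limit J B (comp_func F D) (FObj F L) (\<lambda>j. FArr F (\<pi> j)))"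


section \<open>Smallness\<close>

text \<open>HOL has no distinguished universe of small sets, so smallness is a parameter: a predicate
  on the subsets of an infinite type \<open>'u\<close> from which all index sets are drawn. The conditions
  are those satisfied by the small sets relative to a Grothendieck universe \<open>'u\<close>; closure
  under power sets is not required. In contrast to the full list of universe axioms, they have
  models in HOL, for instance the countable subsets of any infinite type.\<close>

locale smallness =
  fixes small :: "'u set \<Rightarrow> bool"
  assumes infinite_UNIV: "infinite (UNIV :: 'u set)"
    and small_finite: "finite A \<Longrightarrow> small A"
    and small_subset: "small A \<Longrightarrow> B \<subseteq> A \<Longrightarrow> small B"
    and small_image: "small A \<Longrightarrow> small (f ` A)"
    and small_UN: "small I \<Longrightarrow> (\<And>i. i \<in> I \<Longrightarrow> small (X i)) \<Longrightarrow> small (\<Union>i\<in>I. X i)"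

lemma smallness_countable:
  assumes "infinite (UNIV :: 'u set)"
  shows "smallness (countable :: 'u set \<Rightarrow> bool)"
  using assms by unfold_locales (auto intro: countable_finite countable_subset)


section \<open>Coproducts\<close>

definition is_coproduct ::
  "('o, 'a) cat \<Rightarrow> 'u set \<Rightarrow> ('u \<Rightarrow> 'o) \<Rightarrow> 'o \<Rightarrow> ('u \<Rightarrow> 'a) \<Rightarrow> bool" where
  "is_coproduct C I X S \<iota> \<longleftrightarrow> S \<in> Obj C \<and> (\<forall>i\<in>I. \<iota> i \<in> hom C (X i) S) \<and>
    (\<forall>Y \<in> Obj C. \<forall>g. (\<forall>i\<in>I. g i \<in> hom C (X i) Y) \<longrightarrow>
      (\<exists>!h. h \<in> hom C S Y \<and> (\<forall>i\<in>I. Comp C h (\<iota> i) = g i)))"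

definition has_small_coproducts :: "('u set \<Rightarrow> bool) \<Rightarrow> ('o, 'a) cat \<Rightarrow> bool" where
  "has_small_coproducts small C \<longleftrightarrow>
    (\<forall>I X. small I \<longrightarrow> (\<forall>i\<in>I. X i \<in> Obj C) \<longrightarrow> (\<exists>S \<iota>. is_coproduct C I X S \<iota>))"

text \<open>A choice of coproducts, which turns the coproduct into an operation; nothing is known about
  it beyond the universal property.\<close>

definition coproduct :: "('o, 'a) cat \<Rightarrow> 'u set \<Rightarrow> ('u \<Rightarrow> 'o) \<Rightarrow> 'o \<times> ('u \<Rightarrow> 'a)" where
  "coproduct C I X = (SOME (S, \<iota>). is_coproduct C I X S \<iota>)"

definition coprod :: "('o, 'a) cat \<Rightarrow> 'u set \<Rightarrow> ('u \<Rightarrow> 'o) \<Rightarrow> 'o" where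
  "coprod C I X = fst (coproduct C I X)"

definition incl :: "('o, 'a) cat \<Rightarrow> 'u set \<Rightarrow> ('u \<Rightarrow> 'o) \<Rightarrow> 'u \<Rightarrow> 'a" where
  "incl C I X = snd (coproduct C I X)"

definition cotuple ::
  "('o, 'a) cat \<Rightarrow> 'u set \<Rightarrow> ('u \<Rightarrow> 'o) \<Rightarrow> 'o \<Rightarrow> ('u \<Rightarrow> 'a) \<Rightarrow> 'a" where
  "cotuple C I X Y g =
    (THE h. h \<in> hom C (coprod C I X) Y \<and> (\<forall>i\<in>I. Comp C h (incl C I X i) = g i))"

definition coprod_map :: "('o, 'a) cat \<Rightarrow> 'u set \<Rightarrow> ('u \<Rightarrow> 'a) \<Rightarrow> 'a" where
  "coprod_map C I f =
    cotuple C I (\<lambda>i. Dom C (f i)) (coprod C I (\<lambda>i. Cod C (f i)))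
      (\<lambda>i. Comp C (incl C I (\<lambda>i. Cod C (f i)) i) (f i))"


section \<open>Extensive and lextensive categories\<close>

text \<open>The functor from the product of the slices over \<open>X i\<close>, \<open>i \<in> I\<close>, to the slice over
  \<open>coprod C I X\<close>; the family \<open>X\<close> is recovered from the codomains of the objects.\<close>

definition slice_sum ::
  "('o, 'a) cat \<Rightarrow> 'u set \<Rightarrow> ('u \<Rightarrow> 'a, 'u \<Rightarrow> 'a \<times> 'a \<times> 'a, 'a, 'a \<times> 'a \<times> 'a) func" where
  "slice_sum C I = \<lparr>
    FObj = coprod_map C I,
    FArr = (\<lambda>t. (coprod_map C I (\<lambda>i. fst (t i)),
                 coprod_map C I (\<lambda>i. fst (snd (t i))),
                 coprod_map C I (\<lambda>i. snd (snd (t i)))))\<rparr>"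

definition extensive :: "('u set \<Rightarrow> bool) \<Rightarrow> ('o, 'a) cat \<Rightarrow> bool" where
  "extensive small C \<longleftrightarrow> category C \<and> has_small_coproducts small C \<and>
    (\<forall>I X. small I \<longrightarrow> (\<forall>i\<in>I. X i \<in> Obj C) \<longrightarrow>
      equivalence (prod_cat I (\<lambda>i. slice C (X i))) (slice C (coprod C I X)) (slice_sum C I))"

definition lextensive :: "('u set \<Rightarrow> bool) \<Rightarrow> ('o, 'a) cat \<Rightarrow> bool" where
  "lextensive small C \<longleftrightarrow> extensive small C \<and> has_finite_limits C"


section \<open>The free coproduct completion\<close>

record ('u, 'o) fam =
  Ix :: "'u set"
  At :: "'u \<Rightarrow> 'o"

record ('u, 'o, 'a) fam_arr =
  FDom :: "('u, 'o) fam"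
  FCod :: "('u, 'o) fam"
  IxMap :: "'u \<Rightarrow> 'u"
  AtMap :: "'u \<Rightarrow> 'a"

definition fam_obj :: "('u set \<Rightarrow> bool) \<Rightarrow> ('o, 'a) cat \<Rightarrow> ('u, 'o) fam set" where
  "fam_obj small C = {c. small (Ix c) \<and> At c \<in> Ix c \<rightarrow>\<^sub>E Obj C}"

definition Fam ::
  "('u set \<Rightarrow> bool) \<Rightarrow> ('o, 'a) cat \<Rightarrow> (('u, 'o) fam, ('u, 'o, 'a) fam_arr) cat" where
  "Fam small C = \<lparr>
    Obj = fam_obj small C,
    Arr = {f. FDom f \<in> fam_obj small C \<and> FCod f \<in> fam_obj small C \<and>
      IxMap f \<in> Ix (FDom f) \<rightarrow>\<^sub>E Ix (FCod f) \<and>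
      AtMap f \<in> (\<Pi>\<^sub>E x \<in> Ix (FDom f). hom C (At (FDom f) x) (At (FCod f) (IxMap f x)))},
    Dom = FDom,
    Cod = FCod,
    Ide = (\<lambda>c. \<lparr>FDom = c, FCod = c,
      IxMap = (\<lambda>x\<in>Ix c. x), AtMap = (\<lambda>x\<in>Ix c. Ide C (At c x))\<rparr>),
    Comp = (\<lambda>g f. \<lparr>FDom = FDom f, FCod = FCod g,
      IxMap = (\<lambda>x\<in>Ix (FDom f). IxMap g (IxMap f x)),
      AtMap = (\<lambda>x\<in>Ix (FDom f). Comp C (AtMap g (IxMap f x)) (AtMap f x))\<rparr>)\<rparr>"

definition Sum_func ::
  "('o, 'a) cat \<Rightarrow> (('u, 'o) fam, ('u, 'o, 'a) fam_arr, 'o, 'a) func" where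
  "Sum_func C = \<lparr>
    FObj = (\<lambda>c. coprod C (Ix c) (At c)),
    FArr = (\<lambda>f. cotuple C (Ix (FDom f)) (At (FDom f)) (coprod C (Ix (FCod f)) (At (FCod f)))
      (\<lambda>x. Comp C (incl C (Ix (FCod f)) (At (FCod f)) (IxMap f x)) (AtMap f x)))\<rparr>"

end

(* A map from M into a coproduct of X i in an extensive category is a decomposition of M into pieces
   N i with maps N i -> X i; distinct inclusions have initial intersection and inclusions are monic.
   Conversely, pullback of families along inclusions and such decompositions make a category with
   coproducts extensive. In Fam(C) they are read off from the index sets, since a coproduct is a disjoint
   union of index sets.

   A limit in Fam(C) is indexed by the compatible families x in the limit of the index sets, with the
   limit in C of the diagram selected by x as its component at x.

   Given a cone from M over the image of a finite diagram under the coproduct functor, decompose M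
   jointly along its finitely many legs. On each piece N every leg factors through a single summand, so
   it is a map in Fam(C) from the singleton family on N. Unless N is initial, the summands are
   determined by the legs; hence these maps form a cone in Fam(C), and the limit there provides the
   required map on N. *)

theory Submission
  imports Defs
begin

text \<open>The two conditions that stand in for extensivity come from splitting the equivalence in
  its definition: full faithfulness of the slice sum amounts to the pullback condition, essential
  surjectivity to the decomposition condition. No quasi-inverse is ever written down for
  \<open>Fam\<close> itself.

  Three obstacles shape the rest. Coproducts are picked by \<open>SOME\<close>, so a concrete
  coproduct matches the chosen one only up to isomorphism; hence coproduct cocones in
  \<open>Fam\<close> are described up to invertible components. Index sets must be small subsets of
  \<open>'u\<close>, and smallness is not assumed to be closed under function spaces; compatible
  families of indices can be coded inside \<open>'u\<close> because diagrams are finite. On an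
  initial piece one leg may factor through several summands, so indices prove nothing there, but all
  equations between maps out of it hold anyway. Uniqueness of the mediating map in the sum meets the
  same ambiguity: the two candidates are decomposed jointly before they are compared.\<close>

lemma homI: "f \<in> Arr C \<Longrightarrow> Dom C f = x \<Longrightarrow> Cod C f = y \<Longrightarrow> f \<in> hom C x y"
  by (simp add: hom_def)

lemma homD:
  assumes "f \<in> hom C x y"
  shows "f \<in> Arr C" "Dom C f = x" "Cod C f = y"
  using assms by (simp_all add: hom_def)

section \<open>Cancellation of isomorphisms and initial objects\<close>

context category
begin

abbreviation comp (infixr "\<cdot>" 75) where "g \<cdot> f \<equiv> Comp C g f"

lemma hom_Obj:
  assumes "f \<in> hom C x y"
  shows "x \<in> Obj C" "y \<in> Obj C"
  using assms Dom_Obj Cod_Obj by (auto simp: hom_def)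

lemma Arr_hom: "f \<in> Arr C \<Longrightarrow> f \<in> hom C (Dom C f) (Cod C f)"
  by (simp add: hom_def)

lemma iso_cancel_left:
  assumes e: "iso C y z e" and f: "f \<in> hom C x y" and g: "g \<in> hom C x y" and eq: "e \<cdot> f = e \<cdot> g"
  shows "f = g"
proof -
  obtain d where e: "e \<in> hom C y z" and d: "d \<in> hom C z y" and de: "d \<cdot> e = Ide C y"
    using e by (auto simp: iso_def)
  have "f = d \<cdot> e \<cdot> f" using Comp_assoc[OF f e d] de Ide_Comp[OF f] by simp
  also have "\<dots> = g" using Comp_assoc[OF g e d] eq de Ide_Comp[OF g] by simp
  finally show ?thesis .
qed

lemma iso_cancel_right:
  assumes e: "iso C x y e" and f: "f \<in> hom C y z" and g: "g \<in> hom C y z" and eq: "f \<cdot> e = g \<cdot> e"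
  shows "f = g"
proof -
  obtain d where e: "e \<in> hom C x y" and d: "d \<in> hom C y x" and ed: "e \<cdot> d = Ide C y"
    using e by (auto simp: iso_def)
  have "f = (f \<cdot> e) \<cdot> d" using Comp_assoc[OF d e f] ed Comp_Ide[OF f] by simp
  also have "\<dots> = g" using Comp_assoc[OF d e g] eq ed Comp_Ide[OF g] by simp
  finally show ?thesis .
qed

definition initial :: "'o \<Rightarrow> bool" where
  "initial z \<longleftrightarrow> z \<in> Obj C \<and> (\<forall>y \<in> Obj C. \<exists>!h. h \<in> hom C z y)"

lemma initial_eq: "initial z \<Longrightarrow> f \<in> hom C z y \<Longrightarrow> g \<in> hom C z y \<Longrightarrow> f = g"
  unfolding initial_def using hom_Obj by blast

lemma initial_hom: "initial z \<Longrightarrow> y \<in> Obj C \<Longrightarrow> \<exists>h. h \<in> hom C z y"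
  unfolding initial_def by blast

end

section \<open>Equivalences\<close>

definition full_faithful :: "('o, 'a) cat \<Rightarrow> ('p, 'b) cat \<Rightarrow> ('o, 'a, 'p, 'b) func \<Rightarrow> bool" where
  "full_faithful A B F \<longleftrightarrow> (\<forall>x \<in> Obj A. \<forall>y \<in> Obj A. \<forall>g \<in> hom B (FObj F x) (FObj F y).
    \<exists>!f. f \<in> hom A x y \<and> FArr F f = g)"

definition ess_surj :: "('o, 'a) cat \<Rightarrow> ('p, 'b) cat \<Rightarrow> ('o, 'a, 'p, 'b) func \<Rightarrow> bool" where
  "ess_surj A B F \<longleftrightarrow> (\<forall>z \<in> Obj B. \<exists>x \<in> Obj A. \<exists>e. iso B (FObj F x) z e)"

text \<open>Naturality of \<open>\<eta>\<close> rewrites \<open>\<eta> y\<close> after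
  \<open>f\<close> as a composite that involves \<open>f\<close> only through
  \<open>FArr F f\<close>; the invertible \<open>\<eta> y\<close> is then cancelled.\<close>

lemma natural_iso_id_faithful:
  assumes "is_functor A B F" "is_functor B A G" "natural_iso A A id_func (comp_func G F) \<eta>"
    and f: "f \<in> hom A x y" and g: "g \<in> hom A x y" and eq: "FArr F f = FArr F g"
  shows "f = g"
proof -
  interpret natural_iso A A id_func "comp_func G F" \<eta> by fact
  have "Comp A (\<eta> y) f = Comp A (\<eta> y) g"
    using natural[OF f] natural[OF g] eq by (simp add: id_func_def comp_func_def)
  moreover have "iso A y (FObj (comp_func G F) y) (\<eta> y)"
    using component_iso[of y] F.A.hom_Obj[OF f] by (simp add: id_func_def)
  ultimately show ?thesis using F.A.iso_cancel_left f g by blast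
qed

text \<open>The variant for an isomorphism that points to the identity. With the roles of the two
  functors exchanged, it makes the quasi-inverse of an equivalence faithful.\<close>

lemma natural_iso_id_faithful':
  assumes "is_functor A B F" "is_functor B A G" "natural_iso A A (comp_func G F) id_func \<epsilon>"
    and f: "f \<in> hom A x y" and g: "g \<in> hom A x y" and eq: "FArr F f = FArr F g"
  shows "f = g"
proof -
  interpret natural_iso A A "comp_func G F" id_func \<epsilon> by fact
  have "Comp A f (\<epsilon> x) = Comp A g (\<epsilon> x)"
    using natural[OF f] natural[OF g] eq by (simp add: id_func_def comp_func_def)
  moreover have "iso A (FObj (comp_func G F) x) x (\<epsilon> x)"
    using component_iso[of x] F.A.hom_Obj[OF f] by (simp add: id_func_def)
  ultimately show ?thesis using F.A.iso_cancel_right f g by blast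
qed

lemma equivalence_imp_full_faithful:
  assumes "equivalence A B F"
  shows "full_faithful A B F"
proof -
  obtain G \<eta> \<epsilon> where F: "is_functor A B F" and G: "is_functor B A G"
    and \<eta>: "natural_iso A A id_func (comp_func G F) \<eta>"
    and \<epsilon>: "natural_iso B B (comp_func F G) id_func \<epsilon>"
    using assms by (auto simp: equivalence_def)
  interpret F: is_functor A B F by fact
  interpret G: is_functor B A G by fact
  interpret \<eta>: natural_iso A A id_func "comp_func G F" \<eta> by fact
  show ?thesis
    unfolding full_faithful_def
  proof (intro ballI)
    fix x y g assume x: "x \<in> Obj A" and y: "y \<in> Obj A" and g: "g \<in> hom B (FObj F x) (FObj F y)"
    let ?GF = "\<lambda>z. FObj G (FObj F z)"
    have ix: "\<eta> x \<in> hom A x (?GF x)"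
      using \<eta>.component_iso[OF x] by (simp add: iso_def id_func_def comp_func_def)
    have iy: "iso A y (?GF y) (\<eta> y)"
      using \<eta>.component_iso[OF y] by (simp add: id_func_def comp_func_def)
    then obtain d where d: "d \<in> hom A (?GF y) y" "Comp A (\<eta> y) d = Ide A (?GF y)"
      and ey: "\<eta> y \<in> hom A y (?GF y)"
      by (auto simp: iso_def)
    have Gg: "FArr G g \<in> hom A (?GF x) (?GF y)" using G.FArr_hom[OF g] .
    \<comment> \<open>The candidate preimage of \<open>g\<close> is \<open>FArr G g\<close>
      conjugated by the unit, with \<open>d\<close> inverting \<open>\<eta> y\<close>. Naturality
      shows that \<open>FArr G\<close> agrees on \<open>FArr F f\<close> and \<open>g\<close>, and
      \<open>G\<close> is faithful.\<close>
    define f where "f = Comp A d (Comp A (FArr G g) (\<eta> x))"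
    have Ggx: "Comp A (FArr G g) (\<eta> x) \<in> hom A x (?GF y)" using F.A.Comp_hom[OF ix Gg] .
    have f: "f \<in> hom A x y" unfolding f_def using F.A.Comp_hom[OF Ggx d(1)] .
    have "Comp A (\<eta> y) f = Comp A (FArr G g) (\<eta> x)"
      unfolding f_def using F.A.Comp_assoc[OF Ggx d(1) ey] d(2) F.A.Ide_Comp[OF Ggx] by simp
    moreover have "Comp A (\<eta> y) f = Comp A (FArr G (FArr F f)) (\<eta> x)"
      using \<eta>.natural[OF f] by (simp add: id_func_def comp_func_def)
    moreover have "iso A x (?GF x) (\<eta> x)"
      using \<eta>.component_iso[OF x] by (simp add: id_func_def comp_func_def)
    ultimately have "FArr G (FArr F f) = FArr G g"
      using F.A.iso_cancel_right[OF _ G.FArr_hom[OF F.FArr_hom[OF f]] Gg] by simp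
    then have Ff: "FArr F f = g"
      using natural_iso_id_faithful'[OF G F \<epsilon> F.FArr_hom[OF f] g] by simp
    show "\<exists>!f. f \<in> hom A x y \<and> FArr F f = g"
    proof (rule ex1I[of _ f])
      fix f' assume "f' \<in> hom A x y \<and> FArr F f' = g"
      then show "f' = f" using natural_iso_id_faithful[OF F G \<eta> _ f] Ff by simp
    qed (simp add: f Ff)
  qed
qed

lemma equivalence_imp_ess_surj:
  assumes "equivalence A B F"
  shows "ess_surj A B F"
proof -
  obtain G \<epsilon> where "is_functor B A G" and "natural_iso B B (comp_func F G) id_func \<epsilon>"
    using assms by (auto simp: equivalence_def)
  then show ?thesis
    unfolding ess_surj_def
    using is_functor.FObj_Obj natural_iso.component_iso
    by (fastforce simp: comp_func_def id_func_def)
qed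

lemma is_functor_comp_func:
  assumes "is_functor A B F" "is_functor B D G"
  shows "is_functor A D (comp_func G F)"
proof -
  interpret F: is_functor A B F by fact
  interpret G: is_functor B D G by fact
  show ?thesis
    by unfold_locales (auto simp: comp_func_def F.FArr_Ide G.FArr_Ide F.FObj_Obj F.FArr_Comp
        G.FArr_Comp[OF F.FArr_hom F.FArr_hom] intro: F.FObj_Obj G.FObj_Obj F.FArr_hom G.FArr_hom)
qed

lemma is_functor_id_func: "category A \<Longrightarrow> is_functor A A id_func"
  by (auto simp: is_functor_def is_functor_axioms_def id_func_def)

text \<open>The quasi-inverse picks \<open>G0 z\<close> with an isomorphism \<open>e z\<close> from
  its image to \<open>z\<close>, and sends \<open>g\<close> to the preimage of its conjugate by
  these isomorphisms. So \<open>e\<close> is natural by construction, and the unit arises by lifting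
  the inverses of \<open>e\<close> through \<open>F\<close>.\<close>

lemma equivalenceI:
  assumes F: "is_functor A B F" and ff: "full_faithful A B F" and es: "ess_surj A B F"
  shows "equivalence A B F"
proof -
  interpret F: is_functor A B F by fact
  obtain G0 e where G0: "\<And>z. z \<in> Obj B \<Longrightarrow> G0 z \<in> Obj A"
    and e: "\<And>z. z \<in> Obj B \<Longrightarrow> iso B (FObj F (G0 z)) z (e z)"
    using es unfolding ess_surj_def by metis
  obtain d where d: "\<And>z. z \<in> Obj B \<Longrightarrow> d z \<in> hom B z (FObj F (G0 z))"
    and de: "\<And>z. z \<in> Obj B \<Longrightarrow> Comp B (d z) (e z) = Ide B (FObj F (G0 z))"
    and ed: "\<And>z. z \<in> Obj B \<Longrightarrow> Comp B (e z) (d z) = Ide B z"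
    using e unfolding iso_def by metis
  have e_hom: "\<And>z. z \<in> Obj B \<Longrightarrow> e z \<in> hom B (FObj F (G0 z)) z"
    using e by (simp add: iso_def)
  have "\<exists>f. f \<in> hom A x y \<and> FArr F f = g"
    if "x \<in> Obj A" "y \<in> Obj A" "g \<in> hom B (FObj F x) (FObj F y)" for x y g
    using ff that unfolding full_faithful_def by blast
  then obtain p where p: "\<And>x y g. x \<in> Obj A \<Longrightarrow> y \<in> Obj A \<Longrightarrow> g \<in> hom B (FObj F x) (FObj F y) \<Longrightarrow>
      p x y g \<in> hom A x y \<and> FArr F (p x y g) = g"
    by metis
  have inj: "f = g" if "f \<in> hom A x y" "g \<in> hom A x y" "FArr F f = FArr F g" for x y f g
    using ff[unfolded full_faithful_def, rule_format, OF F.A.hom_Obj[OF that(1)] F.FArr_hom[OF that(1)]] that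
    by auto
  define G1 where "G1 g = p (G0 (Dom B g)) (G0 (Cod B g))
    (Comp B (d (Cod B g)) (Comp B g (e (Dom B g))))" for g
  have G1: "G1 g \<in> hom A (G0 z) (G0 w) \<and> FArr F (G1 g) = Comp B (d w) (Comp B g (e z))"
    if g: "g \<in> hom B z w" for g z w
  proof -
    have "z \<in> Obj B" "w \<in> Obj B" using F.B.hom_Obj[OF g] by auto
    then show ?thesis
      unfolding G1_def using p[OF G0 G0 F.B.Comp_hom[OF F.B.Comp_hom[OF e_hom g] d]] homD[OF g] by simp
  qed
  define G where "G = \<lparr>FObj = G0, FArr = G1\<rparr>"
  have G_simps [simp]: "FObj G = G0" "FArr G = G1" by (simp_all add: G_def)
  have e_G1: "Comp B (e w) (FArr F (G1 g)) = Comp B g (e z)" if g: "g \<in> hom B z w" for g z w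
  proof -
    have z: "z \<in> Obj B" and w: "w \<in> Obj B" using F.B.hom_Obj[OF g] by auto
    have ge: "Comp B g (e z) \<in> hom B (FObj F (G0 z)) w" using F.B.Comp_hom[OF e_hom[OF z] g] .
    show ?thesis
      using G1[OF g] F.B.Comp_assoc[OF ge d[OF w] e_hom[OF w]] ed[OF w] F.B.Ide_Comp[OF ge] by simp
  qed
  \<comment> \<open>The naturality square of \<open>e\<close> characterises \<open>G1 g\<close>,
    because \<open>e w\<close> can be cancelled and \<open>F\<close> is faithful. Both functor laws
    of \<open>G\<close> follow by checking this square.\<close>
  have G_eqI: "f = G1 g" if g: "g \<in> hom B z w" and f: "f \<in> hom A (G0 z) (G0 w)"
    and eq: "Comp B (e w) (FArr F f) = Comp B g (e z)" for f g z w
  proof -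
    have "w \<in> Obj B" using F.B.hom_Obj[OF g] by auto
    then have "FArr F f = FArr F (G1 g)"
      using F.B.iso_cancel_left[OF e] F.FArr_hom[OF f] F.FArr_hom G1[OF g] e_G1[OF g] eq by metis
    then show ?thesis using inj f G1[OF g] by blast
  qed
  have Gf: "is_functor B A G"
  proof (unfold_locales, goal_cases)
    case (1 x)
    then show ?case using G0 by simp
  next
    case (2 f x y)
    then show ?case using G1 by simp
  next
    case (3 x)
    have "Ide A (G0 x) = G1 (Ide B x)"
      using G_eqI[OF F.B.Ide_hom[OF 3] F.A.Ide_hom[OF G0[OF 3]]] F.FArr_Ide[OF G0[OF 3]]
        F.B.Comp_Ide[OF e_hom[OF 3]] F.B.Ide_Comp[OF e_hom[OF 3]] by simp
    then show ?case by simp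
  next
    case (4 f x y g z)
    have x: "x \<in> Obj B" and y: "y \<in> Obj B" and z: "z \<in> Obj B"
      using F.B.hom_Obj[OF 4(1)] F.B.hom_Obj[OF 4(2)] by auto
    note f = conjunct1[OF G1[OF 4(1)]] and g = conjunct1[OF G1[OF 4(2)]]
    have "Comp B (e z) (FArr F (Comp A (G1 g) (G1 f))) =
        Comp B (e z) (Comp B (FArr F (G1 g)) (FArr F (G1 f)))"
      using F.FArr_Comp[OF f g] by simp
    also have "\<dots> = Comp B (Comp B g (e y)) (FArr F (G1 f))"
      using F.B.Comp_assoc[OF F.FArr_hom[OF f] F.FArr_hom[OF g] e_hom[OF z]] e_G1[OF 4(2)] by simp
    also have "\<dots> = Comp B g (Comp B f (e x))"
      using F.B.Comp_assoc[OF F.FArr_hom[OF f] e_hom[OF y] 4(2)] e_G1[OF 4(1)] by simp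
    also have "\<dots> = Comp B (Comp B g f) (e x)"
      using F.B.Comp_assoc[OF e_hom[OF x] 4(1) 4(2)] .
    finally show ?case
      using G_eqI[OF F.B.Comp_hom[OF 4] F.A.Comp_hom[OF f g]] by simp
  qed
  define \<eta> where "\<eta> x = p x (G0 (FObj F x)) (d (FObj F x))" for x
  have \<eta>: "\<eta> x \<in> hom A x (G0 (FObj F x)) \<and> FArr F (\<eta> x) = d (FObj F x)" if "x \<in> Obj A" for x
    unfolding \<eta>_def using p[OF that G0[OF F.FObj_Obj[OF that]] d[OF F.FObj_Obj[OF that]]] .
  have "natural_iso B B (comp_func F G) id_func e"
    unfolding natural_iso_def natural_iso_axioms_def
    using is_functor_comp_func[OF Gf F] is_functor_id_func[OF F.B.category_axioms] e e_G1
    by (auto simp: comp_func_def id_func_def)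
  moreover have "natural_iso A A id_func (comp_func G F) \<eta>"
  proof -
    have "iso A x (G0 (FObj F x)) (\<eta> x)" if x: "x \<in> Obj A" for x
    proof -
      let ?z = "FObj F x"
      have z: "?z \<in> Obj B" and gz: "G0 ?z \<in> Obj A" using x F.FObj_Obj G0 by auto
      \<comment> \<open>The lift of \<open>e ?z\<close> is inverse to \<open>\<eta> x\<close>: under
        the faithful \<open>F\<close> both composites become identities.\<close>
      define r where "r = p (G0 ?z) x (e ?z)"
      have r: "r \<in> hom A (G0 ?z) x" and Fr: "FArr F r = e ?z"
        unfolding r_def using p[OF gz x e_hom[OF z]] by auto
      have "FArr F (Comp A r (\<eta> x)) = FArr F (Ide A x)"
        using F.FArr_Comp[OF conjunct1[OF \<eta>[OF x]] r] \<eta>[OF x] Fr ed[OF z] F.FArr_Ide[OF x] by simp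
      moreover have "FArr F (Comp A (\<eta> x) r) = FArr F (Ide A (G0 ?z))"
        using F.FArr_Comp[OF r conjunct1[OF \<eta>[OF x]]] \<eta>[OF x] Fr de[OF z] F.FArr_Ide[OF gz] by simp
      ultimately show ?thesis
        unfolding iso_def
        using \<eta>[OF x] r inj[OF F.A.Comp_hom[OF _ r] F.A.Ide_hom[OF x]]
          inj[OF F.A.Comp_hom[OF r] F.A.Ide_hom[OF gz]] by blast
    qed
    moreover have "Comp A (\<eta> y) f = Comp A (G1 (FArr F f)) (\<eta> x)" if f: "f \<in> hom A x y" for f x y
    proof -
      have x: "x \<in> Obj A" and y: "y \<in> Obj A" using F.A.hom_Obj[OF f] by auto
      let ?z = "FObj F x" and ?w = "FObj F y"
      have z: "?z \<in> Obj B" and w: "?w \<in> Obj B" using x y F.FObj_Obj by auto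
      note Ff = F.FArr_hom[OF f]
      note \<eta>x = conjunct1[OF \<eta>[OF x]] and \<eta>y = conjunct1[OF \<eta>[OF y]]
      note GF = G1[OF Ff]
      have "FArr F (Comp A (G1 (FArr F f)) (\<eta> x)) = Comp B (Comp B (d ?w) (Comp B (FArr F f) (e ?z))) (d ?z)"
        using F.FArr_Comp[OF \<eta>x conjunct1[OF GF]] GF \<eta>[OF x] by simp
      also have "\<dots> = Comp B (d ?w) (Comp B (Comp B (FArr F f) (e ?z)) (d ?z))"
        using F.B.Comp_assoc[OF d[OF z] F.B.Comp_hom[OF e_hom[OF z] Ff] d[OF w]] by simp
      also have "\<dots> = Comp B (d ?w) (FArr F f)"
        using F.B.Comp_assoc[OF d[OF z] e_hom[OF z] Ff] ed[OF z] F.B.Comp_Ide[OF Ff] by simp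
      also have "\<dots> = FArr F (Comp A (\<eta> y) f)"
        using F.FArr_Comp[OF f \<eta>y] \<eta>[OF y] by simp
      finally show ?thesis
        using inj[OF F.A.Comp_hom[OF f \<eta>y] F.A.Comp_hom[OF \<eta>x conjunct1[OF GF]]] by simp
    qed
    ultimately show ?thesis
      unfolding natural_iso_def natural_iso_axioms_def
      using is_functor_comp_func[OF F Gf] is_functor_id_func[OF F.A.category_axioms]
      by (auto simp: comp_func_def id_func_def)
  qed
  ultimately show ?thesis
    unfolding equivalence_def using F Gf by (intro conjI exI)
qed

section \<open>Slices and products\<close>

lemma slice_simps [simp]:
  "Obj (slice C X) = {f \<in> Arr C. Cod C f = X}"
  "Dom (slice C X) (f, h, g) = f"
  "Cod (slice C X) (f, h, g) = g"
  "Ide (slice C X) f = (f, Ide C (Dom C f), f)"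
  "Comp (slice C X) (g', k, e) (f, h, g) = (f, Comp C k h, e)"
  by (simp_all add: slice_def)

lemma slice_hom_iff:
  "t \<in> hom (slice C X) f g \<longleftrightarrow> (\<exists>h. t = (f, h, g) \<and> f \<in> Arr C \<and> Cod C f = X \<and> g \<in> Arr C \<and>
    Cod C g = X \<and> h \<in> hom C (Dom C f) (Dom C g) \<and> Comp C g h = f)"
  by (cases t) (auto simp: hom_def slice_def)

lemma prod_cat_simps [simp]:
  "Obj (prod_cat I A) = (\<Pi>\<^sub>E i\<in>I. Obj (A i))"
  "Ide (prod_cat I A) x = (\<lambda>i\<in>I. Ide (A i) (x i))"
  "Comp (prod_cat I A) g f = (\<lambda>i\<in>I. Comp (A i) (g i) (f i))"
  by (simp_all add: prod_cat_def)

text \<open>\<open>Dom\<close> and \<open>Cod\<close> of a product are restricted functions, so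
  being a source or a target already forces \<open>x\<close> and \<open>y\<close> to be
  extensional.\<close>

lemma prod_cat_hom_iff:
  "t \<in> hom (prod_cat I A) x y \<longleftrightarrow> x \<in> extensional I \<and> y \<in> extensional I \<and> t \<in> extensional I \<and>
    (\<forall>i\<in>I. t i \<in> hom (A i) (x i) (y i))"
  by (auto simp: hom_def prod_cat_def PiE_iff extensional_def fun_eq_iff)

lemma (in category) category_slice: "category (slice C X)"
proof (unfold_locales, goal_cases)
  case (1 f)
  then show ?case by (auto simp: slice_def)
next
  case (2 f)
  then show ?case by (auto simp: slice_def)
next
  case (3 x)
  then show ?case
    by (auto simp: slice_hom_iff intro: Ide_hom Dom_Obj Comp_Ide[OF Arr_hom])
next
  case (4 f x y g z)
  then obtain h k where h: "h \<in> hom C (Dom C x) (Dom C y)" "Comp C y h = x" "f = (x, h, y)"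
    and k: "k \<in> hom C (Dom C y) (Dom C z)" "Comp C z k = y" "g = (y, k, z)"
    and "x \<in> Arr C" "z \<in> Arr C" "Cod C x = X" "Cod C z = X"
    by (auto simp: slice_hom_iff)
  moreover from this have "Comp C z (Comp C k h) = x" using Comp_assoc[OF h(1) k(1) Arr_hom] by simp
  ultimately show ?case by (auto simp: slice_hom_iff intro: Comp_hom)
next
  case (5 f x y)
  then show ?case by (auto simp: slice_hom_iff intro: Comp_Ide)
next
  case (6 f x y)
  then show ?case by (auto simp: slice_hom_iff intro: Ide_Comp)
next
  case (7 f w x g y h z)
  then show ?case by (auto simp: slice_hom_iff intro: Comp_assoc)
qed

lemma category_prod_cat:
  assumes "\<And>i. i \<in> I \<Longrightarrow> category (A i)"
  shows "category (prod_cat I A)"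
proof (unfold_locales, goal_cases)
  case (1 f)
  then show ?case using category.Dom_Obj[OF assms] by (auto simp: prod_cat_def PiE_iff)
next
  case (2 f)
  then show ?case using category.Cod_Obj[OF assms] by (auto simp: prod_cat_def PiE_iff)
next
  case (3 x)
  then show ?case using category.Ide_hom[OF assms] by (auto simp: prod_cat_hom_iff PiE_iff)
next
  case (4 f x y g z)
  then show ?case using category.Comp_hom[OF assms] by (auto simp: prod_cat_hom_iff)
next
  case (5 f x y)
  then show ?case using category.Comp_Ide[OF assms]
    by (auto simp: prod_cat_hom_iff intro!: extensionalityI[of _ I])
next
  case (6 f x y)
  then show ?case using category.Ide_Comp[OF assms]
    by (auto simp: prod_cat_hom_iff intro!: extensionalityI[of _ I])
next
  case (7 f w x g y h z)
  then have "Comp (A i) (h i) (Comp (A i) (g i) (f i)) = Comp (A i) (Comp (A i) (h i) (g i)) (f i)"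
    if "i \<in> I" for i
    using category.Comp_assoc[OF assms[OF that], of "f i" "w i" "x i" "g i" "y i" "h i" "z i"] that 7
    by (simp add: prod_cat_hom_iff)
  then show ?case by (auto simp: fun_eq_iff)
qed

section \<open>Coproducts\<close>

context category
begin

lemma ball_hom_Obj:
  assumes "\<forall>i\<in>I. f i \<in> hom C (X i) (Y i)"
  shows "\<forall>i\<in>I. X i \<in> Obj C" "\<forall>i\<in>I. Y i \<in> Obj C"
  using assms hom_Obj by auto

lemma ball_Comp_hom:
  assumes "\<forall>i\<in>I. f i \<in> hom C (X i) (Y i)" "\<forall>i\<in>I. g i \<in> hom C (Y i) (Z i)"
  shows "\<forall>i\<in>I. g i \<cdot> f i \<in> hom C (X i) (Z i)"
  using assms Comp_hom by auto

lemma is_coproduct_ex1: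
  assumes "is_coproduct C I X S \<iota>" "Y \<in> Obj C" "\<forall>i\<in>I. g i \<in> hom C (X i) Y"
  shows "\<exists>!h. h \<in> hom C S Y \<and> (\<forall>i\<in>I. h \<cdot> \<iota> i = g i)"
  using assms by (simp add: is_coproduct_def)

lemma is_coproduct_factor:
  assumes "is_coproduct C I X S \<iota>" "Y \<in> Obj C" "\<forall>i\<in>I. g i \<in> hom C (X i) Y"
  obtains h where "h \<in> hom C S Y" "\<forall>i\<in>I. h \<cdot> \<iota> i = g i"
proof -
  obtain h where "h \<in> hom C S Y \<and> (\<forall>i\<in>I. h \<cdot> \<iota> i = g i)"
    using ex1_implies_ex[OF is_coproduct_ex1[OF assms]] ..
  then show ?thesis using that[of h] by simp
qed

lemma is_coproduct_Obj: "is_coproduct C I X S \<iota> \<Longrightarrow> S \<in> Obj C"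
  by (simp add: is_coproduct_def)

lemma is_coproduct_homs: "is_coproduct C I X S \<iota> \<Longrightarrow> \<forall>i\<in>I. \<iota> i \<in> hom C (X i) S"
  by (simp add: is_coproduct_def)

lemma is_coproduct_hom: "is_coproduct C I X S \<iota> \<Longrightarrow> i \<in> I \<Longrightarrow> \<iota> i \<in> hom C (X i) S"
  by (simp add: is_coproduct_def)

lemma is_coproduct_eqI:
  assumes S: "is_coproduct C I X S \<iota>" and h: "h \<in> hom C S Y" and k: "k \<in> hom C S Y"
    and eq: "\<forall>i\<in>I. h \<cdot> \<iota> i = k \<cdot> \<iota> i"
  shows "h = k"
proof -
  have "\<forall>i\<in>I. k \<cdot> \<iota> i \<in> hom C (X i) Y"
    using is_coproduct_homs[OF S] Comp_hom[OF _ k] by simp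
  then have "\<exists>!h. h \<in> hom C S Y \<and> (\<forall>i\<in>I. h \<cdot> \<iota> i = k \<cdot> \<iota> i)"
    using is_coproduct_ex1[OF S hom_Obj(2)[OF k]] by simp
  then obtain l where l: "\<forall>m. m \<in> hom C S Y \<and> (\<forall>i\<in>I. m \<cdot> \<iota> i = k \<cdot> \<iota> i) \<longrightarrow> m = l"
    unfolding Ex1_def by (elim exE conjE)
  have "h = l" using l[rule_format, of h] h eq by blast
  moreover have "k = l" using l[rule_format, of k] k by blast
  ultimately show ?thesis by simp
qed

lemma is_coproductI:
  assumes "S \<in> Obj C" "\<And>i. i \<in> I \<Longrightarrow> \<iota> i \<in> hom C (X i) S"
    and ex: "\<And>Y g. Y \<in> Obj C \<Longrightarrow> \<forall>i\<in>I. g i \<in> hom C (X i) Y \<Longrightarrow>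
      \<exists>h. h \<in> hom C S Y \<and> (\<forall>i\<in>I. h \<cdot> \<iota> i = g i)"
    and un: "\<And>Y h k. h \<in> hom C S Y \<Longrightarrow> k \<in> hom C S Y \<Longrightarrow>
      \<forall>i\<in>I. h \<cdot> \<iota> i = k \<cdot> \<iota> i \<Longrightarrow> h = k"
  shows "is_coproduct C I X S \<iota>"
  unfolding is_coproduct_def
proof (intro conjI ballI allI impI)
  fix Y g assume "Y \<in> Obj C" "\<forall>i\<in>I. g i \<in> hom C (X i) Y"
  from ex[OF this] obtain h where h: "h \<in> hom C S Y" "\<forall>i\<in>I. h \<cdot> \<iota> i = g i" by auto
  show "\<exists>!h. h \<in> hom C S Y \<and> (\<forall>i\<in>I. h \<cdot> \<iota> i = g i)"
  proof (rule ex1I[of _ h])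
    fix k assume "k \<in> hom C S Y \<and> (\<forall>i\<in>I. k \<cdot> \<iota> i = g i)"
    then show "k = h" using un[of k Y h] h by simp
  qed (simp add: h)
qed (simp_all add: assms(1,2))

lemma is_coproduct_empty: "is_coproduct C {} X S \<iota> \<longleftrightarrow> initial S"
  by (simp add: is_coproduct_def initial_def)

lemma is_coproduct_singleton: "x \<in> Obj C \<Longrightarrow> is_coproduct C {i} (\<lambda>_. x) x (\<lambda>_. Ide C x)"
  by (rule is_coproductI) (auto intro: Ide_hom Comp_Ide simp: Comp_Ide)

lemma is_coproduct_endo:
  assumes S: "is_coproduct C I X S \<iota>" and h: "h \<in> hom C S S"
    and eq: "\<forall>i\<in>I. h \<cdot> \<iota> i = \<iota> i"
  shows "h = Ide C S"
  using is_coproduct_eqI[OF S h Ide_hom[OF is_coproduct_Obj[OF S]]] eq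
    Ide_Comp[OF is_coproduct_hom[OF S]] by simp

lemma is_coproduct_comparison:
  assumes S: "is_coproduct C I X S \<iota>" and T: "is_coproduct C I X T \<kappa>"
  obtains e where "iso C S T e" "\<forall>i\<in>I. e \<cdot> \<iota> i = \<kappa> i"
proof -
  obtain u where u: "u \<in> hom C S T" "\<forall>i\<in>I. u \<cdot> \<iota> i = \<kappa> i"
    using is_coproduct_factor[OF S is_coproduct_Obj[OF T] is_coproduct_homs[OF T]] .
  obtain v where v: "v \<in> hom C T S" "\<forall>i\<in>I. v \<cdot> \<kappa> i = \<iota> i"
    using is_coproduct_factor[OF T is_coproduct_Obj[OF S] is_coproduct_homs[OF S]] .
  have "v \<cdot> u = Ide C S"
    using is_coproduct_endo[OF S Comp_hom[OF u(1) v(1)]]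
      Comp_assoc[OF is_coproduct_hom[OF S] u(1) v(1)] u(2) v(2) by simp
  moreover have "u \<cdot> v = Ide C T"
    using is_coproduct_endo[OF T Comp_hom[OF v(1) u(1)]]
      Comp_assoc[OF is_coproduct_hom[OF T] v(1) u(1)] u(2) v(2) by simp
  ultimately have "iso C S T u" using u v by (auto simp: iso_def)
  then show ?thesis using that u(2) by simp
qed

text \<open>The two index types may differ: this brings a coproduct over pairs of indices back to
  one over their codes in \<open>'u\<close>.\<close>

lemma is_coproduct_reindex:
  assumes S: "is_coproduct C I X S \<iota>" and p: "bij_betw p K I"
  shows "is_coproduct C K (\<lambda>k. X (p k)) S (\<lambda>k. \<iota> (p k))"
proof (rule is_coproductI)
  fix Y g assume Y: "Y \<in> Obj C" and g: "\<forall>k\<in>K. g k \<in> hom C (X (p k)) Y"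
  let ?q = "inv_into K p"
  have q: "?q i \<in> K" "p (?q i) = i" if "i \<in> I" for i
    using p that by (auto simp: bij_betw_def inv_into_into f_inv_into_f)
  have qp: "?q (p k) = k" "p k \<in> I" if "k \<in> K" for k
    using p that by (auto simp: bij_betw_def)
  have "\<forall>i\<in>I. g (?q i) \<in> hom C (X i) Y"
  proof
    fix i assume "i \<in> I"
    then show "g (?q i) \<in> hom C (X i) Y" using g[rule_format, of "?q i"] q by simp
  qed
  from is_coproduct_factor[OF S Y this]
  obtain h where "h \<in> hom C S Y" "\<forall>i\<in>I. h \<cdot> \<iota> i = g (?q i)" .
  then show "\<exists>h. h \<in> hom C S Y \<and> (\<forall>k\<in>K. h \<cdot> \<iota> (p k) = g k)" using qp by auto
next
  fix Y h k assume h: "h \<in> hom C S Y" "k \<in> hom C S Y"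
    and eq: "\<forall>j\<in>K. h \<cdot> \<iota> (p j) = k \<cdot> \<iota> (p j)"
  have "\<forall>i\<in>I. h \<cdot> \<iota> i = k \<cdot> \<iota> i"
    using p eq by (auto simp: bij_betw_def)
  then show "h = k" using is_coproduct_eqI[OF S h] by simp
qed (use S p in \<open>auto simp: is_coproduct_def bij_betw_def\<close>)

text \<open>Copairing is done in two stages, first on the summands of each \<open>N i\<close> and
  then over \<open>I\<close>. It serves to refine a decomposition by decompositions of its
  pieces.\<close>

lemma is_coproduct_Sigma:
  assumes S: "is_coproduct C I N S m"
    and N: "\<And>i. i \<in> I \<Longrightarrow> is_coproduct C (A i) (X i) (N i) (n i)"
  shows "is_coproduct C (Sigma I A) (\<lambda>s. X (fst s) (snd s)) S (\<lambda>s. m (fst s) \<cdot> n (fst s) (snd s))"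
proof (rule is_coproductI)
  show "S \<in> Obj C" using is_coproduct_Obj[OF S] .
next
  fix s assume "s \<in> Sigma I A"
  then show "m (fst s) \<cdot> n (fst s) (snd s) \<in> hom C (X (fst s) (snd s)) S"
    using Comp_hom[OF is_coproduct_hom[OF N] is_coproduct_hom[OF S]] by auto
next
  fix Y g assume Y: "Y \<in> Obj C"
    and g: "\<forall>s\<in>Sigma I A. g s \<in> hom C (X (fst s) (snd s)) Y"
  have "\<exists>h. h \<in> hom C (N i) Y \<and> (\<forall>a\<in>A i. h \<cdot> n i a = g (i, a))" if i: "i \<in> I" for i
  proof -
    have "\<forall>a\<in>A i. g (i, a) \<in> hom C (X i a) Y" using g i by auto
    from is_coproduct_factor[OF N[OF i] Y this] show ?thesis by metis
  qed
  then obtain k where k: "\<forall>i\<in>I. k i \<in> hom C (N i) Y"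
    "\<And>i a. i \<in> I \<Longrightarrow> a \<in> A i \<Longrightarrow> k i \<cdot> n i a = g (i, a)"
    by metis
  obtain h where h: "h \<in> hom C S Y" "\<forall>i\<in>I. h \<cdot> m i = k i"
    using is_coproduct_factor[OF S Y k(1)] .
  have "h \<cdot> m i \<cdot> n i a = g (i, a)" if "i \<in> I" "a \<in> A i" for i a
    using Comp_assoc[OF is_coproduct_hom[OF N[OF that(1)] that(2)] is_coproduct_hom[OF S that(1)] h(1)]
      h(2) k(2) that by simp
  then show "\<exists>h. h \<in> hom C S Y \<and> (\<forall>s\<in>Sigma I A. h \<cdot> m (fst s) \<cdot> n (fst s) (snd s) = g s)"
    using h(1) by auto
next
  fix Y h k assume h: "h \<in> hom C S Y" and k: "k \<in> hom C S Y"
    and eq: "\<forall>s\<in>Sigma I A.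
      h \<cdot> m (fst s) \<cdot> n (fst s) (snd s) = k \<cdot> m (fst s) \<cdot> n (fst s) (snd s)"
  have "h \<cdot> m i = k \<cdot> m i" if i: "i \<in> I" for i
  proof -
    note mi = is_coproduct_hom[OF S i]
    have "(h \<cdot> m i) \<cdot> n i a = (k \<cdot> m i) \<cdot> n i a" if a: "a \<in> A i" for a
      using eq i a Comp_assoc[OF is_coproduct_hom[OF N[OF i] a] mi h]
        Comp_assoc[OF is_coproduct_hom[OF N[OF i] a] mi k] by auto
    then show ?thesis using is_coproduct_eqI[OF N[OF i] Comp_hom[OF mi h] Comp_hom[OF mi k]] by simp
  qed
  then show "h = k" using is_coproduct_eqI[OF S h k] by simp
qed

end

section \<open>Coding pairs and finite choice functions as indices\<close>

context smallness
begin

text \<open>An infinite type contains a copy of its own square, so ordered pairs of indices can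
  again serve as indices. \<open>SOME\<close> fixes one embedding, of which only injectivity is
  known.\<close>

definition pair :: "'u \<times> 'u \<Rightarrow> 'u" where
  "pair = (SOME f. inj f)"

lemma inj_pair: "inj pair"
proof -
  obtain f :: "'u \<times> 'u \<Rightarrow> 'u" where "bij_betw f (UNIV \<times> UNIV) UNIV"
    using card_of_Times_same_infinite[OF infinite_UNIV] card_of_ordIso by blast
  then have "\<exists>f :: 'u \<times> 'u \<Rightarrow> 'u. inj f" by (auto simp: bij_betw_def)
  then show ?thesis unfolding pair_def by (rule someI_ex)
qed

lemma pair_eq_iff [simp]: "pair s = pair t \<longleftrightarrow> s = t"
  using inj_pair by (simp add: inj_eq)

lemma inv_pair [simp]: "inv pair (pair s) = s"
  using inj_pair by simp

lemma bij_betw_inv_pair: "bij_betw (inv pair) (pair ` A) A"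
  by (rule bij_betw_byWitness[where f' = pair]) auto

lemma small_pair_Sigma:
  assumes "small I" "\<And>i. i \<in> I \<Longrightarrow> small (A i)"
  shows "small (pair ` Sigma I A)"
proof -
  have "pair ` Sigma I A = (\<Union>i\<in>I. (\<lambda>a. pair (i, a)) ` A i)" by auto
  then show ?thesis using small_UN[OF assms(1)] small_image[OF assms(2)] by simp
qed

text \<open>Choice functions on a finite set have codes in \<open>'u\<close>, because \<open>'u \<times> 'u\<close> embeds in \<open>'u\<close>.\<close>

lemma small_code_PiE:
  assumes "finite K" "\<And>k. k \<in> K \<Longrightarrow> small (A k)"
  shows "\<exists>e :: ('k \<Rightarrow> 'u) \<Rightarrow> 'u. inj_on e (PiE K A) \<and> small (e ` PiE K A)"
  using assms
proof (induction K)
  case empty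
  then show ?case by (auto simp: small_finite)
next
  case (insert k K)
  then obtain e :: "('k \<Rightarrow> 'u) \<Rightarrow> 'u" where e: "inj_on e (PiE K A)" "small (e ` PiE K A)" by auto
  \<comment> \<open>Peeling off the value at \<open>k\<close> reduces the product over
    \<open>insert k K\<close> to a product of two small sets, which \<open>pair\<close> embeds in
    \<open>'u\<close>.\<close>
  let ?e = "\<lambda>x. pair (x k, e (restrict x K))"
  have restr: "restrict x K \<in> PiE K A" if "x \<in> PiE (insert k K) A" for x
    using that by auto
  have "inj_on ?e (PiE (insert k K) A)"
  proof (rule inj_onI)
    fix x y assume x: "x \<in> PiE (insert k K) A" and y: "y \<in> PiE (insert k K) A" and "?e x = ?e y"
    then have xk: "x k = y k" and xK: "restrict x K = restrict y K"
      using inj_onD[OF e(1)] restr by auto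
    then have "x i = y i" if "i \<in> insert k K" for i
      using that xk fun_cong[OF xK, of i] unfolding restrict_def by (cases "i = k") auto
    then show "x = y" using PiE_ext[OF x y] by blast
  qed
  moreover have "?e ` PiE (insert k K) A \<subseteq> pair ` (A k \<times> e ` PiE K A)"
    using restr by (auto intro!: imageI)
  ultimately show ?case
    using small_subset[OF small_pair_Sigma[of "A k" "\<lambda>_. e ` PiE K A"]] insert.prems e(2)
    by (intro exI[of _ ?e]) simp
qed

end

section \<open>Chosen coproducts and the functor between slices\<close>

locale coprod_category = category C + smallness small
  for C :: "('o, 'a) cat" and small :: "'u set \<Rightarrow> bool" +
  assumes small_coproducts: "has_small_coproducts small C"
begin

lemma is_coproduct_coprod:
  assumes "small I" "\<forall>i\<in>I. X i \<in> Obj C"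
  shows "is_coproduct C I X (coprod C I X) (incl C I X)"
proof -
  obtain S \<iota> where "is_coproduct C I X S \<iota>"
    using small_coproducts assms unfolding has_small_coproducts_def by metis
  then show ?thesis
    using someI[of "\<lambda>(S, \<iota>). is_coproduct C I X S \<iota>" "(S, \<iota>)"]
    by (simp add: coprod_def incl_def coproduct_def split_beta)
qed

lemmas coprod_Obj = is_coproduct_Obj[OF is_coproduct_coprod]
lemmas incl_hom = is_coproduct_hom[OF is_coproduct_coprod]
lemmas coprod_eqI = is_coproduct_eqI[OF is_coproduct_coprod]

text \<open>The choice depends on the family only through the predicate
  \<open>is_coproduct C I X\<close>, which sees \<open>X\<close> on \<open>I\<close> alone. The
  families of domains and codomains in \<open>coprod_map\<close> agree with the intended ones only
  there.\<close>

lemma coproduct_cong: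
  assumes "\<forall>i\<in>I. X i = Y i"
  shows "coprod C I X = coprod C I Y" "incl C I X = incl C I Y"
proof -
  have "is_coproduct C I X = is_coproduct C I Y"
    using assms by (simp add: is_coproduct_def fun_eq_iff)
  then have "coproduct C I X = coproduct C I Y" by (simp add: coproduct_def)
  then show "coprod C I X = coprod C I Y" "incl C I X = incl C I Y"
    by (simp_all add: coprod_def incl_def)
qed

lemma cotuple_props:
  assumes I: "small I" and Y: "Y \<in> Obj C" and g: "\<forall>i\<in>I. g i \<in> hom C (X i) Y"
  shows "cotuple C I X Y g \<in> hom C (coprod C I X) Y \<and>
    (\<forall>i\<in>I. cotuple C I X Y g \<cdot> incl C I X i = g i)"
  unfolding cotuple_def
  by (rule theI'[OF is_coproduct_ex1[OF is_coproduct_coprod[OF I ball_hom_Obj(1)[OF g]] Y g]])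

lemmas cotuple_hom = cotuple_props[THEN conjunct1]
lemmas cotuple_incl = cotuple_props[THEN conjunct2, THEN bspec]

lemma coprod_map_props:
  assumes I: "small I" and f: "\<forall>i\<in>I. f i \<in> hom C (A i) (B i)"
  shows "coprod_map C I f \<in> hom C (coprod C I A) (coprod C I B) \<and>
    (\<forall>i\<in>I. coprod_map C I f \<cdot> incl C I A i = incl C I B i \<cdot> f i)"
proof -
  have DC: "\<forall>i\<in>I. Dom C (f i) = A i" "\<forall>i\<in>I. Cod C (f i) = B i"
    using f by (simp_all add: hom_def)
  note A = coproduct_cong[OF DC(1)] and B = coproduct_cong[OF DC(2)]
  note Bi = ball_hom_Obj(2)[OF f]
  have "\<forall>i\<in>I. incl C I B i \<cdot> f i \<in> hom C (Dom C (f i)) (coprod C I B)"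
    using Comp_hom[OF bspec[OF f] incl_hom[OF I Bi]] DC by simp
  from cotuple_props[OF I coprod_Obj[OF I Bi] this] show ?thesis
    unfolding coprod_map_def A B .
qed

lemmas coprod_map_hom = coprod_map_props[THEN conjunct1]
lemmas coprod_map_incl = coprod_map_props[THEN conjunct2, THEN bspec]

lemma coprod_map_unique:
  assumes I: "small I" and f: "\<forall>i\<in>I. f i \<in> hom C (A i) (B i)"
    and h: "h \<in> hom C (coprod C I A) (coprod C I B)"
    and eq: "\<forall>i\<in>I. h \<cdot> incl C I A i = incl C I B i \<cdot> f i"
  shows "h = coprod_map C I f"
  using coprod_eqI[OF I ball_hom_Obj(1)[OF f] h coprod_map_hom[OF I f]] eq
    coprod_map_incl[OF I f] by simp

text \<open>Objects of a product of slices are extensional, so a family of maps often enters as its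
  restriction to \<open>I\<close>; this identifies the two sums.\<close>

lemma coprod_map_cong:
  assumes I: "small I" and f: "\<forall>i\<in>I. f i \<in> hom C (A i) (B i)"
    and eq: "\<forall>i\<in>I. f i = g i"
  shows "coprod_map C I f = coprod_map C I g"
proof -
  have g: "\<forall>i\<in>I. g i \<in> hom C (A i) (B i)" using f eq by simp
  show ?thesis
    using coprod_map_unique[OF I g coprod_map_hom[OF I f]] coprod_map_incl[OF I f] eq by simp
qed

lemma coprod_map_Ide:
  assumes I: "small I" and X: "\<forall>i\<in>I. X i \<in> Obj C"
  shows "coprod_map C I (\<lambda>i. Ide C (X i)) = Ide C (coprod C I X)"
proof (rule coprod_map_unique[OF I _ Ide_hom[OF coprod_Obj[OF I X]], symmetric])
  show "\<forall>i\<in>I. Ide C (X i) \<in> hom C (X i) (X i)" using X Ide_hom by simp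
qed (use Comp_Ide[OF incl_hom[OF I X]] Ide_Comp[OF incl_hom[OF I X]] in simp)

lemma coprod_map_Comp:
  assumes I: "small I" and f: "\<forall>i\<in>I. f i \<in> hom C (X i) (Y i)"
    and g: "\<forall>i\<in>I. g i \<in> hom C (Y i) (Z i)"
  shows "coprod_map C I (\<lambda>i. g i \<cdot> f i) = coprod_map C I g \<cdot> coprod_map C I f"
proof (rule coprod_map_unique[OF I ball_Comp_hom[OF f g], symmetric])
  note X = ball_hom_Obj(1)[OF f] and Y = ball_hom_Obj(2)[OF f] and Z = ball_hom_Obj(2)[OF g]
  note F = coprod_map_hom[OF I f] and G = coprod_map_hom[OF I g]
  show "coprod_map C I g \<cdot> coprod_map C I f \<in> hom C (coprod C I X) (coprod C I Z)"
    using Comp_hom[OF F G] .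
  show "\<forall>i\<in>I. (coprod_map C I g \<cdot> coprod_map C I f) \<cdot> incl C I X i = incl C I Z i \<cdot> g i \<cdot> f i"
  proof
    fix i assume i: "i \<in> I"
    note fi = bspec[OF f i] and gi = bspec[OF g i]
    have "(coprod_map C I g \<cdot> coprod_map C I f) \<cdot> incl C I X i =
        coprod_map C I g \<cdot> incl C I Y i \<cdot> f i"
      using Comp_assoc[OF incl_hom[OF I X i] F G] coprod_map_incl[OF I f i] by simp
    also have "\<dots> = (incl C I Z i \<cdot> g i) \<cdot> f i"
      using Comp_assoc[OF fi incl_hom[OF I Y i] G] coprod_map_incl[OF I g i] by simp
    finally show "(coprod_map C I g \<cdot> coprod_map C I f) \<cdot> incl C I X i = incl C I Z i \<cdot> g i \<cdot> f i"
      using Comp_assoc[OF fi gi incl_hom[OF I Z i]] by simp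
  qed
qed

lemma slice_prod_hom:
  assumes "t \<in> hom (prod_cat I (\<lambda>i. slice C (X i))) x y"
  shows "\<forall>i\<in>I. x i \<in> hom C (Dom C (x i)) (X i)" "\<forall>i\<in>I. y i \<in> hom C (Dom C (y i)) (X i)"
    "\<forall>i\<in>I. fst (snd (t i)) \<in> hom C (Dom C (x i)) (Dom C (y i))"
    "\<forall>i\<in>I. y i \<cdot> fst (snd (t i)) = x i" "\<forall>i\<in>I. t i = (x i, fst (snd (t i)), y i)"
proof -
  have "\<forall>i\<in>I. x i \<in> hom C (Dom C (x i)) (X i) \<and> y i \<in> hom C (Dom C (y i)) (X i) \<and>
      fst (snd (t i)) \<in> hom C (Dom C (x i)) (Dom C (y i)) \<and> y i \<cdot> fst (snd (t i)) = x i \<and>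
      t i = (x i, fst (snd (t i)), y i)"
  proof
    fix i assume "i \<in> I"
    then have "t i \<in> hom (slice C (X i)) (x i) (y i)" using assms by (simp add: prod_cat_hom_iff)
    then show "x i \<in> hom C (Dom C (x i)) (X i) \<and> y i \<in> hom C (Dom C (y i)) (X i) \<and>
        fst (snd (t i)) \<in> hom C (Dom C (x i)) (Dom C (y i)) \<and> y i \<cdot> fst (snd (t i)) = x i \<and>
        t i = (x i, fst (snd (t i)), y i)"
      by (auto simp: slice_hom_iff intro: homI)
  qed
  then show "\<forall>i\<in>I. x i \<in> hom C (Dom C (x i)) (X i)" "\<forall>i\<in>I. y i \<in> hom C (Dom C (y i)) (X i)"
    "\<forall>i\<in>I. fst (snd (t i)) \<in> hom C (Dom C (x i)) (Dom C (y i))"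
    "\<forall>i\<in>I. y i \<cdot> fst (snd (t i)) = x i" "\<forall>i\<in>I. t i = (x i, fst (snd (t i)), y i)"
    by simp_all
qed

lemma slice_sum_FArr:
  assumes I: "small I" and t: "t \<in> hom (prod_cat I (\<lambda>i. slice C (X i))) x y"
  shows "FArr (slice_sum C I) t =
    (coprod_map C I x, coprod_map C I (\<lambda>i. fst (snd (t i))), coprod_map C I y)"
proof -
  note a = slice_prod_hom[OF t]
  have "\<forall>i\<in>I. x i = fst (t i)" "\<forall>i\<in>I. y i = snd (snd (t i))"
    using a(5) by (metis fst_conv, metis snd_conv)
  from coprod_map_cong[OF I a(1) this(1)] coprod_map_cong[OF I a(2) this(2)] show ?thesis
    by (simp add: slice_sum_def)
qed

lemma slice_sum_FObj:
  assumes I: "small I" and x: "x \<in> Obj (prod_cat I (\<lambda>i. slice C (X i)))"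
  shows "FObj (slice_sum C I) x = coprod_map C I x"
    and "coprod_map C I x \<in> hom C (coprod C I (\<lambda>i. Dom C (x i))) (coprod C I X)"
    and "\<forall>i\<in>I. x i \<in> hom C (Dom C (x i)) (X i)"
proof -
  show 1: "\<forall>i\<in>I. x i \<in> hom C (Dom C (x i)) (X i)"
    using x by (auto simp: PiE_iff hom_def)
  show "coprod_map C I x \<in> hom C (coprod C I (\<lambda>i. Dom C (x i))) (coprod C I X)"
    using coprod_map_hom[OF I 1] .
qed (simp add: slice_sum_def)

text \<open>The triangles over the single \<open>X i\<close> add up to a triangle over the sum
  because \<open>coprod_map\<close> preserves composites.\<close>

lemma is_functor_slice_sum:
  assumes I: "small I"
  shows "is_functor (prod_cat I (\<lambda>i. slice C (X i))) (slice C (coprod C I X)) (slice_sum C I)"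
    (is "is_functor ?P ?S ?F")
proof -
  interpret P: category ?P by (rule category_prod_cat) (rule category_slice)
  show ?thesis
  proof (intro is_functor.intro is_functor_axioms.intro P.category_axioms category_slice, goal_cases)
    case (1 x)
    then show ?case using slice_sum_FObj[OF I 1] by (auto simp: hom_def)
  next
    case (2 t x y)
    note a = slice_prod_hom[OF 2]
    note x = slice_sum_FObj[OF I P.hom_Obj(1)[OF 2]] and y = slice_sum_FObj[OF I P.hom_Obj(2)[OF 2]]
    have "\<forall>i\<in>I. x i = y i \<cdot> fst (snd (t i))" using a(4) by simp
    from coprod_map_cong[OF I a(1) this]
    have "coprod_map C I y \<cdot> coprod_map C I (\<lambda>i. fst (snd (t i))) = coprod_map C I x"
      using coprod_map_Comp[OF I a(3) a(2)] by simp
    then show ?case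
      unfolding x(1) y(1) slice_sum_FArr[OF I 2] slice_hom_iff
      using x(2) y(2) coprod_map_hom[OF I a(3)] by (simp add: hom_def)
  next
    case (3 x)
    note x = slice_sum_FObj[OF I 3]
    have "\<forall>i\<in>I. Ide C (Dom C (x i)) \<in> hom C (Dom C (x i)) (Dom C (x i))"
      using ball_hom_Obj(1)[OF x(3)] Ide_hom by simp
    from coprod_map_cong[OF I this, of "\<lambda>i. fst (snd (Ide ?P x i))"]
    have "coprod_map C I (\<lambda>i. fst (snd (Ide ?P x i))) = coprod_map C I (\<lambda>i. Ide C (Dom C (x i)))"
      by simp
    then show ?case
      using slice_sum_FArr[OF I P.Ide_hom[OF 3]] coprod_map_Ide[OF I ball_hom_Obj(1)[OF x(3)]]
        homD(2)[OF x(2)] x(1) by simp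
  next
    case (4 s x y t z)
    note s = slice_prod_hom[OF 4(1)] and t = slice_prod_hom[OF 4(2)]
    have "\<forall>i\<in>I. fst (snd (t i)) \<cdot> fst (snd (s i)) = fst (snd (Comp ?P t s i))"
    proof
      fix i assume i: "i \<in> I"
      show "fst (snd (t i)) \<cdot> fst (snd (s i)) = fst (snd (Comp ?P t s i))"
        using i by (cases "s i"; cases "t i") simp
    qed
    from coprod_map_cong[OF I ball_Comp_hom[OF s(3) t(3)] this]
    show ?case
      using slice_sum_FArr[OF I P.Comp_hom[OF 4]] slice_sum_FArr[OF I 4(1)]
        slice_sum_FArr[OF I 4(2)] coprod_map_Comp[OF I s(3) t(3)] by simp
  qed
qed

end

section \<open>Extensive categories\<close>

context category
begin

text \<open>Essential surjectivity presents an object only as isomorphic to a chosen coproduct; here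
  it inherits the coproduct structure.\<close>

lemma is_coproduct_iso:
  assumes S: "is_coproduct C I X S \<iota>" and e: "iso C S T e"
  shows "is_coproduct C I X T (\<lambda>i. e \<cdot> \<iota> i)"
proof -
  obtain d where e: "e \<in> hom C S T" and d: "d \<in> hom C T S" and de: "d \<cdot> e = Ide C S"
    using e by (auto simp: iso_def)
  show ?thesis
  proof (rule is_coproductI)
    show "T \<in> Obj C" using hom_Obj[OF e] by simp
  next
    fix i assume "i \<in> I"
    then show "e \<cdot> \<iota> i \<in> hom C (X i) T" using Comp_hom[OF is_coproduct_hom[OF S] e] by simp
  next
    fix Y g assume "Y \<in> Obj C" "\<forall>i\<in>I. g i \<in> hom C (X i) Y"
    then obtain h where h: "h \<in> hom C S Y" "\<forall>i\<in>I. h \<cdot> \<iota> i = g i"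
      by (rule is_coproduct_factor[OF S])
    have "(h \<cdot> d) \<cdot> e \<cdot> \<iota> i = g i" if i: "i \<in> I" for i
    proof -
      note \<iota> = is_coproduct_hom[OF S i]
      have "(h \<cdot> d) \<cdot> e \<cdot> \<iota> i = h \<cdot> d \<cdot> e \<cdot> \<iota> i"
        using Comp_assoc[OF Comp_hom[OF \<iota> e] d h(1)] by simp
      also have "d \<cdot> e \<cdot> \<iota> i = \<iota> i"
        using Comp_assoc[OF \<iota> e d] de Ide_Comp[OF \<iota>] by simp
      finally show ?thesis using h(2) i by simp
    qed
    then show "\<exists>h. h \<in> hom C T Y \<and> (\<forall>i\<in>I. h \<cdot> e \<cdot> \<iota> i = g i)"
      using Comp_hom[OF d h(1)] by blast
  next
    fix Y h k assume h: "h \<in> hom C T Y" and k: "k \<in> hom C T Y"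
      and eq: "\<forall>i\<in>I. h \<cdot> e \<cdot> \<iota> i = k \<cdot> e \<cdot> \<iota> i"
    have "\<forall>i\<in>I. (h \<cdot> e) \<cdot> \<iota> i = (k \<cdot> e) \<cdot> \<iota> i"
      using eq Comp_assoc[OF is_coproduct_hom[OF S] e h] Comp_assoc[OF is_coproduct_hom[OF S] e k]
      by simp
    then have "h \<cdot> e = k \<cdot> e" using is_coproduct_eqI[OF S Comp_hom[OF e h] Comp_hom[OF e k]] by simp
    then show "h = k" using iso_cancel_right[OF assms(2) h k] by simp
  qed
qed

lemma iso_sliceD:
  assumes "iso (slice C X) f g t"
  obtains e where "iso C (Dom C f) (Dom C g) e" "g \<cdot> e = f"
proof -
  obtain s where t: "t \<in> hom (slice C X) f g" and s: "s \<in> hom (slice C X) g f"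
    and st: "Comp (slice C X) s t = Ide (slice C X) f" "Comp (slice C X) t s = Ide (slice C X) g"
    using assms by (auto simp: iso_def)
  obtain e where e: "t = (f, e, g)" "e \<in> hom C (Dom C f) (Dom C g)" "g \<cdot> e = f"
    using t by (auto simp: slice_hom_iff)
  obtain d where d: "s = (g, d, f)" "d \<in> hom C (Dom C g) (Dom C f)"
    using s by (auto simp: slice_hom_iff)
  have "d \<cdot> e = Ide C (Dom C f)" "e \<cdot> d = Ide C (Dom C g)" using st e(1) d(1) by simp_all
  then have "iso C (Dom C f) (Dom C g) e" using e(2) d(2) by (auto simp: iso_def)
  then show ?thesis using that e(3) by simp
qed

lemma iso_sliceI:
  assumes e: "iso C a b e" and f: "f \<in> hom C a X" and g: "g \<in> hom C b X" and ge: "g \<cdot> e = f"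
  shows "iso (slice C X) f g (f, e, g)"
proof -
  obtain d where e: "e \<in> hom C a b" and d: "d \<in> hom C b a"
    and de: "d \<cdot> e = Ide C a" "e \<cdot> d = Ide C b"
    using e by (auto simp: iso_def)
  have "f \<cdot> d = g" using Comp_assoc[OF d e g] ge de Comp_Ide[OF g] by simp
  then show ?thesis
    unfolding iso_def using e d de f g ge
    by (intro conjI bexI[of _ "(g, d, f)"]) (auto simp: slice_hom_iff homD[OF f] homD[OF g])
qed

end

section \<open>Extensivity as pullback squares and decompositions\<close>

context coprod_category
begin

lemma initial_exists: "\<exists>z. initial z"
proof -
  have "is_coproduct C {} X (coprod C {} X) (incl C {} X)" for X :: "'u \<Rightarrow> 'o"
    by (rule is_coproduct_coprod) (auto simp: small_finite)
  then show ?thesis unfolding is_coproduct_empty by blast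
qed

text \<open>The universal property of a pullback, for the square with sides \<open>f i\<close>,
  \<open>coprod_map C I f\<close> and the two inclusions at \<open>i\<close>. Over all families it
  matches full faithfulness of \<open>slice_sum\<close>.\<close>

definition inclusions_pullback :: bool where
  "inclusions_pullback \<longleftrightarrow> (\<forall>I f A X i Z p q. small I \<longrightarrow> (\<forall>i\<in>I. f i \<in> hom C (A i) (X i)) \<longrightarrow>
    i \<in> I \<longrightarrow> p \<in> hom C Z (X i) \<longrightarrow> q \<in> hom C Z (coprod C I A) \<longrightarrow>
    coprod_map C I f \<cdot> q = incl C I X i \<cdot> p \<longrightarrow>
    (\<exists>!h. h \<in> hom C Z (A i) \<and> f i \<cdot> h = p \<and> incl C I A i \<cdot> h = q))"

text \<open>The counterpart of essential surjectivity of \<open>slice_sum\<close>: \<open>f\<close>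
  is an object of the slice over the sum, and up to isomorphism it is the sum of the
  \<open>g i\<close>.\<close>

definition maps_decompose :: bool where
  "maps_decompose \<longleftrightarrow> (\<forall>I X M f. small I \<longrightarrow> (\<forall>i\<in>I. X i \<in> Obj C) \<longrightarrow> f \<in> hom C M (coprod C I X) \<longrightarrow>
    (\<exists>N m g. is_coproduct C I N M m \<and>
      (\<forall>i\<in>I. g i \<in> hom C (N i) (X i)) \<and> (\<forall>i\<in>I. f \<cdot> m i = incl C I X i \<cdot> g i)))"

lemma extensive_slice_equivalence:
  assumes "extensive small C" "small I" "\<forall>i\<in>I. X i \<in> Obj C"
  shows "equivalence (prod_cat I (\<lambda>i. slice C (X i))) (slice C (coprod C I X)) (slice_sum C I)"
  using assms by (simp add: extensive_def)

text \<open>As an object of the slice, \<open>f\<close> is isomorphic to the sum of some maps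
  \<open>x i\<close>. Their domains are the pieces, and the isomorphism carries the inclusions over
  to \<open>M\<close>.\<close>

lemma extensive_imp_maps_decompose:
  assumes ext: "extensive small C"
  shows maps_decompose
  unfolding maps_decompose_def
proof (intro allI impI)
  fix I :: "'u set" and X M f
  assume I: "small I" and X: "\<forall>i\<in>I. X i \<in> Obj C" and f: "f \<in> hom C M (coprod C I X)"
  let ?P = "prod_cat I (\<lambda>i. slice C (X i))"
  have "f \<in> Obj (slice C (coprod C I X))" using f by (simp add: hom_def)
  then obtain x t where x: "x \<in> Obj ?P"
    and t: "iso (slice C (coprod C I X)) (FObj (slice_sum C I) x) f t"
    using equivalence_imp_ess_surj[OF extensive_slice_equivalence[OF ext I X]]
    unfolding ess_surj_def by blast
  note x = slice_sum_FObj[OF I x]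
  obtain e where e: "iso C (coprod C I (\<lambda>i. Dom C (x i))) M e" "f \<cdot> e = coprod_map C I x"
    using iso_sliceD[OF t] unfolding x(1) homD(2)[OF x(2)] homD(2)[OF f] .
  have e': "e \<in> hom C (coprod C I (\<lambda>i. Dom C (x i))) M" using e(1) by (simp add: iso_def)
  note D = ball_hom_Obj(1)[OF x(3)]
  let ?\<iota> = "incl C I (\<lambda>i. Dom C (x i))"
  have "is_coproduct C I (\<lambda>i. Dom C (x i)) M (\<lambda>i. e \<cdot> ?\<iota> i)"
    using is_coproduct_iso[OF is_coproduct_coprod[OF I D] e(1)] .
  moreover have "\<forall>i\<in>I. f \<cdot> e \<cdot> ?\<iota> i = incl C I X i \<cdot> x i"
    using Comp_assoc[OF incl_hom[OF I D] e' f] e(2) coprod_map_incl[OF I x(3)] by simp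
  ultimately show "\<exists>N m g. is_coproduct C I N M m \<and>
      (\<forall>i\<in>I. g i \<in> hom C (N i) (X i)) \<and> (\<forall>i\<in>I. f \<cdot> m i = incl C I X i \<cdot> g i)"
    using x(3) by (intro exI conjI)
qed

text \<open>Full faithfulness speaks about maps at all indices, whereas the given square concerns
  \<open>i\<close> alone. Padding the other indices with an initial object turns the square into a
  morphism between sums; its unique preimage under \<open>slice_sum\<close> has the mediating map as
  its component at \<open>i\<close>.\<close>

lemma extensive_imp_inclusions_pullback:
  assumes ext: "extensive small C"
  shows inclusions_pullback
  unfolding inclusions_pullback_def
proof (intro allI impI)
  fix I :: "'u set" and f A X i Z p q
  assume I: "small I" and f: "\<forall>i\<in>I. f i \<in> hom C (A i) (X i)" and i: "i \<in> I"
    and p: "p \<in> hom C Z (X i)" and q: "q \<in> hom C Z (coprod C I A)"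
    and eq: "coprod_map C I f \<cdot> q = incl C I X i \<cdot> p"
  let ?P = "prod_cat I (\<lambda>i. slice C (X i))" and ?S = "slice C (coprod C I X)"
  let ?F = "slice_sum C I"
  note A = ball_hom_Obj(1)[OF f] and X = ball_hom_Obj(2)[OF f] and Z = hom_Obj(1)[OF p]
  obtain z where z: "initial z" using initial_exists by blast
  then have "\<forall>Y. \<exists>b. Y \<in> Obj C \<longrightarrow> b \<in> hom C z Y" using initial_hom by blast
  then obtain b where b: "\<And>Y. Y \<in> Obj C \<Longrightarrow> b Y \<in> hom C z Y" by metis
  define W where "W j = (if j = i then Z else z)" for j
  define pw where "pw j = (if j = i then p else b (X j))" for j
  define qj where "qj j = (if j = i then q else b (coprod C I A))" for j
  have pw: "\<forall>j\<in>I. pw j \<in> hom C (W j) (X j)" using p b X by (simp add: pw_def W_def)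
  note W = ball_hom_Obj(1)[OF pw]
  have qj: "\<forall>j\<in>I. qj j \<in> hom C (W j) (coprod C I A)"
    using q b[OF coprod_Obj[OF I A]] by (simp add: qj_def W_def)
  define qw where "qw = cotuple C I W (coprod C I A) qj"
  have qw: "qw \<in> hom C (coprod C I W) (coprod C I A)"
    unfolding qw_def using cotuple_hom[OF I coprod_Obj[OF I A] qj] .
  have qw_incl: "\<And>j. j \<in> I \<Longrightarrow> qw \<cdot> incl C I W j = qj j"
    unfolding qw_def using cotuple_incl[OF I coprod_Obj[OF I A] qj] .
  note F = coprod_map_hom[OF I f]
  have "\<forall>j\<in>I. (coprod_map C I f \<cdot> qw) \<cdot> incl C I W j = incl C I X j \<cdot> pw j"
  proof
    fix j assume j: "j \<in> I"
    have 1: "(coprod_map C I f \<cdot> qw) \<cdot> incl C I W j = coprod_map C I f \<cdot> qj j"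
      using Comp_assoc[OF incl_hom[OF I W j] qw F] qw_incl[OF j] by simp
    show "(coprod_map C I f \<cdot> qw) \<cdot> incl C I W j = incl C I X j \<cdot> pw j"
    proof (cases "j = i")
      case True
      then show ?thesis using 1 eq by (simp add: qj_def pw_def)
    next
      case False
      then have "W j = z" by (simp add: W_def)
      then show ?thesis
        using 1 initial_eq[OF z] Comp_hom[OF bspec[OF qj j] F]
          Comp_hom[OF bspec[OF pw j] incl_hom[OF I X j]] by metis
    qed
  qed
  from coprod_map_unique[OF I pw Comp_hom[OF qw F] this]
  have fqw: "coprod_map C I f \<cdot> qw = coprod_map C I pw" .
  \<comment> \<open>Objects of the product category are extensional, hence these restrictions; they
    leave the sums unchanged.\<close>
  define w where "w = restrict pw I"
  define fr where "fr = restrict f I"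
  have Dw: "\<And>j. j \<in> I \<Longrightarrow> w j = pw j \<and> Dom C (w j) = W j"
    and Df: "\<And>j. j \<in> I \<Longrightarrow> fr j = f j \<and> Dom C (fr j) = A j"
    using f pw by (auto simp: w_def fr_def hom_def)
  have w: "w \<in> Obj ?P" and fr: "fr \<in> Obj ?P"
    using pw f by (auto simp: w_def fr_def hom_def)
  have "coprod_map C I pw = coprod_map C I w" "coprod_map C I f = coprod_map C I fr"
    using coprod_map_cong[OF I pw, of w] coprod_map_cong[OF I f, of fr] Dw Df by simp_all
  then have Fw: "FObj ?F w = coprod_map C I pw" and Ff: "FObj ?F fr = coprod_map C I f"
    by (simp_all add: slice_sum_def)
  note Pw = coprod_map_hom[OF I pw]
  define T where "T = (coprod_map C I pw, qw, coprod_map C I f)"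
  have T: "T \<in> hom ?S (FObj ?F w) (FObj ?F fr)"
    unfolding slice_hom_iff T_def Fw Ff
    using fqw Pw F qw homD[OF Pw] homD[OF F] by simp
  have ex1: "\<exists>!t. t \<in> hom ?P w fr \<and> FArr ?F t = T"
    using equivalence_imp_full_faithful[OF extensive_slice_equivalence[OF ext I X]] w fr T
    unfolding full_faithful_def by blast
  show "\<exists>!h. h \<in> hom C Z (A i) \<and> f i \<cdot> h = p \<and> incl C I A i \<cdot> h = q"
  proof (rule ex_ex1I)
    obtain t where t: "t \<in> hom ?P w fr" "FArr ?F t = T"
      using ex1_implies_ex[OF ex1] by blast
    note a = slice_prod_hom[OF t(1)]
    have h: "\<forall>j\<in>I. fst (snd (t j)) \<in> hom C (W j) (A j)" using a(3) Dw Df by (metis (no_types))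
    have "coprod_map C I (\<lambda>j. fst (snd (t j))) = qw"
      using slice_sum_FArr[OF I t(1)] t(2) by (simp add: T_def)
    then have "incl C I A i \<cdot> fst (snd (t i)) = q"
      using coprod_map_incl[OF I h i] qw_incl[OF i] by (simp add: qj_def)
    moreover have "f i \<cdot> fst (snd (t i)) = p" using bspec[OF a(4) i] Dw[OF i] Df[OF i]
      by (simp add: pw_def)
    moreover have "fst (snd (t i)) \<in> hom C Z (A i)" using bspec[OF h i] by (simp add: W_def)
    ultimately show "\<exists>h. h \<in> hom C Z (A i) \<and> f i \<cdot> h = p \<and> incl C I A i \<cdot> h = q" by blast
  next
    \<comment> \<open>Uniqueness: every mediating map \<open>h\<close>, padded in the same way,
      yields a preimage \<open>t h\<close> of the same \<open>T\<close>. Any two such preimages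
      coincide, in particular at \<open>i\<close>.\<close>
    define H where "H h j = (if j = i then h else b (A j))" for h j
    define t where "t h = (\<lambda>j\<in>I. (w j, H h j, fr j))" for h
    have th: "t h \<in> hom ?P w fr \<and> FArr ?F (t h) = T"
      if h: "h \<in> hom C Z (A i)" and fh: "f i \<cdot> h = p" and qh: "incl C I A i \<cdot> h = q" for h
    proof -
      have H: "\<forall>j\<in>I. H h j \<in> hom C (W j) (A j)" using h b A by (simp add: H_def W_def)
      have fH: "f j \<cdot> H h j = pw j" if j: "j \<in> I" for j
      proof (cases "j = i")
        case True
        then show ?thesis using fh by (simp add: H_def pw_def)
      next
        case False
        then have "W j = z" by (simp add: W_def)
        then show ?thesis
          using initial_eq[OF z] Comp_hom[OF bspec[OF H j] bspec[OF f j]] bspec[OF pw j] by metis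
      qed
      have t: "t h \<in> hom ?P w fr"
        unfolding prod_cat_hom_iff
      proof (intro conjI ballI)
        fix j assume j: "j \<in> I"
        show "t h j \<in> hom (slice C (X j)) (w j) (fr j)"
          unfolding slice_hom_iff
          using j Dw[OF j] Df[OF j] bspec[OF H j] fH[OF j] homD[OF bspec[OF pw j]] homD[OF bspec[OF f j]]
          by (simp add: t_def)
      qed (simp_all add: t_def w_def fr_def)
      have "\<forall>j\<in>I. qw \<cdot> incl C I W j = incl C I A j \<cdot> H h j"
      proof
        fix j assume j: "j \<in> I"
        show "qw \<cdot> incl C I W j = incl C I A j \<cdot> H h j"
        proof (cases "j = i")
          case True
          then show ?thesis using qh qw_incl[OF j] by (simp add: H_def qj_def)
        next
          case False
          then have "W j = z" by (simp add: W_def)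
          then show ?thesis
            using initial_eq[OF z] Comp_hom[OF bspec[OF H j] incl_hom[OF I A j]]
              Comp_hom[OF incl_hom[OF I W j] qw] by metis
        qed
      qed
      from coprod_map_unique[OF I H qw this]
      have "coprod_map C I (H h) = qw" by simp
      moreover have "\<forall>j\<in>I. H h j = fst (snd (t h j))" by (simp add: t_def)
      note coprod_map_cong[OF I H this]
      ultimately show ?thesis
        using t slice_sum_FArr[OF I t] Fw Ff by (simp add: T_def slice_sum_def)
    qed
    fix h k assume "h \<in> hom C Z (A i) \<and> f i \<cdot> h = p \<and> incl C I A i \<cdot> h = q"
      and "k \<in> hom C Z (A i) \<and> f i \<cdot> k = p \<and> incl C I A i \<cdot> k = q"
    then have "t h = t k" using th[of h] th[of k] ex1 by blast
    then have "t h i = t k i" by simp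
    then show "h = k" using i by (simp add: t_def H_def)
  qed
qed

text \<open>A morphism \<open>k\<close> between two sums over the base poses, along each inclusion,
  a pullback problem; the solutions form the family that \<open>k\<close> comes from. Essential
  surjectivity is the decomposition of a map read backwards.\<close>

lemma extensiveI:
  assumes pb: inclusions_pullback and dec: maps_decompose
  shows "extensive small C"
  unfolding extensive_def
proof (intro conjI allI impI)
  show "category C" "has_small_coproducts small C"
    using category_axioms small_coproducts by auto
next
  fix I :: "'u set" and X
  assume I: "small I" and X: "\<forall>i\<in>I. X i \<in> Obj C"
  let ?P = "prod_cat I (\<lambda>i. slice C (X i))" and ?S = "slice C (coprod C I X)"
  let ?F = "slice_sum C I"
  show "equivalence ?P ?S ?F"
  proof (rule equivalenceI[OF is_functor_slice_sum[OF I]])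
    show "full_faithful ?P ?S ?F"
      unfolding full_faithful_def
    proof (intro ballI)
      fix x y T assume xO: "x \<in> Obj ?P" and yO: "y \<in> Obj ?P" and T: "T \<in> hom ?S (FObj ?F x) (FObj ?F y)"
      note x = slice_sum_FObj[OF I xO] and y = slice_sum_FObj[OF I yO]
      let ?A = "\<lambda>i. Dom C (x i)" and ?B = "\<lambda>i. Dom C (y i)"
      note A = ball_hom_Obj(1)[OF x(3)]
      obtain k where T_eq: "T = (coprod_map C I x, k, coprod_map C I y)"
        and k: "k \<in> hom C (coprod C I ?A) (coprod C I ?B)"
        and yk: "coprod_map C I y \<cdot> k = coprod_map C I x"
        using T unfolding slice_hom_iff x(1) y(1) homD(2)[OF x(2)] homD(2)[OF y(2)] by blast
      have ex1: "\<exists>!h. h \<in> hom C (?A i) (?B i) \<and> y i \<cdot> h = x i \<and>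
          incl C I ?B i \<cdot> h = k \<cdot> incl C I ?A i" if i: "i \<in> I" for i
      proof -
        have "coprod_map C I y \<cdot> k \<cdot> incl C I ?A i = incl C I X i \<cdot> x i"
          using Comp_assoc[OF incl_hom[OF I A i] k y(2)] yk coprod_map_incl[OF I x(3) i] by simp
        then show ?thesis
          using pb[unfolded inclusions_pullback_def, rule_format, of I y ?B X i "x i" "?A i"]
            I y(3) i x(3) Comp_hom[OF incl_hom[OF I A i] k] by simp
      qed
      then have "\<forall>i. \<exists>h. i \<in> I \<longrightarrow> h \<in> hom C (?A i) (?B i) \<and> y i \<cdot> h = x i \<and>
          incl C I ?B i \<cdot> h = k \<cdot> incl C I ?A i" by blast
      then obtain h where h: "\<forall>i\<in>I. h i \<in> hom C (?A i) (?B i)" "\<forall>i\<in>I. y i \<cdot> h i = x i"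
        "\<forall>i\<in>I. k \<cdot> incl C I ?A i = incl C I ?B i \<cdot> h i" by metis
      define t where "t = (\<lambda>i\<in>I. (x i, h i, y i))"
      have t: "t \<in> hom ?P x y"
        unfolding prod_cat_hom_iff
      proof (intro conjI ballI)
        fix i assume i: "i \<in> I"
        show "t i \<in> hom (slice C (X i)) (x i) (y i)"
          unfolding slice_hom_iff using i h homD[OF bspec[OF x(3) i]] homD[OF bspec[OF y(3) i]]
          by (simp add: t_def)
      qed (use xO yO in \<open>simp_all add: t_def PiE_iff\<close>)
      have "k = coprod_map C I h" using coprod_map_unique[OF I h(1) k h(3)] .
      moreover have "\<forall>i\<in>I. h i = fst (snd (t i))" by (simp add: t_def)
      note coprod_map_cong[OF I h(1) this]
      ultimately have Ft: "FArr ?F t = T" using slice_sum_FArr[OF I t] T_eq by simp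
      show "\<exists>!t. t \<in> hom ?P x y \<and> FArr ?F t = T"
      proof (rule ex1I[of _ t])
        \<comment> \<open>The components of any other preimage solve the same pullback
          problems.\<close>
        fix s assume s: "s \<in> hom ?P x y \<and> FArr ?F s = T"
        then have sh: "s \<in> hom ?P x y" by simp
        note a = slice_prod_hom[OF sh]
        have "coprod_map C I (\<lambda>i. fst (snd (s i))) = k"
          using s slice_sum_FArr[OF I sh] T_eq by simp
        then have "incl C I ?B i \<cdot> fst (snd (s i)) = k \<cdot> incl C I ?A i" if "i \<in> I" for i
          using coprod_map_incl[OF I a(3) that] by simp
        then have "fst (snd (s i)) = h i" if i: "i \<in> I" for i
          using ex1[OF i] i a(3,4) h by (metis (no_types, lifting))
        then have "s i = t i" if "i \<in> I" for i
          using bspec[OF a(5) that] that by (simp add: t_def)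
        then show "s = t"
          using sh t unfolding prod_cat_hom_iff by (intro extensionalityI[of s I t]) auto
      qed (simp add: t Ft)
    qed
  next
    show "ess_surj ?P ?S ?F"
      unfolding ess_surj_def
    proof
      fix f assume "f \<in> Obj ?S"
      then have f: "f \<in> hom C (Dom C f) (coprod C I X)" by (simp add: hom_def)
      then obtain N m g where N: "is_coproduct C I N (Dom C f) m"
        and g: "\<forall>i\<in>I. g i \<in> hom C (N i) (X i)" "\<forall>i\<in>I. f \<cdot> m i = incl C I X i \<cdot> g i"
        using dec I X unfolding maps_decompose_def by blast
      note NO = ball_hom_Obj(1)[OF g(1)]
      \<comment> \<open>The pieces form some coproduct, whereas the slice sum uses the chosen one.
        The comparison \<open>e\<close> becomes the isomorphism in the slice.\<close>
      obtain e where e: "iso C (coprod C I N) (Dom C f) e" "\<forall>i\<in>I. e \<cdot> incl C I N i = m i"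
        using is_coproduct_comparison[OF is_coproduct_coprod[OF I NO] N] .
      have e': "e \<in> hom C (coprod C I N) (Dom C f)" using e(1) by (simp add: iso_def)
      have "\<forall>i\<in>I. (f \<cdot> e) \<cdot> incl C I N i = incl C I X i \<cdot> g i"
        using Comp_assoc[OF incl_hom[OF I NO] e' f] e(2) g(2) by simp
      from coprod_map_unique[OF I g(1) Comp_hom[OF e' f] this]
      have fe: "f \<cdot> e = coprod_map C I g" .
      define x where "x = restrict g I"
      have x: "x \<in> Obj ?P" using g(1) by (auto simp: x_def hom_def)
      have "\<forall>i\<in>I. g i = x i" by (simp add: x_def)
      from coprod_map_cong[OF I g(1) this]
      have Fx: "FObj ?F x = coprod_map C I g" by (simp add: slice_sum_def)
      have "iso ?S (FObj ?F x) f (coprod_map C I g, e, f)"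
        unfolding Fx using iso_sliceI[OF e(1) coprod_map_hom[OF I g(1)] f fe] .
      then show "\<exists>x\<in>Obj ?P. \<exists>t. iso ?S (FObj ?F x) f t" using x by blast
    qed
  qed
qed

end

section \<open>Strict initial object, disjoint inclusions and joint decompositions\<close>

locale extensive_category = coprod_category C small
  for C :: "('o, 'a) cat" and small :: "'u set \<Rightarrow> bool" +
  assumes extensive: "extensive small C"
begin

text \<open>Up to isomorphism an initial object is the coproduct of the empty family, and
  decomposing a map into that coproduct exhibits its source as an empty coproduct too.\<close>

lemma strict_initial:
  assumes z: "initial z" and h: "h \<in> hom C Z z"
  shows "initial Z"
proof -
  fix X :: "'u \<Rightarrow> 'o"
  have I: "small ({} :: 'u set)" by (rule small_finite) simp
  then have "coprod C {} X \<in> Obj C" by (rule coprod_Obj) simp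
  then obtain u where "u \<in> hom C z (coprod C {} X)" using initial_hom[OF z] by blast
  then have "u \<cdot> h \<in> hom C Z (coprod C {} X)" using Comp_hom h by blast
  then obtain N m where "is_coproduct C ({} :: 'u set) N Z m"
    using extensive_imp_maps_decompose[OF extensive] I unfolding maps_decompose_def by blast
  then show ?thesis by (simp add: is_coproduct_empty)
qed

text \<open>The pullback condition is tested on the family with \<open>X i\<close> at
  \<open>i\<close> and an initial object elsewhere. At an index \<open>j\<close> other than
  \<open>i\<close> it yields a map from \<open>Z\<close> to an initial object; at
  \<open>j = i\<close> it compares \<open>a\<close> and \<open>b\<close> through a split
  monomorphism.\<close>

lemma inclusions_disjoint_mono:
  assumes I: "small I" and X: "\<forall>i\<in>I. X i \<in> Obj C" and i: "i \<in> I" and j: "j \<in> I"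
    and a: "a \<in> hom C Z (X i)" and b: "b \<in> hom C Z (X j)"
    and eq: "incl C I X i \<cdot> a = incl C I X j \<cdot> b"
  shows "i = j \<and> a = b \<or> initial Z"
proof -
  obtain z where z: "initial z" using initial_exists by blast
  then have "\<forall>Y. \<exists>c. Y \<in> Obj C \<longrightarrow> c \<in> hom C z Y" using initial_hom by blast
  then obtain c where c: "\<And>Y. Y \<in> Obj C \<Longrightarrow> c Y \<in> hom C z Y" by metis
  note Xi = bspec[OF X i]
  define A where "A k = (if k = i then X i else z)" for k
  define f where "f k = (if k = i then Ide C (X i) else c (X k))" for k
  define r where "r k = (if k = i then Ide C (X i) else c (X i))" for k
  have f: "\<forall>k\<in>I. f k \<in> hom C (A k) (X k)" and r: "\<forall>k\<in>I. r k \<in> hom C (A k) (X i)"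
    using Ide_hom[OF Xi] c X i by (auto simp: f_def r_def A_def)
  note AO = ball_hom_Obj(1)[OF f]
  have \<iota>: "incl C I A i \<in> hom C (X i) (coprod C I A)"
    using incl_hom[OF I AO i] A_def[of i] by simp
  have f\<iota>: "coprod_map C I f \<cdot> incl C I A i = incl C I X i"
    using coprod_map_incl[OF I f i] Comp_Ide[OF incl_hom[OF I X i]] f_def[of i] by simp
  have "coprod_map C I f \<cdot> incl C I A i \<cdot> a = incl C I X j \<cdot> b"
    using Comp_assoc[OF a \<iota> coprod_map_hom[OF I f]] f\<iota> eq by simp
  from extensive_imp_inclusions_pullback[OF extensive, unfolded inclusions_pullback_def, rule_format,
    OF I bspec[OF f] j b Comp_hom[OF a \<iota>] this]
  obtain h where h: "h \<in> hom C Z (A j)" "f j \<cdot> h = b" "incl C I A j \<cdot> h = incl C I A i \<cdot> a"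
    by blast
  show ?thesis
  proof (cases "i = j")
    case False
    then show ?thesis using h(1) strict_initial[OF z, of h] by (simp add: A_def)
  next
    case True
    \<comment> \<open>As all other summands of the test family are initial, each of them maps to
      \<open>X i\<close>. So its inclusion at \<open>i\<close> has a retraction, even where the
      original family offers no maps to \<open>X i\<close>.\<close>
    define R where "R = cotuple C I A (X i) r"
    have R: "R \<in> hom C (coprod C I A) (X i)" "R \<cdot> incl C I A i = Ide C (X i)"
      unfolding R_def using cotuple_hom[OF I Xi r] cotuple_incl[OF I Xi r i] r_def[of i] by simp_all
    have h': "h \<in> hom C Z (X i)" using h(1) True by (simp add: A_def)
    have hb: "h = b" using h(2) True Ide_Comp[OF h'] f_def[of i] by simp
    then have b': "b \<in> hom C Z (X i)" using h' by simp
    have "a = R \<cdot> incl C I A i \<cdot> a" using Comp_assoc[OF a \<iota> R(1)] R(2) Ide_Comp[OF a] by simp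
    also have "\<dots> = R \<cdot> incl C I A i \<cdot> b" using h(3) hb True by simp
    also have "\<dots> = b" using Comp_assoc[OF b' \<iota> R(1)] R(2) Ide_Comp[OF b'] by simp
    finally have "a = b" .
    then show ?thesis using True by simp
  qed
qed

text \<open>The pieces are refined one map at a time, by decomposing the restriction of the new map
  to every existing piece. It is applied to the legs of a cone and also to a pair of parallel maps.
  No uniqueness of the summand is claimed: it may fail on initial pieces.\<close>

lemma joint_decomposition:
  assumes "finite K" and M: "M \<in> Obj C"
    and "\<forall>k\<in>K. small (B k) \<and> (\<forall>x\<in>B k. X k x \<in> Obj C) \<and> f k \<in> hom C M (coprod C (B k) (X k))"
  shows "\<exists>I N m. small I \<and> is_coproduct C I N M m \<and> (\<forall>i\<in>I. \<forall>k\<in>K. \<exists>x\<in>B k. \<exists>a\<in>hom C (N i) (X k x).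
    f k \<cdot> m i = incl C (B k) (X k) x \<cdot> a)"
  using assms(1,3)
proof (induction K)
  case empty
  \<comment> \<open>With no maps to decompose, \<open>M\<close> is its own single piece, under an
    arbitrary index. This covers cones over the empty diagram.\<close>
  have "is_coproduct C {undefined} (\<lambda>_. M) M (\<lambda>_. Ide C M)" using is_coproduct_singleton[OF M] .
  then show ?case using small_finite[of "{undefined}"] by blast
next
  case (insert k K)
  then obtain I N m where I: "small I" and M: "is_coproduct C I N M m"
    and fac: "\<And>i l. i \<in> I \<Longrightarrow> l \<in> K \<Longrightarrow> \<exists>x\<in>B l. \<exists>a\<in>hom C (N i) (X l x).
      f l \<cdot> m i = incl C (B l) (X l) x \<cdot> a"
    by auto
  have Bk: "small (B k)" and Xk: "\<forall>x\<in>B k. X k x \<in> Obj C" and fk: "f k \<in> hom C M (coprod C (B k) (X k))"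
    using insert.prems by auto
  have "\<forall>i\<in>I. \<exists>N' m' g. is_coproduct C (B k) N' (N i) m' \<and> (\<forall>x\<in>B k. g x \<in> hom C (N' x) (X k x)) \<and>
      (\<forall>x\<in>B k. (f k \<cdot> m i) \<cdot> m' x = incl C (B k) (X k) x \<cdot> g x)"
  proof
    fix i assume i: "i \<in> I"
    have "f k \<cdot> m i \<in> hom C (N i) (coprod C (B k) (X k))"
      using Comp_hom[OF is_coproduct_hom[OF M i] fk] .
    then show "\<exists>N' m' g. is_coproduct C (B k) N' (N i) m' \<and> (\<forall>x\<in>B k. g x \<in> hom C (N' x) (X k x)) \<and>
        (\<forall>x\<in>B k. (f k \<cdot> m i) \<cdot> m' x = incl C (B k) (X k) x \<cdot> g x)"
      using extensive_imp_maps_decompose[OF extensive] Bk Xk unfolding maps_decompose_def by blast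
  qed
  from this[unfolded bchoice_iff] obtain N' where "\<forall>i\<in>I. \<exists>m' g. is_coproduct C (B k) (N' i) (N i) m' \<and>
      (\<forall>x\<in>B k. g x \<in> hom C (N' i x) (X k x)) \<and>
      (\<forall>x\<in>B k. (f k \<cdot> m i) \<cdot> m' x = incl C (B k) (X k) x \<cdot> g x)" by blast
  from this[unfolded bchoice_iff] obtain m' where "\<forall>i\<in>I. \<exists>g. is_coproduct C (B k) (N' i) (N i) (m' i) \<and>
      (\<forall>x\<in>B k. g x \<in> hom C (N' i x) (X k x)) \<and>
      (\<forall>x\<in>B k. (f k \<cdot> m i) \<cdot> m' i x = incl C (B k) (X k) x \<cdot> g x)" by blast
  from this[unfolded bchoice_iff] obtain g where
    m': "\<And>i. i \<in> I \<Longrightarrow> is_coproduct C (B k) (N' i) (N i) (m' i)"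
    and g: "\<And>i x. i \<in> I \<Longrightarrow> x \<in> B k \<Longrightarrow> g i x \<in> hom C (N' i x) (X k x)"
    and eq: "\<And>i x. i \<in> I \<Longrightarrow> x \<in> B k \<Longrightarrow> (f k \<cdot> m i) \<cdot> m' i x = incl C (B k) (X k) x \<cdot> g i x"
    by blast
  \<comment> \<open>The refined pieces are indexed by pairs; coding them makes the index set a small
    subset of \<open>'u\<close> again.\<close>
  let ?D = "pair ` (I \<times> B k)"
  define N'' where "N'' s = N' (fst s) (snd s)" for s
  define m'' where "m'' s = m (fst s) \<cdot> m' (fst s) (snd s)" for s
  have "is_coproduct C (I \<times> B k) N'' M m''"
    using is_coproduct_Sigma[OF M, of "\<lambda>_. B k" N' m'] m' unfolding N''_def m''_def by simp
  from is_coproduct_reindex[OF this bij_betw_inv_pair]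
  have cop: "is_coproduct C ?D (\<lambda>s. N'' (inv pair s)) M (\<lambda>s. m'' (inv pair s))" .
  have "\<exists>x\<in>B l. \<exists>a\<in>hom C (N'' s) (X l x). f l \<cdot> m'' s = incl C (B l) (X l) x \<cdot> a"
    if s: "s \<in> I \<times> B k" and l: "l \<in> insert k K" for s l
  proof -
    obtain i y where s_eq: "s = (i, y)" and i: "i \<in> I" and y: "y \<in> B k" using s by auto
    note mi = is_coproduct_hom[OF M i] and m'y = is_coproduct_hom[OF m'[OF i] y]
    have fl: "f l \<in> hom C M (coprod C (B l) (X l))" and Bl: "small (B l)"
      and Xl: "\<forall>x\<in>B l. X l x \<in> Obj C"
      using insert.prems l by auto
    have split: "f l \<cdot> m'' s = (f l \<cdot> m i) \<cdot> m' i y"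
      using Comp_assoc[OF m'y mi fl] s_eq by (simp add: m''_def)
    show ?thesis
    proof (cases "l = k")
      case True
      then show ?thesis using split eq[OF i y] g[OF i y] y s_eq by (auto simp: N''_def)
    next
      case False
      then obtain x a where x: "x \<in> B l" and a: "a \<in> hom C (N i) (X l x)"
        and fa: "f l \<cdot> m i = incl C (B l) (X l) x \<cdot> a"
        using fac[OF i, of l] l by auto
      \<comment> \<open>An earlier map stays in its summand under refinement: its factor is composed
        with the inclusion of the smaller piece.\<close>
      have "f l \<cdot> m'' s = incl C (B l) (X l) x \<cdot> a \<cdot> m' i y"
        using split fa Comp_assoc[OF m'y a incl_hom[OF Bl Xl x]] by simp
      moreover have "a \<cdot> m' i y \<in> hom C (N'' s) (X l x)"
        using Comp_hom[OF m'y a] s_eq by (simp add: N''_def)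
      ultimately show ?thesis using x by blast
    qed
  qed
  then have "\<forall>s\<in>?D. \<forall>l\<in>insert k K. \<exists>x\<in>B l. \<exists>a\<in>hom C (N'' (inv pair s)) (X l x).
      f l \<cdot> m'' (inv pair s) = incl C (B l) (X l) x \<cdot> a"
    by auto
  moreover have "small ?D" using small_pair_Sigma[OF I, of "\<lambda>_. B k"] Bk by simp
  ultimately show ?case using cop by blast
qed

end

section \<open>The free coproduct completion is extensive\<close>

lemma iso_hom: "iso C x y e \<Longrightarrow> e \<in> hom C x y"
  by (simp add: iso_def)

lemma (in category) iso_Ide: "x \<in> Obj C \<Longrightarrow> iso C x x (Ide C x)"
  unfolding iso_def using Ide_hom Comp_Ide by blast

text \<open>Arrows of \<open>Fam\<close> carry extensional functions. Building the restrictions in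
  leaves only values on \<open>Ix c\<close> to be checked.\<close>

definition fam_map ::
  "('u, 'o) fam \<Rightarrow> ('u, 'o) fam \<Rightarrow> ('u \<Rightarrow> 'u) \<Rightarrow> ('u \<Rightarrow> 'a) \<Rightarrow> ('u, 'o, 'a) fam_arr" where
  "fam_map c d F A = \<lparr>FDom = c, FCod = d, IxMap = restrict F (Ix c), AtMap = restrict A (Ix c)\<rparr>"

lemma fam_map_apply [simp]:
  "x \<in> Ix c \<Longrightarrow> IxMap (fam_map c d F A) x = F x"
  "x \<in> Ix c \<Longrightarrow> AtMap (fam_map c d F A) x = A x"
  by (simp_all add: fam_map_def)

section \<open>The category of families and its coproducts\<close>

locale category_smallness = category C + smallness small
  for C :: "('o, 'a) cat" and small :: "'u set \<Rightarrow> bool"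
begin

abbreviation FC where "FC \<equiv> Fam small C"

abbreviation fcomp (infixr "\<odot>" 75) where "g \<odot> f \<equiv> Comp FC g f"

lemma Fam_Obj_iff: "c \<in> Obj FC \<longleftrightarrow>
    small (Ix c) \<and> (\<forall>x\<in>Ix c. At c x \<in> Obj C) \<and> At c \<in> extensional (Ix c)"
  by (auto simp: Fam_def fam_obj_def PiE_iff)

lemma Fam_hom_iff: "f \<in> hom FC c d \<longleftrightarrow> c \<in> Obj FC \<and> d \<in> Obj FC \<and> FDom f = c \<and> FCod f = d \<and>
    IxMap f \<in> extensional (Ix c) \<and> AtMap f \<in> extensional (Ix c) \<and>
    (\<forall>x\<in>Ix c. IxMap f x \<in> Ix d \<and> AtMap f x \<in> hom C (At c x) (At d (IxMap f x)))"
  unfolding hom_def[of FC c d] by (auto simp: Fam_def PiE_iff)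

lemma Fam_homD:
  assumes "f \<in> hom FC c d"
  shows "c \<in> Obj FC" "d \<in> Obj FC" "FDom f = c" "FCod f = d"
    "\<And>x. x \<in> Ix c \<Longrightarrow> IxMap f x \<in> Ix d"
    "\<And>x. x \<in> Ix c \<Longrightarrow> AtMap f x \<in> hom C (At c x) (At d (IxMap f x))"
  using assms by (simp_all add: Fam_hom_iff)

lemma fam_map_hom:
  assumes "c \<in> Obj FC" "d \<in> Obj FC" "\<And>x. x \<in> Ix c \<Longrightarrow> F x \<in> Ix d"
    "\<And>x. x \<in> Ix c \<Longrightarrow> A x \<in> hom C (At c x) (At d (F x))"
  shows "fam_map c d F A \<in> hom FC c d"
  using assms by (simp add: Fam_hom_iff) (simp add: fam_map_def)

lemma Fam_eqI:
  assumes f: "f \<in> hom FC c d" and g: "g \<in> hom FC c d"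
    and "\<And>x. x \<in> Ix c \<Longrightarrow> IxMap f x = IxMap g x" "\<And>x. x \<in> Ix c \<Longrightarrow> AtMap f x = AtMap g x"
  shows "f = g"
proof -
  have "IxMap f = IxMap g" "AtMap f = AtMap g"
    using f g assms(3,4) by (auto simp: Fam_hom_iff intro: extensionalityI)
  then show ?thesis using Fam_homD(3,4)[OF f] Fam_homD(3,4)[OF g] by simp
qed

lemma Fam_Comp_apply:
  assumes "f \<in> hom FC c d" "x \<in> Ix c"
  shows "IxMap (g \<odot> f) x = IxMap g (IxMap f x)"
    and "AtMap (g \<odot> f) x = AtMap g (IxMap f x) \<cdot> AtMap f x"
  using assms Fam_homD(3)[OF assms(1)] by (simp_all add: Fam_def)

lemma Fam_Ide_apply:
  assumes "x \<in> Ix c"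
  shows "IxMap (Ide FC c) x = x" "AtMap (Ide FC c) x = Ide C (At c x)"
  using assms by (simp_all add: Fam_def)

lemma Fam_Ide_hom: "c \<in> Obj FC \<Longrightarrow> Ide FC c \<in> hom FC c c"
  unfolding Fam_hom_iff using Fam_Ide_apply Ide_hom
  by (simp add: Fam_Obj_iff) (simp add: Fam_def)

lemma Fam_Comp_hom:
  assumes f: "f \<in> hom FC c d" and g: "g \<in> hom FC d e"
  shows "g \<odot> f \<in> hom FC c e"
proof -
  have "IxMap (g \<odot> f) x \<in> Ix e \<and> AtMap (g \<odot> f) x \<in> hom C (At c x) (At e (IxMap (g \<odot> f) x))"
    if x: "x \<in> Ix c" for x
    using Fam_homD(5)[OF g] Comp_hom[OF Fam_homD(6)[OF f x] Fam_homD(6)[OF g]]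
      Fam_homD(5)[OF f x] Fam_Comp_apply[OF f x] by simp
  then show ?thesis
    unfolding Fam_hom_iff using Fam_homD[OF f] Fam_homD[OF g] by simp (simp add: Fam_def)
qed

lemma category_Fam: "category FC"
proof (unfold_locales, goal_cases)
  case (1 f)
  then show ?case by (simp add: Fam_def)
next
  case (2 f)
  then show ?case by (simp add: Fam_def)
next
  case (3 x)
  then show ?case by (rule Fam_Ide_hom)
next
  case (4 f x y g z)
  then show ?case by (rule Fam_Comp_hom)
next
  case (5 f x y)
  note i = Fam_Ide_hom[OF Fam_homD(1)[OF 5]]
  show ?case
    by (rule Fam_eqI[OF Fam_Comp_hom[OF i 5] 5])
      (simp_all add: Fam_Comp_apply[OF i] Fam_Ide_apply Comp_Ide[OF Fam_homD(6)[OF 5]])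
next
  case (6 f x y)
  note i = Fam_Ide_hom[OF Fam_homD(2)[OF 6]]
  show ?case
    by (rule Fam_eqI[OF Fam_Comp_hom[OF 6 i] 6])
      (simp_all add: Fam_Comp_apply[OF 6] Fam_Ide_apply Fam_homD(5)[OF 6] Ide_Comp[OF Fam_homD(6)[OF 6]])
next
  case (7 f w x g y h z)
  note gf = Fam_Comp_hom[OF 7(1,2)] and hg = Fam_Comp_hom[OF 7(2,3)]
  have g: "IxMap f s \<in> Ix x" "IxMap g (IxMap f s) \<in> Ix y" if "s \<in> Ix w" for s
    using Fam_homD(5)[OF 7(1) that] Fam_homD(5)[OF 7(2)] by auto
  show ?case
    by (rule Fam_eqI[OF Fam_Comp_hom[OF gf 7(3)] Fam_Comp_hom[OF 7(1) hg]])
      (simp_all add: Fam_Comp_apply[OF gf] Fam_Comp_apply[OF 7(1)] Fam_Comp_apply[OF 7(2)] g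
        Comp_assoc[OF Fam_homD(6)[OF 7(1)] Fam_homD(6)[OF 7(2)] Fam_homD(6)[OF 7(3)]])
qed

sublocale Fam: category FC
  by (rule category_Fam)

text \<open>Evaluating the two inverse laws at an index splits them into mutually inverse index maps
  and, over each index, mutually inverse components.\<close>

lemma Fam_isoD:
  assumes "iso FC c d e"
  shows "bij_betw (IxMap e) (Ix c) (Ix d)"
    and "\<And>x. x \<in> Ix c \<Longrightarrow> iso C (At c x) (At d (IxMap e x)) (AtMap e x)"
proof -
  obtain k where e: "e \<in> hom FC c d" and k: "k \<in> hom FC d c"
    and ke: "k \<odot> e = Ide FC c" and ek: "e \<odot> k = Ide FC d"
    using assms by (auto simp: iso_def)
  have 1: "IxMap k (IxMap e x) = x" "AtMap k (IxMap e x) \<cdot> AtMap e x = Ide C (At c x)"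
    if "x \<in> Ix c" for x
    using Fam_Comp_apply[OF e that, of k] ke Fam_Ide_apply[OF that] by simp_all
  have 2: "IxMap e (IxMap k y) = y" "AtMap e (IxMap k y) \<cdot> AtMap k y = Ide C (At d y)"
    if "y \<in> Ix d" for y
    using Fam_Comp_apply[OF k that, of e] ek Fam_Ide_apply[OF that] by simp_all
  show "bij_betw (IxMap e) (Ix c) (Ix d)"
    by (rule bij_betw_byWitness[where f' = "IxMap k"])
      (use 1 2 Fam_homD(5)[OF e] Fam_homD(5)[OF k] in auto)
  fix x assume x: "x \<in> Ix c"
  note ex = Fam_homD(5)[OF e x]
  have "AtMap k (IxMap e x) \<in> hom C (At d (IxMap e x)) (At c x)"
    using Fam_homD(6)[OF k ex] 1(1)[OF x] by simp
  moreover have "AtMap e x \<cdot> AtMap k (IxMap e x) = Ide C (At d (IxMap e x))"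
    using 2(2)[OF ex] 1(1)[OF x] by simp
  ultimately show "iso C (At c x) (At d (IxMap e x)) (AtMap e x)"
    unfolding iso_def using Fam_homD(6)[OF e x] 1(2)[OF x] by blast
qed

text \<open>The concrete form of a coproduct cocone in \<open>Fam\<close>. Components are required
  to be invertible rather than identities, because a chosen coproduct is known only up to
  isomorphism. \<open>Fam_is_coproductI\<close> and \<open>Fam_is_coproductD\<close> compare this
  with the universal property.\<close>

definition covers_disjointly :: "'u set \<Rightarrow> ('u \<Rightarrow> ('u, 'o) fam) \<Rightarrow> ('u, 'o) fam \<Rightarrow>
    ('u \<Rightarrow> ('u, 'o, 'a) fam_arr) \<Rightarrow> bool" where
  "covers_disjointly I X S \<iota> \<longleftrightarrow> S \<in> Obj FC \<and> (\<forall>i\<in>I. \<iota> i \<in> hom FC (X i) S) \<and>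
    bij_betw (\<lambda>s. IxMap (\<iota> (fst s)) (snd s)) (SIGMA i:I. Ix (X i)) (Ix S) \<and>
    (\<forall>i\<in>I. \<forall>a\<in>Ix (X i). iso C (At (X i) a) (At S (IxMap (\<iota> i) a)) (AtMap (\<iota> i) a))"

lemma covers_disjointlyD:
  assumes "covers_disjointly I X S \<iota>"
  shows "\<And>i. i \<in> I \<Longrightarrow> \<iota> i \<in> hom FC (X i) S"
    and "\<And>s. s \<in> Ix S \<Longrightarrow> \<exists>i\<in>I. \<exists>a\<in>Ix (X i). IxMap (\<iota> i) a = s"
    and "\<And>i j a b. i \<in> I \<Longrightarrow> j \<in> I \<Longrightarrow> a \<in> Ix (X i) \<Longrightarrow> b \<in> Ix (X j) \<Longrightarrow>
      IxMap (\<iota> i) a = IxMap (\<iota> j) b \<Longrightarrow> i = j \<and> a = b"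
    and "\<And>i a. i \<in> I \<Longrightarrow> a \<in> Ix (X i) \<Longrightarrow>
      iso C (At (X i) a) (At S (IxMap (\<iota> i) a)) (AtMap (\<iota> i) a)"
proof -
  let ?b = "\<lambda>s. IxMap (\<iota> (fst s)) (snd s)" and ?D = "SIGMA i:I. Ix (X i)"
  have bij: "inj_on ?b ?D" "?b ` ?D = Ix S"
    using assms by (simp_all add: covers_disjointly_def bij_betw_def)
  fix s assume "s \<in> Ix S"
  then obtain t where "t \<in> ?D" "s = ?b t" using bij(2) by blast
  then show "\<exists>i\<in>I. \<exists>a\<in>Ix (X i). IxMap (\<iota> i) a = s"
    by (intro bexI[of _ "fst t"] bexI[of _ "snd t"]) auto
next
  let ?b = "\<lambda>s. IxMap (\<iota> (fst s)) (snd s)" and ?D = "SIGMA i:I. Ix (X i)"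
  fix i j a b assume "i \<in> I" "j \<in> I" "a \<in> Ix (X i)" "b \<in> Ix (X j)" "IxMap (\<iota> i) a = IxMap (\<iota> j) b"
  moreover have "inj_on ?b ?D" using assms by (simp add: covers_disjointly_def bij_betw_def)
  ultimately show "i = j \<and> a = b" using inj_onD[of ?b ?D "(i, a)" "(j, b)"] by simp
qed (use assms in \<open>simp_all add: covers_disjointly_def\<close>)

text \<open>Each index of \<open>S\<close> comes from exactly one summand, so a cocone prescribes
  the index map of the copairing. Its components are obtained by dividing by the invertible
  components of the inclusions.\<close>

lemma Fam_is_coproductI:
  assumes S: "covers_disjointly I X S \<iota>"
  shows "is_coproduct FC I X S \<iota>"
proof (rule Fam.is_coproductI)
  note \<iota> = covers_disjointlyD[OF S]
  show SO: "S \<in> Obj FC" using S by (simp add: covers_disjointly_def)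
  show "\<And>i. i \<in> I \<Longrightarrow> \<iota> i \<in> hom FC (X i) S" using \<iota>(1) .
  {
    fix Y g assume Y: "Y \<in> Obj FC" and g: "\<forall>i\<in>I. g i \<in> hom FC (X i) Y"
    have "\<exists>i a. s \<in> Ix S \<longrightarrow> i \<in> I \<and> a \<in> Ix (X i) \<and> IxMap (\<iota> i) a = s" for s
      using \<iota>(2)[of s] by blast
    then obtain p q where pq: "\<And>s. s \<in> Ix S \<Longrightarrow> p s \<in> I \<and> q s \<in> Ix (X (p s)) \<and> IxMap (\<iota> (p s)) (q s) = s"
      by metis
    have "\<exists>v. s \<in> Ix S \<longrightarrow> v \<in> hom C (At S s) (At (X (p s)) (q s)) \<and>
        v \<cdot> AtMap (\<iota> (p s)) (q s) = Ide C (At (X (p s)) (q s))" for s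
      using \<iota>(4)[of "p s" "q s"] pq[of s] unfolding iso_def by auto
    then obtain v where v: "\<And>s. s \<in> Ix S \<Longrightarrow> v s \<in> hom C (At S s) (At (X (p s)) (q s))"
      "\<And>s. s \<in> Ix S \<Longrightarrow> v s \<cdot> AtMap (\<iota> (p s)) (q s) = Ide C (At (X (p s)) (q s))"
      by metis
    define h where "h = fam_map S Y (\<lambda>s. IxMap (g (p s)) (q s)) (\<lambda>s. AtMap (g (p s)) (q s) \<cdot> v s)"
    have h: "h \<in> hom FC S Y"
      unfolding h_def
    proof (rule fam_map_hom[OF SO Y])
      fix s assume s: "s \<in> Ix S"
      have gp: "g (p s) \<in> hom FC (X (p s)) Y" and qs: "q s \<in> Ix (X (p s))"
        using g pq[OF s] by simp_all
      show "IxMap (g (p s)) (q s) \<in> Ix Y" using Fam_homD(5)[OF gp qs] .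
      show "AtMap (g (p s)) (q s) \<cdot> v s \<in> hom C (At S s) (At Y (IxMap (g (p s)) (q s)))"
        using Comp_hom[OF v(1)[OF s] Fam_homD(6)[OF gp qs]] .
    qed
    have "h \<odot> \<iota> i = g i" if i: "i \<in> I" for i
    proof (rule Fam_eqI[OF Fam_Comp_hom[OF \<iota>(1)[OF i] h] bspec[OF g i]])
      fix a assume a: "a \<in> Ix (X i)"
      define s where "s = IxMap (\<iota> i) a"
      have s: "s \<in> Ix S" unfolding s_def using Fam_homD(5)[OF \<iota>(1)[OF i] a] .
      have ps: "p s = i" "q s = a"
        using \<iota>(3)[of "p s" i "q s" a] pq[OF s] i a by (auto simp: s_def)
      show "IxMap (h \<odot> \<iota> i) a = IxMap (g i) a"
        using Fam_Comp_apply(1)[OF \<iota>(1)[OF i] a, of h] s ps by (simp add: s_def[symmetric] h_def)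
      note ga = Fam_homD(6)[OF bspec[OF g i] a]
      have "AtMap (h \<odot> \<iota> i) a = (AtMap (g i) a \<cdot> v s) \<cdot> AtMap (\<iota> i) a"
        using Fam_Comp_apply(2)[OF \<iota>(1)[OF i] a, of h] s ps by (simp add: s_def[symmetric] h_def)
      also have "\<dots> = AtMap (g i) a \<cdot> v s \<cdot> AtMap (\<iota> i) a"
        using Comp_assoc[OF Fam_homD(6)[OF \<iota>(1)[OF i] a] _ ga, of "v s"] v(1)[OF s] ps
        by (simp add: s_def[symmetric])
      also have "\<dots> = AtMap (g i) a"
        using v(2)[OF s] ps Comp_Ide[OF ga] by simp
      finally show "AtMap (h \<odot> \<iota> i) a = AtMap (g i) a" .
    qed
    then show "\<exists>h. h \<in> hom FC S Y \<and> (\<forall>i\<in>I. h \<odot> \<iota> i = g i)" using h by blast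
  }
  fix Y h k assume h: "h \<in> hom FC S Y" and k: "k \<in> hom FC S Y"
    and eq: "\<forall>i\<in>I. h \<odot> \<iota> i = k \<odot> \<iota> i"
  have hk: "IxMap h s = IxMap k s \<and> AtMap h s = AtMap k s" if s: "s \<in> Ix S" for s
  proof -
    obtain i a where i: "i \<in> I" and a: "a \<in> Ix (X i)" and s_eq: "IxMap (\<iota> i) a = s"
      using \<iota>(2)[OF s] by blast
    note ap = Fam_Comp_apply[OF \<iota>(1)[OF i] a]
    have Ix_eq: "IxMap h s = IxMap k s" and "AtMap h s \<cdot> AtMap (\<iota> i) a = AtMap k s \<cdot> AtMap (\<iota> i) a"
      using bspec[OF eq i] ap[of h] ap[of k] s_eq by simp_all
    moreover have "AtMap k s \<in> hom C (At S s) (At Y (IxMap h s))"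
      using Fam_homD(6)[OF k s] Ix_eq by simp
    ultimately show ?thesis
      using iso_cancel_right[OF \<iota>(4)[OF i a]] Fam_homD(6)[OF h s] s_eq by simp
  qed
  show "h = k" by (rule Fam_eqI[OF h k]) (simp_all add: hk)
qed

definition disjoint_union :: "'u set \<Rightarrow> ('u \<Rightarrow> ('u, 'o) fam) \<Rightarrow> ('u, 'o) fam" where
  "disjoint_union I X = \<lparr>Ix = pair ` (SIGMA i:I. Ix (X i)),
    At = (\<lambda>s \<in> pair ` (SIGMA i:I. Ix (X i)). At (X (fst (inv pair s))) (snd (inv pair s)))\<rparr>"

definition disjoint_incl ::
  "'u set \<Rightarrow> ('u \<Rightarrow> ('u, 'o) fam) \<Rightarrow> 'u \<Rightarrow> ('u, 'o, 'a) fam_arr" where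
  "disjoint_incl I X i =
    fam_map (X i) (disjoint_union I X) (\<lambda>a. pair (i, a)) (\<lambda>a. Ide C (At (X i) a))"

lemma covers_disjointly_disjoint_union:
  assumes I: "small I" and X: "\<forall>i\<in>I. X i \<in> Obj FC"
  shows "covers_disjointly I X (disjoint_union I X) (disjoint_incl I X)"
proof -
  let ?S = "disjoint_union I X" and ?\<kappa> = "disjoint_incl I X"
  have At: "At ?S (pair (i, a)) = At (X i) a" if "i \<in> I" "a \<in> Ix (X i)" for i a
    using that by (auto simp: disjoint_union_def)
  have XO: "At (X i) a \<in> Obj C" if "i \<in> I" "a \<in> Ix (X i)" for i a
    using X that by (simp add: Fam_Obj_iff)
  have S: "?S \<in> Obj FC"
    using small_pair_Sigma[OF I, of "\<lambda>i. Ix (X i)"] X XO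
    by (auto simp: Fam_Obj_iff disjoint_union_def)
  moreover have "?\<kappa> i \<in> hom FC (X i) ?S" if i: "i \<in> I" for i
    unfolding disjoint_incl_def
    by (rule fam_map_hom[OF bspec[OF X i] S])
      (use At[OF i] Ide_hom[OF XO[OF i]] i in \<open>auto simp: disjoint_union_def\<close>)
  moreover have "bij_betw (\<lambda>s. IxMap (?\<kappa> (fst s)) (snd s)) (SIGMA i:I. Ix (X i)) (Ix ?S)"
  proof -
    have "bij_betw pair (SIGMA i:I. Ix (X i)) (Ix ?S)"
      by (auto simp: bij_betw_def inj_on_def disjoint_union_def)
    moreover have "IxMap (?\<kappa> (fst s)) (snd s) = pair s" if "s \<in> (SIGMA i:I. Ix (X i))" for s
      using that by (auto simp: disjoint_incl_def)
    ultimately show ?thesis by (simp cong: bij_betw_cong)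
  qed
  moreover have "iso C (At (X i) a) (At ?S (IxMap (?\<kappa> i) a)) (AtMap (?\<kappa> i) a)"
    if "i \<in> I" "a \<in> Ix (X i)" for i a
    using iso_Ide[OF XO[OF that]] At[OF that] that by (simp add: disjoint_incl_def)
  ultimately show ?thesis by (simp add: covers_disjointly_def)
qed

text \<open>The explicit disjoint union is also a coproduct. The comparison \<open>e\<close> with it
  is bijective on indices and invertible on components, which transports the description to
  \<open>S\<close>.\<close>

lemma Fam_is_coproductD:
  assumes I: "small I" and X: "\<forall>i\<in>I. X i \<in> Obj FC" and S: "is_coproduct FC I X S \<iota>"
  shows "covers_disjointly I X S \<iota>"
proof -
  let ?T = "disjoint_union I X" and ?\<kappa> = "disjoint_incl I X"
  note T = covers_disjointly_disjoint_union[OF I X]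
  note \<kappa> = covers_disjointlyD[OF T]
  obtain e where e: "iso FC ?T S e" and e\<kappa>: "\<forall>i\<in>I. e \<odot> ?\<kappa> i = \<iota> i"
    using Fam.is_coproduct_comparison[OF Fam_is_coproductI[OF T] S] .
  have ap: "IxMap (\<iota> i) a = IxMap e (pair (i, a))" "AtMap (\<iota> i) a = AtMap e (pair (i, a))"
    "At ?T (pair (i, a)) = At (X i) a" "pair (i, a) \<in> Ix ?T"
    if i: "i \<in> I" and a: "a \<in> Ix (X i)" for i a
  proof -
    show p: "pair (i, a) \<in> Ix ?T" and At: "At ?T (pair (i, a)) = At (X i) a"
      using i a by (auto simp: disjoint_union_def)
    have k: "IxMap (?\<kappa> i) a = pair (i, a)" "AtMap (?\<kappa> i) a = Ide C (At (X i) a)"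
      using a by (simp_all add: disjoint_incl_def)
    show "IxMap (\<iota> i) a = IxMap e (pair (i, a))"
      using Fam_Comp_apply(1)[OF \<kappa>(1)[OF i] a, of e] bspec[OF e\<kappa> i] k by simp
    show "AtMap (\<iota> i) a = AtMap e (pair (i, a))"
      using Fam_Comp_apply(2)[OF \<kappa>(1)[OF i] a, of e] bspec[OF e\<kappa> i] k
        Comp_Ide[OF Fam_homD(6)[OF iso_hom[OF e] p]] At by simp
  qed
  have "bij_betw (IxMap e \<circ> pair) (SIGMA i:I. Ix (X i)) (Ix S)"
    by (rule bij_betw_trans[OF _ Fam_isoD(1)[OF e]])
      (auto simp: bij_betw_def inj_on_def disjoint_union_def)
  moreover have "IxMap (\<iota> (fst s)) (snd s) = (IxMap e \<circ> pair) s" if "s \<in> (SIGMA i:I. Ix (X i))" for s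
    using that ap(1) by auto
  ultimately have "bij_betw (\<lambda>s. IxMap (\<iota> (fst s)) (snd s)) (SIGMA i:I. Ix (X i)) (Ix S)"
    by (simp cong: bij_betw_cong)
  moreover have "iso C (At (X i) a) (At S (IxMap (\<iota> i) a)) (AtMap (\<iota> i) a)"
    if "i \<in> I" "a \<in> Ix (X i)" for i a
    using Fam_isoD(2)[OF e ap(4)[OF that]] ap[OF that] by simp
  ultimately show ?thesis
    using Fam.is_coproduct_Obj[OF S] Fam.is_coproduct_homs[OF S] by (simp add: covers_disjointly_def)
qed

text \<open>Inclusions are injective on indices and invertible on components, so both halves of a
  morphism cancel.\<close>

lemma covers_disjointly_mono:
  assumes S: "covers_disjointly I X S \<iota>" and i: "i \<in> I"
    and f: "f \<in> hom FC Z (X i)" and g: "g \<in> hom FC Z (X i)" and eq: "\<iota> i \<odot> f = \<iota> i \<odot> g"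
  shows "f = g"
proof -
  note \<iota> = covers_disjointlyD[OF S]
  have fg: "IxMap f z = IxMap g z \<and> AtMap f z = AtMap g z" if z: "z \<in> Ix Z" for z
  proof -
    note fz = Fam_homD(5)[OF f z] and gz = Fam_homD(5)[OF g z]
    note apf = Fam_Comp_apply[OF f z, of "\<iota> i"] and apg = Fam_Comp_apply[OF g z, of "\<iota> i"]
    have Ix_eq: "IxMap f z = IxMap g z" using \<iota>(3)[OF i i fz gz] eq apf(1) apg(1) by simp
    have "AtMap (\<iota> i) (IxMap f z) \<cdot> AtMap f z = AtMap (\<iota> i) (IxMap f z) \<cdot> AtMap g z"
      using eq apf(2) apg(2) Ix_eq by simp
    moreover have "AtMap g z \<in> hom C (At Z z) (At (X i) (IxMap f z))"
      using Fam_homD(6)[OF g z] Ix_eq by simp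
    ultimately show ?thesis
      using iso_cancel_left[OF \<iota>(4)[OF i fz] Fam_homD(6)[OF f z]] Ix_eq by blast
  qed
  show ?thesis by (rule Fam_eqI[OF f g]) (simp_all add: fg)
qed

text \<open>Landing in a summand is a condition on indices alone, because the components can be
  divided by those of the inclusion.\<close>

lemma covers_disjointly_factor:
  assumes S: "covers_disjointly I X S \<iota>" and i: "i \<in> I" and XO: "X i \<in> Obj FC"
    and f: "f \<in> hom FC Z S" and im: "\<forall>z\<in>Ix Z. IxMap f z \<in> IxMap (\<iota> i) ` Ix (X i)"
  shows "\<exists>g. g \<in> hom FC Z (X i) \<and> \<iota> i \<odot> g = f"
proof -
  note \<iota> = covers_disjointlyD[OF S]
  have "\<forall>z\<in>Ix Z. \<exists>a. a \<in> Ix (X i) \<and> IxMap (\<iota> i) a = IxMap f z"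
  proof
    fix z assume "z \<in> Ix Z"
    then have "IxMap f z \<in> IxMap (\<iota> i) ` Ix (X i)" using im by simp
    then show "\<exists>a. a \<in> Ix (X i) \<and> IxMap (\<iota> i) a = IxMap f z" by (elim imageE) auto
  qed
  from bchoice[OF this] obtain a where a: "\<And>z. z \<in> Ix Z \<Longrightarrow> a z \<in> Ix (X i)"
    "\<And>z. z \<in> Ix Z \<Longrightarrow> IxMap (\<iota> i) (a z) = IxMap f z"
    by auto
  have "\<forall>z\<in>Ix Z. \<exists>v. v \<in> hom C (At S (IxMap f z)) (At (X i) (a z)) \<and>
      AtMap (\<iota> i) (a z) \<cdot> v = Ide C (At S (IxMap f z))"
  proof
    fix z assume z: "z \<in> Ix Z"
    show "\<exists>v. v \<in> hom C (At S (IxMap f z)) (At (X i) (a z)) \<and>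
        AtMap (\<iota> i) (a z) \<cdot> v = Ide C (At S (IxMap f z))"
      using \<iota>(4)[OF i a(1)[OF z]] a(2)[OF z] by (auto simp: iso_def)
  qed
  from bchoice[OF this] obtain v where
    v: "\<And>z. z \<in> Ix Z \<Longrightarrow> v z \<in> hom C (At S (IxMap f z)) (At (X i) (a z))"
      "\<And>z. z \<in> Ix Z \<Longrightarrow> AtMap (\<iota> i) (a z) \<cdot> v z = Ide C (At S (IxMap f z))"
    by auto
  define g where "g = fam_map Z (X i) a (\<lambda>z. v z \<cdot> AtMap f z)"
  have g: "g \<in> hom FC Z (X i)"
    unfolding g_def
    by (rule fam_map_hom[OF Fam_homD(1)[OF f] XO a(1)]) (auto intro: Comp_hom[OF Fam_homD(6)[OF f] v(1)])
  have "\<iota> i \<odot> g = f"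
  proof (rule Fam_eqI[OF Fam_Comp_hom[OF g \<iota>(1)[OF i]] f])
    fix z assume z: "z \<in> Ix Z"
    have gz: "IxMap g z = a z" "AtMap g z = v z \<cdot> AtMap f z" using z by (simp_all add: g_def)
    show "IxMap (\<iota> i \<odot> g) z = IxMap f z"
      using Fam_Comp_apply(1)[OF g z] gz a(2)[OF z] by simp
    have "AtMap (\<iota> i) (a z) \<in> hom C (At (X i) (a z)) (At S (IxMap f z))"
      using Fam_homD(6)[OF \<iota>(1)[OF i] a(1)[OF z]] a(2)[OF z] by simp
    from Comp_assoc[OF Fam_homD(6)[OF f z] v(1)[OF z] this]
    show "AtMap (\<iota> i \<odot> g) z = AtMap f z"
      using Fam_Comp_apply(2)[OF g z] gz v(2)[OF z] Ide_Comp[OF Fam_homD(6)[OF f z]] by simp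
  qed
  then show ?thesis using g by blast
qed

section \<open>Extensivity of the category of families\<close>

sublocale Fam: coprod_category FC small
proof unfold_locales
  show "has_small_coproducts small FC"
    unfolding has_small_coproducts_def
    using Fam_is_coproductI[OF covers_disjointly_disjoint_union] by blast
qed

lemma covers_disjointly_coprod:
  assumes "small I" "\<forall>i\<in>I. X i \<in> Obj FC"
  shows "covers_disjointly I X (coprod FC I X) (incl FC I X)"
  using Fam_is_coproductD[OF assms Fam.is_coproduct_coprod[OF assms]] .

text \<open>Followed into the sum of the \<open>X j\<close>, an index of \<open>Z\<close> must
  arrive in summand \<open>i\<close>, so \<open>q\<close> already takes its values in the summand
  \<open>A i\<close> and factors through it. The other equation and uniqueness come from cancelling
  inclusions.\<close>

lemma Fam_inclusions_pullback: "Fam.inclusions_pullback"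
  unfolding Fam.inclusions_pullback_def
proof (intro allI impI)
  fix I :: "'u set" and f A X i Z p q
  assume I: "small I" and f: "\<forall>i\<in>I. f i \<in> hom FC (A i) (X i)" and i: "i \<in> I"
    and p: "p \<in> hom FC Z (X i)" and q: "q \<in> hom FC Z (coprod FC I A)"
    and eq: "coprod_map FC I f \<odot> q = incl FC I X i \<odot> p"
  note A = Fam.ball_hom_Obj(1)[OF f] and X = Fam.ball_hom_Obj(2)[OF f]
  note cA = covers_disjointly_coprod[OF I A] and cX = covers_disjointly_coprod[OF I X]
  note \<iota>A = covers_disjointlyD[OF cA] and \<iota>X = covers_disjointlyD[OF cX]
  note F = Fam.coprod_map_hom[OF I f]
  note fi = bspec[OF f i]
  have "IxMap q z \<in> IxMap (incl FC I A i) ` Ix (A i)" if z: "z \<in> Ix Z" for z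
  proof -
    obtain j a where j: "j \<in> I" and a: "a \<in> Ix (A j)" and qz: "IxMap (incl FC I A j) a = IxMap q z"
      using \<iota>A(2)[OF Fam_homD(5)[OF q z]] by blast
    note fj = bspec[OF f j]
    have "IxMap (incl FC I X j) (IxMap (f j) a) = IxMap (incl FC I X j \<odot> f j) a"
      using Fam_Comp_apply(1)[OF fj a] by simp
    also have "\<dots> = IxMap (coprod_map FC I f) (IxMap q z)"
      using Fam.coprod_map_incl[OF I f j] Fam_Comp_apply(1)[OF \<iota>A(1)[OF j] a] qz by metis
    also have "\<dots> = IxMap (incl FC I X i) (IxMap p z)"
      using eq Fam_Comp_apply(1)[OF q z] Fam_Comp_apply(1)[OF p z] by metis
    finally have "j = i"
      using \<iota>X(3)[OF j i Fam_homD(5)[OF fj a] Fam_homD(5)[OF p z]] by blast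
    then show ?thesis using a qz by (metis imageI)
  qed
  then obtain h where h: "h \<in> hom FC Z (A i)" and \<iota>h: "incl FC I A i \<odot> h = q"
    using covers_disjointly_factor[OF cA i bspec[OF A i] q] by blast
  have "incl FC I X i \<odot> f i \<odot> h = (coprod_map FC I f \<odot> incl FC I A i) \<odot> h"
    using Fam.Comp_assoc[OF h fi \<iota>X(1)[OF i]] Fam.coprod_map_incl[OF I f i] by simp
  also have "\<dots> = incl FC I X i \<odot> p"
    using Fam.Comp_assoc[OF h \<iota>A(1)[OF i] F] \<iota>h eq by simp
  finally have "f i \<odot> h = p"
    using covers_disjointly_mono[OF cX i Fam_Comp_hom[OF h fi] p] by blast
  then show "\<exists>!h. h \<in> hom FC Z (A i) \<and> f i \<odot> h = p \<and> incl FC I A i \<odot> h = q"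
    using h \<iota>h covers_disjointly_mono[OF cA i] by (intro ex1I[of _ h]) auto
qed

lemma Fam_maps_decompose: "Fam.maps_decompose"
  unfolding Fam.maps_decompose_def
proof (intro allI impI)
  fix I :: "'u set" and X M f
  assume I: "small I" and X: "\<forall>i\<in>I. X i \<in> Obj FC" and f: "f \<in> hom FC M (coprod FC I X)"
  note cX = covers_disjointly_coprod[OF I X]
  note \<iota> = covers_disjointlyD[OF cX]
  note M = Fam_homD(1)[OF f]
  \<comment> \<open>The pieces are the restrictions of \<open>M\<close> to the fibres of the
    function that assigns to an index the summand reached by \<open>f\<close>. These fibres are
    disjoint and exhaust \<open>Ix M\<close>, which makes the pieces a coproduct with identity
    components.\<close>
  define B where "B i = {x \<in> Ix M. IxMap f x \<in> IxMap (incl FC I X i) ` Ix (X i)}" for i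
  define N where "N i = \<lparr>Ix = B i, At = restrict (At M) (B i)\<rparr>" for i
  define m where "m i = fam_map (N i) M (\<lambda>x. x) (\<lambda>x. Ide C (At M x))" for i
  have BM: "B i \<subseteq> Ix M" for i by (auto simp: B_def)
  have Ix_N: "Ix (N i) = B i" and At_N: "x \<in> B i \<Longrightarrow> At (N i) x = At M x" for i x
    by (simp_all add: N_def)
  have MO: "At M x \<in> Obj C" if "x \<in> B i" for x i
    using M BM[of i] that by (auto simp: Fam_Obj_iff)
  have N: "N i \<in> Obj FC" for i
    using M small_subset[OF _ BM] MO by (simp add: Fam_Obj_iff N_def)
  have m: "m i \<in> hom FC (N i) M" for i
    unfolding m_def
    by (rule fam_map_hom[OF N M]) (use BM Ide_hom[OF MO] in \<open>auto simp: Ix_N At_N\<close>)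
  have m_ap: "IxMap (m i) x = x" "AtMap (m i) x = Ide C (At M x)" if "x \<in> B i" for i x
    using that by (simp_all add: m_def Ix_N)
  have "covers_disjointly I N M m"
    unfolding covers_disjointly_def
  proof (intro conjI ballI)
    have "bij_betw snd (Sigma I B) (Ix M)"
      unfolding bij_betw_def
    proof
      show "inj_on snd (Sigma I B)"
      proof (rule inj_onI)
        fix s t assume s: "s \<in> Sigma I B" and t: "t \<in> Sigma I B" and eq: "snd s = snd t"
        obtain a where a: "a \<in> Ix (X (fst s))"
          "IxMap f (snd s) = IxMap (incl FC I X (fst s)) a" using s by (auto simp: B_def)
        obtain b where b: "b \<in> Ix (X (fst t))"
          "IxMap f (snd t) = IxMap (incl FC I X (fst t)) b" using t by (auto simp: B_def)
        have "fst s = fst t" using \<iota>(3)[OF _ _ a(1) b(1)] a(2) b(2) eq s t by auto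
        then show "s = t" using eq by (simp add: prod_eq_iff)
      qed
      show "snd ` Sigma I B = Ix M"
      proof
        show "snd ` Sigma I B \<subseteq> Ix M" by (auto simp: B_def)
        show "Ix M \<subseteq> snd ` Sigma I B"
        proof
          fix x assume x: "x \<in> Ix M"
          obtain i a where i: "i \<in> I" and "a \<in> Ix (X i)" "IxMap (incl FC I X i) a = IxMap f x"
            using \<iota>(2)[OF Fam_homD(5)[OF f x]] by (elim bexE)
          then have "x \<in> B i" using x imageI[of a "Ix (X i)" "IxMap (incl FC I X i)"]
            by (simp add: B_def)
          with i show "x \<in> snd ` Sigma I B" by (intro image_eqI[of _ _ "(i, x)"]) auto
        qed
      qed
    qed
    moreover have "IxMap (m (fst s)) (snd s) = snd s" if "s \<in> Sigma I B" for s
      using that m_ap(1) by auto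
    ultimately show "bij_betw (\<lambda>s. IxMap (m (fst s)) (snd s)) (SIGMA i:I. Ix (N i)) (Ix M)"
      using bij_betw_cong[of "Sigma I B" "\<lambda>s. IxMap (m (fst s)) (snd s)" snd "Ix M"]
      by (simp add: Ix_N)
  qed (use M m iso_Ide[OF MO] in \<open>auto simp: m_ap Ix_N At_N\<close>)
  then have cop: "is_coproduct FC I N M m" by (rule Fam_is_coproductI)
  have "\<exists>g. g \<in> hom FC (N i) (X i) \<and> incl FC I X i \<odot> g = f \<odot> m i" if i: "i \<in> I" for i
  proof (rule covers_disjointly_factor[OF cX i bspec[OF X i] Fam_Comp_hom[OF m f]])
    show "\<forall>x\<in>Ix (N i). IxMap (f \<odot> m i) x \<in> IxMap (incl FC I X i) ` Ix (X i)"
      using Fam_Comp_apply(1)[OF m] m_ap by (auto simp: Ix_N B_def)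
  qed
  then have "\<forall>i. \<exists>g. i \<in> I \<longrightarrow> g \<in> hom FC (N i) (X i) \<and> incl FC I X i \<odot> g = f \<odot> m i" by blast
  from choice[OF this] obtain g where
    "\<forall>i. i \<in> I \<longrightarrow> g i \<in> hom FC (N i) (X i) \<and> incl FC I X i \<odot> g i = f \<odot> m i" ..
  then have "\<forall>i\<in>I. g i \<in> hom FC (N i) (X i)" "\<forall>i\<in>I. f \<odot> m i = incl FC I X i \<odot> g i"
    by simp_all
  then show "\<exists>N m g. is_coproduct FC I N M m \<and>
      (\<forall>i\<in>I. g i \<in> hom FC (N i) (X i)) \<and> (\<forall>i\<in>I. f \<odot> m i = incl FC I X i \<odot> g i)"
    using cop by blast
qed

lemma extensive_Fam: "extensive small FC"
  using Fam.extensiveI[OF Fam_inclusions_pullback Fam_maps_decompose] .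

end

section \<open>Finite limits\<close>

lemma is_limit_cone: "is_limit J C D L \<pi> \<Longrightarrow> is_cone J C D L \<pi>"
  by (simp add: is_limit_def)

lemma is_limit_ex1: "is_limit J C D L \<pi> \<Longrightarrow> is_cone J C D M \<mu> \<Longrightarrow>
    \<exists>!h. h \<in> hom C M L \<and> (\<forall>j\<in>Obj J. Comp C (\<pi> j) h = \<mu> j)"
  by (simp add: is_limit_def)

lemma is_cone_hom: "is_cone J C D L \<pi> \<Longrightarrow> j \<in> Obj J \<Longrightarrow> \<pi> j \<in> hom C L (FObj D j)"
  by (simp add: is_cone_def)

lemma is_cone_Comp:
  "is_cone J C D L \<pi> \<Longrightarrow> u \<in> Arr J \<Longrightarrow> Comp C (FArr D u) (\<pi> (Dom J u)) = \<pi> (Cod J u)"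
  by (simp add: is_cone_def)

lemma is_limitI:
  assumes "is_cone J C D L \<pi>"
    and ex: "\<And>M \<mu>. is_cone J C D M \<mu> \<Longrightarrow>
      \<exists>h. h \<in> hom C M L \<and> (\<forall>j\<in>Obj J. Comp C (\<pi> j) h = \<mu> j)"
    and un: "\<And>M h k. h \<in> hom C M L \<Longrightarrow> k \<in> hom C M L \<Longrightarrow>
      \<forall>j\<in>Obj J. Comp C (\<pi> j) h = Comp C (\<pi> j) k \<Longrightarrow> h = k"
  shows "is_limit J C D L \<pi>"
  unfolding is_limit_def
proof (intro conjI allI impI assms(1))
  fix M \<mu> assume "is_cone J C D M \<mu>"
  from ex[OF this] obtain h where h: "h \<in> hom C M L" "\<forall>j\<in>Obj J. Comp C (\<pi> j) h = \<mu> j" by auto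
  show "\<exists>!h. h \<in> hom C M L \<and> (\<forall>j\<in>Obj J. Comp C (\<pi> j) h = \<mu> j)"
  proof (rule ex1I[of _ h])
    fix k assume "k \<in> hom C M L \<and> (\<forall>j\<in>Obj J. Comp C (\<pi> j) k = \<mu> j)"
    then show "k = h" using un[of k M h] h by simp
  qed (simp add: h)
qed

context is_functor
begin

lemma is_cone_precompose:
  assumes L: "is_cone A B F L \<pi>" and h: "h \<in> hom B M L"
  shows "is_cone A B F M (\<lambda>j. Comp B (\<pi> j) h)"
  unfolding is_cone_def
proof (intro conjI ballI)
  show "M \<in> Obj B" using B.hom_Obj[OF h] by simp
  fix j assume "j \<in> Obj A"
  then show "Comp B (\<pi> j) h \<in> hom B M (FObj F j)" using B.Comp_hom[OF h is_cone_hom[OF L]] by simp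
next
  fix u assume u: "u \<in> Arr A"
  show "Comp B (FArr F u) (Comp B (\<pi> (Dom A u)) h) = Comp B (\<pi> (Cod A u)) h"
    using B.Comp_assoc[OF h is_cone_hom[OF L A.Dom_Obj[OF u]] FArr_hom[OF A.Arr_hom[OF u]]]
      is_cone_Comp[OF L u] by simp
qed

lemma is_limit_eqI:
  assumes L: "is_limit A B F L \<pi>" and h: "h \<in> hom B M L" and k: "k \<in> hom B M L"
    and eq: "\<forall>j\<in>Obj A. Comp B (\<pi> j) h = Comp B (\<pi> j) k"
  shows "h = k"
proof -
  have "\<exists>!h. h \<in> hom B M L \<and> (\<forall>j\<in>Obj A. Comp B (\<pi> j) h = Comp B (\<pi> j) k)"
    using is_limit_ex1[OF L is_cone_precompose[OF is_limit_cone[OF L] k]] .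
  then obtain l where l: "\<forall>m. m \<in> hom B M L \<and> (\<forall>j\<in>Obj A. Comp B (\<pi> j) m = Comp B (\<pi> j) k) \<longrightarrow> m = l"
    unfolding Ex1_def by (elim exE conjE)
  have "h = l" using l[rule_format, of h] h eq by blast
  moreover have "k = l" using l[rule_format, of k] k by blast
  ultimately show ?thesis by simp
qed

end

section \<open>Finite limits of families\<close>

context category_smallness
begin

lemma Fam_limit_exists:
  fixes D :: "(nat, nat, ('u, 'o) fam, ('u, 'o, 'a) fam_arr) func"
  assumes lim: "has_finite_limits C" and J: "finite_category J" and D: "is_functor J FC D"
  shows "\<exists>L \<pi>. is_limit J FC D L \<pi>"
proof -
  interpret D: is_functor J FC D by fact
  have finJ: "finite (Obj J)" using J by (simp add: finite_category_def)
  let ?D = "FObj D" and ?d = "FArr D"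
  define K where "K = {x \<in> PiE (Obj J) (\<lambda>j. Ix (?D j)).
    \<forall>u\<in>Arr J. IxMap (?d u) (x (Dom J u)) = x (Cod J u)}"
  have DO: "small (Ix (?D j))" "\<And>a. a \<in> Ix (?D j) \<Longrightarrow> At (?D j) a \<in> Obj C" if "j \<in> Obj J" for j
    using D.FObj_Obj[OF that] by (simp_all add: Fam_Obj_iff)
  have K_Ix: "x j \<in> Ix (?D j)" if "x \<in> K" "j \<in> Obj J" for x j
    using that by (auto simp: K_def)
  have K_compat: "IxMap (?d u) (x j) = x k" if "x \<in> K" "u \<in> hom J j k" for x j k u
    using that by (auto simp: K_def hom_def)
  \<comment> \<open>For \<open>x\<close> in \<open>K\<close>, compatibility makes the target of
    \<open>AtMap (?d u) (x (Dom J u))\<close> the object selected at \<open>Cod J u\<close>; this is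
    why \<open>Dx x\<close> is a functor on \<open>J\<close>.\<close>
  define Dx where "Dx x = \<lparr>FObj = (\<lambda>j. At (?D j) (x j)), FArr = (\<lambda>u. AtMap (?d u) (x (Dom J u)))\<rparr>"
    for x
  have Dx_simps: "FObj (Dx x) j = At (?D j) (x j)" "FArr (Dx x) u = AtMap (?d u) (x (Dom J u))"
    for x j u
    by (simp_all add: Dx_def)
  have Dx: "is_functor J C (Dx x)" if x: "x \<in> K" for x
  proof (intro is_functor.intro is_functor_axioms.intro D.A.category_axioms category_axioms, goal_cases)
    case (1 j)
    then show ?case using DO(2)[OF 1 K_Ix[OF x 1]] by (simp add: Dx_simps)
  next
    case (2 u j k)
    have "x j \<in> Ix (?D j)" using K_Ix[OF x] D.A.hom_Obj[OF 2] by simp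
    from Fam_homD(6)[OF D.FArr_hom[OF 2] this] show ?case
      using K_compat[OF x 2] homD(2)[OF 2] by (simp add: Dx_simps)
  next
    case (3 j)
    then show ?case
      using homD(2)[OF D.A.Ide_hom[OF 3]] D.FArr_Ide[OF 3] Fam_Ide_apply(2)[OF K_Ix[OF x 3]]
      by (simp add: Dx_simps)
  next
    case (4 u j k v l)
    have "x j \<in> Ix (?D j)" using K_Ix[OF x] D.A.hom_Obj[OF 4(1)] by simp
    from Fam_Comp_apply(2)[OF D.FArr_hom[OF 4(1)] this] show ?case
      using D.FArr_Comp[OF 4] homD(2)[OF D.A.Comp_hom[OF 4]] homD(2)[OF 4(1)] homD(2)[OF 4(2)]
        K_compat[OF x 4(1)] by (simp add: Dx_simps)
  qed
  have "\<forall>x\<in>K. \<exists>L \<pi>. is_limit J C (Dx x) L \<pi>"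
    using lim J Dx unfolding has_finite_limits_def by simp
  from bchoice[OF this] obtain Lim where "\<forall>x\<in>K. \<exists>\<pi>. is_limit J C (Dx x) (Lim x) \<pi>" ..
  from bchoice[OF this] obtain p where p: "\<forall>x\<in>K. is_limit J C (Dx x) (Lim x) (p x)" ..
  note lim_x = bspec[OF p] and cone_x = is_limit_cone[OF bspec[OF p]]
  \<comment> \<open>Members of \<open>K\<close> are functions, but an index set must be a small
    subset of \<open>'u\<close>. Finiteness of \<open>Obj J\<close> provides the codes
    \<open>e\<close>, and \<open>dec\<close> undoes them on \<open>K\<close>.\<close>
  obtain e :: "(nat \<Rightarrow> 'u) \<Rightarrow> 'u" where e_inj: "inj_on e (PiE (Obj J) (\<lambda>j. Ix (?D j)))"
    and e_small: "small (e ` PiE (Obj J) (\<lambda>j. Ix (?D j)))"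
    using small_code_PiE[OF finJ, of "\<lambda>j. Ix (?D j)"] DO(1) by blast
  have K_sub: "K \<subseteq> PiE (Obj J) (\<lambda>j. Ix (?D j))" by (auto simp: K_def)
  define dec where "dec = inv_into K e"
  have dec: "dec (e x) = x" if "x \<in> K" for x
    unfolding dec_def using inv_into_f_f[OF inj_on_subset[OF e_inj K_sub] that] .
  have dec_K: "dec s \<in> K" and e_dec: "e (dec s) = s" if "s \<in> e ` K" for s
    using that dec by auto
  define L where "L = \<lparr>Ix = e ` K, At = (\<lambda>s\<in>e ` K. Lim (dec s))\<rparr>"
  have Ix_L: "Ix L = e ` K" and At_L: "s \<in> e ` K \<Longrightarrow> At L s = Lim (dec s)" for s
    by (simp_all add: L_def)
  have "Lim x \<in> Obj C" if "x \<in> K" for x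
    using cone_x[OF that] by (simp add: is_cone_def)
  then have L: "L \<in> Obj FC"
    using small_subset[OF e_small image_mono[OF K_sub]] dec
    by (auto simp: Fam_Obj_iff L_def)
  define \<pi> where "\<pi> j = fam_map L (?D j) (\<lambda>s. dec s j) (\<lambda>s. p (dec s) j)" for j
  have \<pi>_ap: "IxMap (\<pi> j) s = dec s j" "AtMap (\<pi> j) s = p (dec s) j" if "s \<in> Ix L" for s j
    using that by (simp_all add: \<pi>_def)
  have \<pi>: "\<pi> j \<in> hom FC L (?D j)" if j: "j \<in> Obj J" for j
    unfolding \<pi>_def
  proof (rule fam_map_hom[OF L D.FObj_Obj[OF j]])
    fix s assume "s \<in> Ix L"
    then have s: "s \<in> e ` K" by (simp add: Ix_L)
    show "dec s j \<in> Ix (?D j)" using K_Ix[OF dec_K[OF s] j] .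
    show "p (dec s) j \<in> hom C (At L s) (At (?D j) (dec s j))"
      using is_cone_hom[OF cone_x[OF dec_K[OF s]] j] At_L[OF s] by (simp add: Dx_simps)
  qed
  have "is_limit J FC D L \<pi>"
  proof (rule is_limitI)
    show "is_cone J FC D L \<pi>"
      unfolding is_cone_def
    proof (intro conjI ballI L \<pi>)
      fix u assume u: "u \<in> Arr J"
      note uh = D.A.Arr_hom[OF u] and j = D.A.Dom_Obj[OF u] and k = D.A.Cod_Obj[OF u]
      show "?d u \<odot> \<pi> (Dom J u) = \<pi> (Cod J u)"
      proof (rule Fam_eqI[OF Fam_Comp_hom[OF \<pi>[OF j] D.FArr_hom[OF uh]] \<pi>[OF k]])
        fix s assume s: "s \<in> Ix L"
        then have sK: "dec s \<in> K" using dec_K by (simp add: Ix_L)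
        show "IxMap (?d u \<odot> \<pi> (Dom J u)) s = IxMap (\<pi> (Cod J u)) s"
          using Fam_Comp_apply(1)[OF \<pi>[OF j] s] \<pi>_ap[OF s] K_compat[OF sK uh] by simp
        show "AtMap (?d u \<odot> \<pi> (Dom J u)) s = AtMap (\<pi> (Cod J u)) s"
          using Fam_Comp_apply(2)[OF \<pi>[OF j] s] \<pi>_ap[OF s] is_cone_Comp[OF cone_x[OF sK] u]
          by (simp add: Dx_simps)
      qed
    qed
  next
    fix M \<mu> assume M: "is_cone J FC D M \<mu>"
    note \<mu> = is_cone_hom[OF M]
    have MO: "M \<in> Obj FC" using M by (simp add: is_cone_def)
    \<comment> \<open>Through the legs, an index \<open>m\<close> of the apex selects one compatible
      family. The components of the legs at \<open>m\<close> form a cone over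
      \<open>Dx (x m)\<close>, whose limit supplies the component of the mediating map.\<close>
    define x where "x m = (\<lambda>j\<in>Obj J. IxMap (\<mu> j) m)" for m
    have x_ap: "x m j = IxMap (\<mu> j) m" if "j \<in> Obj J" for m j
      using that by (simp add: x_def)
    have xK: "x m \<in> K" if m: "m \<in> Ix M" for m
    proof -
      have "x m \<in> PiE (Obj J) (\<lambda>j. Ix (?D j))" using Fam_homD(5)[OF \<mu> m] by (auto simp: x_def)
      moreover have "IxMap (?d u) (x m (Dom J u)) = x m (Cod J u)" if u: "u \<in> Arr J" for u
        using is_cone_Comp[OF M u] Fam_Comp_apply(1)[OF \<mu>[OF D.A.Dom_Obj[OF u]] m, of "?d u"]
          x_ap[OF D.A.Dom_Obj[OF u]] x_ap[OF D.A.Cod_Obj[OF u]] by simp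
      ultimately show ?thesis by (simp add: K_def)
    qed
    have cone: "is_cone J C (Dx (x m)) (At M m) (\<lambda>j. AtMap (\<mu> j) m)" if m: "m \<in> Ix M" for m
      unfolding is_cone_def
    proof (intro conjI ballI)
      show "At M m \<in> Obj C" using MO m by (simp add: Fam_Obj_iff)
      fix j assume j: "j \<in> Obj J"
      show "AtMap (\<mu> j) m \<in> hom C (At M m) (FObj (Dx (x m)) j)"
        using Fam_homD(6)[OF \<mu>[OF j] m] x_ap[OF j] by (simp add: Dx_simps)
    next
      fix u assume u: "u \<in> Arr J"
      note j = D.A.Dom_Obj[OF u]
      show "FArr (Dx (x m)) u \<cdot> AtMap (\<mu> (Dom J u)) m = AtMap (\<mu> (Cod J u)) m"
        using is_cone_Comp[OF M u] Fam_Comp_apply(2)[OF \<mu>[OF j] m, of "?d u"] x_ap[OF j]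
        by (simp add: Dx_simps)
    qed
    have "\<forall>m\<in>Ix M. \<exists>h. h \<in> hom C (At M m) (Lim (x m)) \<and> (\<forall>j\<in>Obj J. p (x m) j \<cdot> h = AtMap (\<mu> j) m)"
      using ex1_implies_ex[OF is_limit_ex1[OF lim_x[OF xK] cone]] by simp
    from bchoice[OF this] obtain a where
      a: "\<forall>m\<in>Ix M. a m \<in> hom C (At M m) (Lim (x m)) \<and> (\<forall>j\<in>Obj J. p (x m) j \<cdot> a m = AtMap (\<mu> j) m)" ..
    define h where "h = fam_map M L (\<lambda>m. e (x m)) a"
    have h: "h \<in> hom FC M L"
      unfolding h_def
    proof (rule fam_map_hom[OF MO L])
      fix m assume m: "m \<in> Ix M"
      show "e (x m) \<in> Ix L" using xK[OF m] by (simp add: Ix_L)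
      show "a m \<in> hom C (At M m) (At L (e (x m)))"
        using bspec[OF a m] xK[OF m] dec[OF xK[OF m]] by (simp add: At_L)
    qed
    have "\<pi> j \<odot> h = \<mu> j" if j: "j \<in> Obj J" for j
    proof (rule Fam_eqI[OF Fam_Comp_hom[OF h \<pi>[OF j]] \<mu>[OF j]])
      fix m assume m: "m \<in> Ix M"
      have hm: "IxMap h m = e (x m)" "AtMap h m = a m" "e (x m) \<in> Ix L"
        using m xK[OF m] by (simp_all add: h_def Ix_L)
      show "IxMap (\<pi> j \<odot> h) m = IxMap (\<mu> j) m"
        using Fam_Comp_apply(1)[OF h m, of "\<pi> j"] hm \<pi>_ap(1)[OF hm(3)] dec[OF xK[OF m]] x_ap[OF j]
        by simp
      show "AtMap (\<pi> j \<odot> h) m = AtMap (\<mu> j) m"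
        using Fam_Comp_apply(2)[OF h m, of "\<pi> j"] hm \<pi>_ap(2)[OF hm(3)] dec[OF xK[OF m]]
          bspec[OF a m] j by simp
    qed
    then show "\<exists>h. h \<in> hom FC M L \<and> (\<forall>j\<in>Obj J. \<pi> j \<odot> h = \<mu> j)" using h by blast
  next
    fix M h k assume h: "h \<in> hom FC M L" and k: "k \<in> hom FC M L"
      and eq: "\<forall>j\<in>Obj J. \<pi> j \<odot> h = \<pi> j \<odot> k"
    have hk: "IxMap h m = IxMap k m \<and> AtMap h m = AtMap k m" if m: "m \<in> Ix M" for m
    proof -
      note hm = Fam_homD(5)[OF h m] and km = Fam_homD(5)[OF k m]
      have hK: "dec (IxMap h m) \<in> K" and kK: "dec (IxMap k m) \<in> K"
        using dec_K hm km by (simp_all add: Ix_L)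
      have dec_eq: "dec (IxMap h m) j = dec (IxMap k m) j" if j: "j \<in> Obj J" for j
        using bspec[OF eq j] Fam_Comp_apply(1)[OF h m, of "\<pi> j"] Fam_Comp_apply(1)[OF k m, of "\<pi> j"]
          \<pi>_ap(1)[OF hm] \<pi>_ap(1)[OF km] by simp
      \<comment> \<open>Indices come first: the decoded families agree on \<open>Obj J\<close> and
        are extensional, so they and their codes are equal. Then the components of \<open>h\<close>
        and \<open>k\<close> lie in the same hom and can be compared by the limit in
        \<open>C\<close>.\<close>
      have "dec (IxMap h m) = dec (IxMap k m)"
        by (rule PiE_ext[OF subsetD[OF K_sub hK] subsetD[OF K_sub kK] dec_eq])
      from arg_cong[OF this, of e] have Ix_eq: "IxMap h m = IxMap k m"
        unfolding e_dec[OF hm[unfolded Ix_L]] e_dec[OF km[unfolded Ix_L]] .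
      have L_eq: "At L (IxMap h m) = Lim (dec (IxMap h m))" using hm At_L by (simp add: Ix_L)
      have "\<forall>j\<in>Obj J. p (dec (IxMap h m)) j \<cdot> AtMap h m = p (dec (IxMap h m)) j \<cdot> AtMap k m"
      proof
        fix j assume j: "j \<in> Obj J"
        show "p (dec (IxMap h m)) j \<cdot> AtMap h m = p (dec (IxMap h m)) j \<cdot> AtMap k m"
          using bspec[OF eq j] Fam_Comp_apply(2)[OF h m, of "\<pi> j"] Fam_Comp_apply(2)[OF k m, of "\<pi> j"]
            \<pi>_ap(2)[OF hm] \<pi>_ap(2)[OF km] Ix_eq by simp
      qed
      moreover have "AtMap h m \<in> hom C (At M m) (Lim (dec (IxMap h m)))"
        "AtMap k m \<in> hom C (At M m) (Lim (dec (IxMap h m)))"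
        using Fam_homD(6)[OF h m] Fam_homD(6)[OF k m] Ix_eq L_eq by simp_all
      ultimately show ?thesis
        using is_functor.is_limit_eqI[OF Dx[OF hK] lim_x[OF hK]] Ix_eq by blast
    qed
    show "h = k" by (rule Fam_eqI[OF h k]) (simp_all add: hk)
  qed
  then show ?thesis by blast
qed

lemma has_finite_limits_Fam: "has_finite_limits C \<Longrightarrow> has_finite_limits FC"
  using Fam_limit_exists unfolding has_finite_limits_def[of FC] by blast

end

section \<open>The coproduct functor preserves finite limits\<close>

locale extensive_Fam = extensive_category C small + category_smallness C small
  for C :: "('o, 'a) cat" and small :: "'u set \<Rightarrow> bool"
begin

abbreviation Sum_obj where "Sum_obj c \<equiv> coprod C (Ix c) (At c)"

abbreviation Sum_incl where "Sum_incl c \<equiv> incl C (Ix c) (At c)"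

abbreviation Sum_map where "Sum_map f \<equiv> FArr (Sum_func C) f"

lemma Fam_ObjD:
  assumes "c \<in> Obj FC"
  shows "small (Ix c)" "\<forall>x\<in>Ix c. At c x \<in> Obj C"
  using assms by (simp_all add: Fam_Obj_iff)

lemma Sum_Obj: "c \<in> Obj FC \<Longrightarrow> Sum_obj c \<in> Obj C"
  by (rule coprod_Obj[OF Fam_ObjD])

lemma Sum_incl_hom: "c \<in> Obj FC \<Longrightarrow> x \<in> Ix c \<Longrightarrow> Sum_incl c x \<in> hom C (At c x) (Sum_obj c)"
  by (rule incl_hom[OF Fam_ObjD])

lemma Sum_eqI:
  assumes "c \<in> Obj FC" "h \<in> hom C (Sum_obj c) y" "k \<in> hom C (Sum_obj c) y"
    "\<forall>x\<in>Ix c. h \<cdot> Sum_incl c x = k \<cdot> Sum_incl c x"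
  shows "h = k"
  using coprod_eqI[OF Fam_ObjD[OF assms(1)] assms(2-4)] .

lemma Sum_map_props:
  assumes f: "f \<in> hom FC c d"
  shows "Sum_map f \<in> hom C (Sum_obj c) (Sum_obj d) \<and>
    (\<forall>x\<in>Ix c. Sum_map f \<cdot> Sum_incl c x = Sum_incl d (IxMap f x) \<cdot> AtMap f x)"
proof -
  note c = Fam_homD(1)[OF f] and d = Fam_homD(2)[OF f]
  have "\<forall>x\<in>Ix c. Sum_incl d (IxMap f x) \<cdot> AtMap f x \<in> hom C (At c x) (Sum_obj d)"
    using Comp_hom[OF Fam_homD(6)[OF f] Sum_incl_hom[OF d Fam_homD(5)[OF f]]] by simp
  from cotuple_props[OF Fam_ObjD(1)[OF c] Sum_Obj[OF d] this] show ?thesis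
    using Fam_homD(3,4)[OF f] by (simp add: Sum_func_def)
qed

lemmas Sum_map_hom = Sum_map_props[THEN conjunct1]
lemmas Sum_map_incl = Sum_map_props[THEN conjunct2, THEN bspec]

text \<open>Evaluates \<open>Sum_map f\<close> on a map that factors through a summand; the pieces
  of a joint decomposition supply such maps.\<close>

lemma Sum_map_Comp_incl:
  assumes f: "f \<in> hom FC c d" and x: "x \<in> Ix c" and a: "a \<in> hom C Z (At c x)"
  shows "Sum_map f \<cdot> Sum_incl c x \<cdot> a = Sum_incl d (IxMap f x) \<cdot> AtMap f x \<cdot> a"
proof -
  note c = Fam_homD(1)[OF f] and d = Fam_homD(2)[OF f]
  have "Sum_map f \<cdot> Sum_incl c x \<cdot> a = (Sum_incl d (IxMap f x) \<cdot> AtMap f x) \<cdot> a"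
    using Comp_assoc[OF a Sum_incl_hom[OF c x] Sum_map_hom[OF f]] Sum_map_incl[OF f x] by simp
  then show ?thesis
    using Comp_assoc[OF a Fam_homD(6)[OF f x] Sum_incl_hom[OF d Fam_homD(5)[OF f x]]] by simp
qed

lemma is_functor_Sum_func: "is_functor FC C (Sum_func C)"
proof (intro is_functor.intro is_functor_axioms.intro category_Fam category_axioms, goal_cases)
  case (1 c)
  then show ?case using Sum_Obj by (simp add: Sum_func_def)
next
  case (2 f c d)
  then show ?case using Sum_map_hom[OF 2] by (simp add: Sum_func_def)
next
  case (3 c)
  have "Sum_map (Ide FC c) = Ide C (Sum_obj c)"
  proof (rule Sum_eqI[OF 3 Sum_map_hom[OF Fam_Ide_hom[OF 3]] Ide_hom[OF Sum_Obj[OF 3]]])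
    show "\<forall>x\<in>Ix c. Sum_map (Ide FC c) \<cdot> Sum_incl c x = Ide C (Sum_obj c) \<cdot> Sum_incl c x"
      using Sum_map_incl[OF Fam_Ide_hom[OF 3]] Comp_Ide[OF Sum_incl_hom[OF 3]]
        Ide_Comp[OF Sum_incl_hom[OF 3]] by (simp add: Fam_Ide_apply)
  qed
  then show ?case by (simp add: Sum_func_def)
next
  case (4 f c d g e)
  note c = Fam_homD(1)[OF 4(1)] and gf = Fam_Comp_hom[OF 4]
  show ?case
  proof (rule Sum_eqI[OF c Sum_map_hom[OF gf] Comp_hom[OF Sum_map_hom[OF 4(1)] Sum_map_hom[OF 4(2)]]])
    show "\<forall>x\<in>Ix c. Sum_map (g \<odot> f) \<cdot> Sum_incl c x = (Sum_map g \<cdot> Sum_map f) \<cdot> Sum_incl c x"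
    proof
      fix x assume x: "x \<in> Ix c"
      have "(Sum_map g \<cdot> Sum_map f) \<cdot> Sum_incl c x =
          Sum_map g \<cdot> Sum_incl d (IxMap f x) \<cdot> AtMap f x"
        using Comp_assoc[OF Sum_incl_hom[OF c x] Sum_map_hom[OF 4(1)] Sum_map_hom[OF 4(2)]]
          Sum_map_incl[OF 4(1) x] by simp
      also have "\<dots> = Sum_map (g \<odot> f) \<cdot> Sum_incl c x"
        using Sum_map_Comp_incl[OF 4(2) Fam_homD(5)[OF 4(1) x] Fam_homD(6)[OF 4(1) x]]
          Sum_map_incl[OF gf x] Fam_Comp_apply[OF 4(1) x] by simp
      finally show "Sum_map (g \<odot> f) \<cdot> Sum_incl c x = (Sum_map g \<cdot> Sum_map f) \<cdot> Sum_incl c x" by simp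
    qed
  qed
qed

text \<open>The singleton family on \<open>Z\<close>, under an arbitrary index. A morphism from it
  to \<open>c\<close> is an index \<open>x\<close> with a map from \<open>Z\<close> to
  \<open>At c x\<close>: the data of a map into the sum through one summand.\<close>

definition point :: "'o \<Rightarrow> ('u, 'o) fam" where
  "point Z = \<lparr>Ix = {undefined}, At = (\<lambda>_\<in>{undefined}. Z)\<rparr>"

definition point_map :: "'o \<Rightarrow> ('u, 'o) fam \<Rightarrow> 'u \<Rightarrow> 'a \<Rightarrow> ('u, 'o, 'a) fam_arr" where
  "point_map Z c x a = fam_map (point Z) c (\<lambda>_. x) (\<lambda>_. a)"

lemma point_map_apply [simp]:
  "IxMap (point_map Z c x a) undefined = x" "AtMap (point_map Z c x a) undefined = a"
  by (simp_all add: point_map_def point_def)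

lemma point_simps [simp]: "Ix (point Z) = {undefined}" "At (point Z) undefined = Z"
  by (simp_all add: point_def)

lemma point_Obj: "Z \<in> Obj C \<Longrightarrow> point Z \<in> Obj FC"
  by (simp add: Fam_Obj_iff small_finite) (simp add: point_def)

lemma point_map_hom:
  assumes "c \<in> Obj FC" "x \<in> Ix c" "a \<in> hom C Z (At c x)"
  shows "point_map Z c x a \<in> hom FC (point Z) c"
  unfolding point_map_def
  using fam_map_hom[OF point_Obj[OF hom_Obj(1)[OF assms(3)]] assms(1)] assms(2,3) by simp

lemma Comp_point_map:
  assumes f: "f \<in> hom FC c d" and x: "x \<in> Ix c" and a: "a \<in> hom C Z (At c x)"
  shows "f \<odot> point_map Z c x a = point_map Z d (IxMap f x) (AtMap f x \<cdot> a)"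
proof -
  note p = point_map_hom[OF Fam_homD(1)[OF f] x a]
  have q: "point_map Z d (IxMap f x) (AtMap f x \<cdot> a) \<in> hom FC (point Z) d"
    using point_map_hom[OF Fam_homD(2)[OF f] Fam_homD(5)[OF f x] Comp_hom[OF a Fam_homD(6)[OF f x]]] .
  show ?thesis
    by (rule Fam_eqI[OF Fam_Comp_hom[OF p f] q]) (use Fam_Comp_apply[OF p] in simp_all)
qed

lemma hom_point_cases:
  assumes f: "f \<in> hom FC (point Z) c"
  obtains x a where "x \<in> Ix c" "a \<in> hom C Z (At c x)" "f = point_map Z c x a"
proof -
  let ?x = "IxMap f undefined" and ?a = "AtMap f undefined"
  have x: "?x \<in> Ix c" and a: "?a \<in> hom C Z (At c ?x)"
    using Fam_homD(5,6)[OF f, of undefined] by simp_all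
  have "f = point_map Z c ?x ?a"
    by (rule Fam_eqI[OF f point_map_hom[OF Fam_homD(2)[OF f] x a]]) simp_all
  then show ?thesis using that[OF x a] by simp
qed

lemma point_map_inject:
  "point_map Z c x a = point_map Z c y b \<Longrightarrow> x = y \<and> a = b"
  using point_map_apply by metis

text \<open>A map from a noninitial object into a sum remembers both the summand through which it
  factors and the factor. Equations in \<open>C\<close> between such maps therefore lift to
  \<open>Fam\<close>.\<close>

lemma Sum_incl_point_map:
  assumes c: "c \<in> Obj FC" and x: "x \<in> Ix c" and y: "y \<in> Ix c"
    and a: "a \<in> hom C Z (At c x)" and b: "b \<in> hom C Z (At c y)"
    and eq: "Sum_incl c x \<cdot> a = Sum_incl c y \<cdot> b" and Z: "\<not> initial Z"
  shows "point_map Z c x a = point_map Z c y b"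
  using inclusions_disjoint_mono[OF Fam_ObjD[OF c] x y a b eq] Z by auto

lemma Sum_preserves_limit:
  fixes D :: "(nat, nat, ('u, 'o) fam, ('u, 'o, 'a) fam_arr) func"
  assumes J: "finite_category J" and D: "is_functor J FC D" and lim: "is_limit J FC D L \<pi>"
  shows "is_limit J C (comp_func (Sum_func C) D) (Sum_obj L) (\<lambda>j. Sum_map (\<pi> j))"
proof (rule is_limitI)
  interpret D: is_functor J FC D by fact
  interpret S: is_functor FC C "Sum_func C" by (rule is_functor_Sum_func)
  let ?D = "FObj D" and ?d = "FArr D"
  have SD: "FObj (comp_func (Sum_func C) D) j = Sum_obj (?D j)"
    "FArr (comp_func (Sum_func C) D) u = Sum_map (?d u)" for j u
    by (simp_all add: comp_func_def Sum_func_def)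
  have finJ: "finite (Obj J)" using J by (simp add: finite_category_def)
  note cone = is_limit_cone[OF lim]
  note \<pi> = is_cone_hom[OF cone]
  have L: "L \<in> Obj FC" using cone by (simp add: is_cone_def)
  show "is_cone J C (comp_func (Sum_func C) D) (Sum_obj L) (\<lambda>j. Sum_map (\<pi> j))"
    unfolding is_cone_def SD
  proof (intro conjI ballI Sum_Obj[OF L] Sum_map_hom[OF \<pi>])
    fix u assume u: "u \<in> Arr J"
    show "Sum_map (?d u) \<cdot> Sum_map (\<pi> (Dom J u)) = Sum_map (\<pi> (Cod J u))"
      using S.FArr_Comp[OF \<pi>[OF D.A.Dom_Obj[OF u]] D.FArr_hom[OF D.A.Arr_hom[OF u]]]
        is_cone_Comp[OF cone u] by simp
  qed
  {
    fix M \<mu> assume M: "is_cone J C (comp_func (Sum_func C) D) M \<mu>"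
    have MO: "M \<in> Obj C" using M by (simp add: is_cone_def)
    have \<mu>: "\<mu> j \<in> hom C M (Sum_obj (?D j))" if "j \<in> Obj J" for j
      using is_cone_hom[OF M that] by (simp add: SD)
    have "\<forall>j\<in>Obj J. small (Ix (?D j)) \<and> (\<forall>x\<in>Ix (?D j). At (?D j) x \<in> Obj C) \<and>
        \<mu> j \<in> hom C M (Sum_obj (?D j))"
      using Fam_ObjD[OF D.FObj_Obj] \<mu> by simp
    from joint_decomposition[OF finJ MO this] obtain I :: "'u set" and N m where
      cop: "is_coproduct C I N M m"
      and fac: "\<forall>i\<in>I. \<forall>j\<in>Obj J. \<exists>x\<in>Ix (?D j). \<exists>a\<in>hom C (N i) (At (?D j) x).
        \<mu> j \<cdot> m i = Sum_incl (?D j) x \<cdot> a"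
      by (elim exE conjE)
    note m = is_coproduct_hom[OF cop]
    have "\<exists>k. k \<in> hom C (N i) (Sum_obj L) \<and> (\<forall>j\<in>Obj J. Sum_map (\<pi> j) \<cdot> k = \<mu> j \<cdot> m i)"
      if i: "i \<in> I" for i
    \<comment> \<open>On an initial piece the indices chosen for the legs need not be compatible;
      but any map to the sum of the limit will do, as maps out of \<open>N i\<close> are
      unique.\<close>
    proof (cases "initial (N i)")
      case True
      obtain k where k: "k \<in> hom C (N i) (Sum_obj L)" using initial_hom[OF True Sum_Obj[OF L]] ..
      have "Sum_map (\<pi> j) \<cdot> k = \<mu> j \<cdot> m i" if "j \<in> Obj J" for j
        using initial_eq[OF True Comp_hom[OF k Sum_map_hom[OF \<pi>[OF that]]]
            Comp_hom[OF m[OF i] \<mu>[OF that]]] .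
      then show ?thesis using k by blast
    next
      case False
      have "\<forall>j\<in>Obj J. \<exists>x. x \<in> Ix (?D j) \<and> (\<exists>a. a \<in> hom C (N i) (At (?D j) x) \<and>
          \<mu> j \<cdot> m i = Sum_incl (?D j) x \<cdot> a)"
        using bspec[OF fac i] by (simp add: Bex_def)
      from bchoice[OF this] obtain x where x: "\<forall>j\<in>Obj J. x j \<in> Ix (?D j) \<and>
          (\<exists>a. a \<in> hom C (N i) (At (?D j) (x j)) \<and> \<mu> j \<cdot> m i = Sum_incl (?D j) (x j) \<cdot> a)" ..
      then have "\<forall>j\<in>Obj J. \<exists>a. a \<in> hom C (N i) (At (?D j) (x j)) \<and>
          \<mu> j \<cdot> m i = Sum_incl (?D j) (x j) \<cdot> a" by simp
      from bchoice[OF this] obtain a where a_all: "\<forall>j\<in>Obj J. a j \<in> hom C (N i) (At (?D j) (x j)) \<and>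
          \<mu> j \<cdot> m i = Sum_incl (?D j) (x j) \<cdot> a j" ..
      have xj: "x j \<in> Ix (?D j)" and a: "a j \<in> hom C (N i) (At (?D j) (x j))"
        and \<mu>a: "\<mu> j \<cdot> m i = Sum_incl (?D j) (x j) \<cdot> a j" if "j \<in> Obj J" for j
        using x a_all that by simp_all
      define \<phi> where "\<phi> j = point_map (N i) (?D j) (x j) (a j)" for j
      have "is_cone J FC D (point (N i)) \<phi>"
        unfolding is_cone_def
      proof (intro conjI ballI)
        show "point (N i) \<in> Obj FC" using point_Obj hom_Obj(1)[OF m[OF i]] by simp
        fix j assume j: "j \<in> Obj J"
        show "\<phi> j \<in> hom FC (point (N i)) (?D j)"
          unfolding \<phi>_def using point_map_hom[OF D.FObj_Obj[OF j] xj[OF j] a[OF j]] .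
      next
        fix u assume u: "u \<in> Arr J"
        let ?j = "Dom J u" and ?k = "Cod J u"
        note j = D.A.Dom_Obj[OF u] and k = D.A.Cod_Obj[OF u]
        note du = D.FArr_hom[OF D.A.Arr_hom[OF u]]
        \<comment> \<open>The cone law in \<open>C\<close> equates two factorisations of one map
          through summands; as \<open>N i\<close> is not initial, it lifts to the cone law in
          \<open>Fam\<close>.\<close>
        have "Sum_incl (?D ?k) (IxMap (?d u) (x ?j)) \<cdot> AtMap (?d u) (x ?j) \<cdot> a ?j =
            Sum_map (?d u) \<cdot> \<mu> ?j \<cdot> m i"
          using Sum_map_Comp_incl[OF du xj[OF j] a[OF j]] \<mu>a[OF j] by simp
        also have "\<dots> = Sum_incl (?D ?k) (x ?k) \<cdot> a ?k"
          using Comp_assoc[OF m[OF i] \<mu>[OF j] Sum_map_hom[OF du]] is_cone_Comp[OF M u] \<mu>a[OF k]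
          by (simp add: SD)
        finally have "point_map (N i) (?D ?k) (IxMap (?d u) (x ?j)) (AtMap (?d u) (x ?j) \<cdot> a ?j) = \<phi> ?k"
          unfolding \<phi>_def
          by (rule Sum_incl_point_map[OF D.FObj_Obj[OF k] Fam_homD(5)[OF du xj[OF j]] xj[OF k]
                Comp_hom[OF a[OF j] Fam_homD(6)[OF du xj[OF j]]] a[OF k] _ False])
        then show "?d u \<odot> \<phi> ?j = \<phi> ?k"
          unfolding \<phi>_def using Comp_point_map[OF du xj[OF j] a[OF j]] by simp
      qed
      from ex1_implies_ex[OF is_limit_ex1[OF lim this]] obtain h where
        h: "h \<in> hom FC (point (N i)) L" and \<pi>h: "\<forall>j\<in>Obj J. \<pi> j \<odot> h = \<phi> j"
        by (elim exE conjE)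
      \<comment> \<open>The mediating morphism from a point is an index \<open>y\<close> of the
        limit with a map \<open>b\<close>; \<open>b\<close> followed by the inclusion at
        \<open>y\<close> is the map wanted on this piece.\<close>
      obtain y b where y: "y \<in> Ix L" and b: "b \<in> hom C (N i) (At L y)" and h_eq: "h = point_map (N i) L y b"
        using hom_point_cases[OF h] .
      have "Sum_map (\<pi> j) \<cdot> Sum_incl L y \<cdot> b = \<mu> j \<cdot> m i" if j: "j \<in> Obj J" for j
      proof -
        have "point_map (N i) (?D j) (IxMap (\<pi> j) y) (AtMap (\<pi> j) y \<cdot> b) =
            point_map (N i) (?D j) (x j) (a j)"
          using bspec[OF \<pi>h j] Comp_point_map[OF \<pi>[OF j] y b] by (simp add: h_eq \<phi>_def)
        then have "IxMap (\<pi> j) y = x j \<and> AtMap (\<pi> j) y \<cdot> b = a j" by (rule point_map_inject)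
        then show ?thesis using Sum_map_Comp_incl[OF \<pi>[OF j] y b] \<mu>a[OF j] by simp
      qed
      then show ?thesis using Comp_hom[OF b Sum_incl_hom[OF L y]] by blast
    qed
    then have "\<forall>i\<in>I. \<exists>k. k \<in> hom C (N i) (Sum_obj L) \<and> (\<forall>j\<in>Obj J. Sum_map (\<pi> j) \<cdot> k = \<mu> j \<cdot> m i)"
      by simp
    from bchoice[OF this] obtain k where
      k: "\<forall>i\<in>I. k i \<in> hom C (N i) (Sum_obj L) \<and> (\<forall>j\<in>Obj J. Sum_map (\<pi> j) \<cdot> k i = \<mu> j \<cdot> m i)" ..
    then have k': "\<forall>i\<in>I. k i \<in> hom C (N i) (Sum_obj L)" by simp
    obtain h where h: "h \<in> hom C M (Sum_obj L)" and hm: "\<forall>i\<in>I. h \<cdot> m i = k i"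
      using is_coproduct_factor[OF cop Sum_Obj[OF L] k'] .
    have "Sum_map (\<pi> j) \<cdot> h = \<mu> j" if j: "j \<in> Obj J" for j
    proof (rule is_coproduct_eqI[OF cop Comp_hom[OF h Sum_map_hom[OF \<pi>[OF j]]] \<mu>[OF j]])
      show "\<forall>i\<in>I. (Sum_map (\<pi> j) \<cdot> h) \<cdot> m i = \<mu> j \<cdot> m i"
        using Comp_assoc[OF m h Sum_map_hom[OF \<pi>[OF j]]] hm k j by simp
    qed
    then show "\<exists>h. h \<in> hom C M (Sum_obj L) \<and> (\<forall>j\<in>Obj J. Sum_map (\<pi> j) \<cdot> h = \<mu> j)" using h by blast
  }
  fix M h k assume h: "h \<in> hom C M (Sum_obj L)" and k: "k \<in> hom C M (Sum_obj L)"
    and eq: "\<forall>j\<in>Obj J. Sum_map (\<pi> j) \<cdot> h = Sum_map (\<pi> j) \<cdot> k"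
  note MO = hom_Obj(1)[OF h]
  \<comment> \<open>Decomposing \<open>h\<close> and \<open>k\<close> together makes both factor
    through single summands on every piece. Where a piece is not initial they become morphisms from
    a point to \<open>L\<close>, which are determined by their composites with the
    projections.\<close>
  have "\<forall>l\<in>{h, k}. small (Ix L) \<and> (\<forall>x\<in>Ix L. At L x \<in> Obj C) \<and> l \<in> hom C M (Sum_obj L)"
    using Fam_ObjD[OF L] h k by simp
  from joint_decomposition[OF _ MO this] obtain I :: "'u set" and N m where
    cop: "is_coproduct C I N M m"
    and fac: "\<forall>i\<in>I. \<forall>l\<in>{h, k}. \<exists>x\<in>Ix L. \<exists>a\<in>hom C (N i) (At L x). l \<cdot> m i = Sum_incl L x \<cdot> a"
    by auto
  note m = is_coproduct_hom[OF cop]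
  have "h \<cdot> m i = k \<cdot> m i" if i: "i \<in> I" for i
  proof (cases "initial (N i)")
    case True
    show ?thesis using initial_eq[OF True Comp_hom[OF m[OF i] h] Comp_hom[OF m[OF i] k]] .
  next
    case False
    obtain x a where x: "x \<in> Ix L" and a: "a \<in> hom C (N i) (At L x)" and ha: "h \<cdot> m i = Sum_incl L x \<cdot> a"
      using fac i by auto
    obtain y b where y: "y \<in> Ix L" and b: "b \<in> hom C (N i) (At L y)" and kb: "k \<cdot> m i = Sum_incl L y \<cdot> b"
      using fac i by auto
    have "\<forall>j\<in>Obj J. \<pi> j \<odot> point_map (N i) L x a = \<pi> j \<odot> point_map (N i) L y b"
    proof
      fix j assume j: "j \<in> Obj J"
      note \<pi>j = \<pi>[OF j] and S\<pi> = Sum_map_hom[OF \<pi>[OF j]]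
      have "Sum_map (\<pi> j) \<cdot> h \<cdot> m i = Sum_map (\<pi> j) \<cdot> k \<cdot> m i"
        using Comp_assoc[OF m[OF i] h S\<pi>] Comp_assoc[OF m[OF i] k S\<pi>] bspec[OF eq j] by simp
      then have "Sum_incl (?D j) (IxMap (\<pi> j) x) \<cdot> AtMap (\<pi> j) x \<cdot> a =
          Sum_incl (?D j) (IxMap (\<pi> j) y) \<cdot> AtMap (\<pi> j) y \<cdot> b"
        using Sum_map_Comp_incl[OF \<pi>j x a] Sum_map_Comp_incl[OF \<pi>j y b] ha kb by simp
      then have "point_map (N i) (?D j) (IxMap (\<pi> j) x) (AtMap (\<pi> j) x \<cdot> a) =
          point_map (N i) (?D j) (IxMap (\<pi> j) y) (AtMap (\<pi> j) y \<cdot> b)"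
        by (rule Sum_incl_point_map[OF D.FObj_Obj[OF j] Fam_homD(5)[OF \<pi>j x] Fam_homD(5)[OF \<pi>j y]
              Comp_hom[OF a Fam_homD(6)[OF \<pi>j x]] Comp_hom[OF b Fam_homD(6)[OF \<pi>j y]] _ False])
      then show "\<pi> j \<odot> point_map (N i) L x a = \<pi> j \<odot> point_map (N i) L y b"
        using Comp_point_map[OF \<pi>j x a] Comp_point_map[OF \<pi>j y b] by simp
    qed
    from D.is_limit_eqI[OF lim point_map_hom[OF L x a] point_map_hom[OF L y b] this]
    have "x = y \<and> a = b" by (rule point_map_inject)
    then show ?thesis using ha kb by simp
  qed
  then show "h = k" using is_coproduct_eqI[OF cop h k] by simp
qed

lemma Sum_func_preserves_finite_limits: "preserves_finite_limits FC C (Sum_func C)"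
proof -
  have "FObj (Sum_func C) L = Sum_obj L" for L :: "('u, 'o) fam" by (simp add: Sum_func_def)
  then show ?thesis
    unfolding preserves_finite_limits_def
    using is_functor_Sum_func Sum_preserves_limit by simp
qed

end

theorem theorem7p2:
  fixes small :: "'u set \<Rightarrow> bool" and C :: "('o, 'a) cat"
  assumes "smallness small"
    and "lextensive small C"
  shows "lextensive small (Fam small C) \<and>
    preserves_finite_limits (Fam small C) C (Sum_func C)"
proof -
  interpret smallness small by fact
  have ext: "extensive small C" and lim: "has_finite_limits C"
    using assms(2) by (simp_all add: lextensive_def)
  then interpret category C by (simp add: extensive_def)
  interpret extensive_Fam C small
    by unfold_locales (use ext in \<open>simp_all add: extensive_def\<close>)
  show ?thesis
    using extensive_Fam has_finite_limits_Fam[OF lim] Sum_func_preserves_finite_limits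
    by (simp add: lextensive_def)
qed

end
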